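(* Let $E,F$ be complex Banach spaces, $U\subseteq E$ open, $v$ a weight on $U$, $p\in(1,\infty)$, and $f\in\mathcal H_v^\infty(U,F)$. The following are equivalent: (i) $f\in\mathcal H^\infty_{v\mathcal K_{wp}}(U,F)$; (ii) there are a quotient space $G$ of $\ell_{p^*}$, a reflexive Banach space $H$, operators $T\in\mathcal L(G,H)$ and $Q\in\mathcal L(H,F)$ and a mapping $g\in\mathcal H^\infty_{v\mathcal K_{wp}}(U,G)$ such that $f=Q\circ T\circ g$. In this case, $$\inf\{\|Q\circ T\|\,\|g\|_{\mathcal H^\infty_{v\mathcal K_{wp}}}\}\le\|f\|_{\mathcal H^\infty_{v\mathcal K_{wp}}}\le\inf\{\|Q\|\,\|T\|\,\|g\|_{\mathcal H^\infty_{v\mathcal K_{wp}}}\},$$ where both infima are taken over all factorizations of $f$ as in (ii).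
   Context: A weight on $U$ is a strictly positive continuous function. $\mathcal H_v^\infty(U,F)$ is the Banach space of holomorphic $f\colon U\to F$ with $\|f\|_v:=\sup_{x\in U}v(x)\|f(x)\|<\infty$. $\mathcal L(X,Y)$ denotes the bounded linear operators with the operator norm. $p^*$ is the conjugate index of $p$. For a Banach space $X$, $\ell_p^w(X)$ is the space of sequences in $X$ with $\|(x_n)\|_p^w=\sup_{x^*\in B_{X^*}}(\sum|x^*(x_n)|^p)^{1/p}<\infty$, and $p\text{-}\mathrm{conv}(x_n)=\{\sum_n a_nx_n:(a_n)\in B_{\ell_{p^*}}\}$. A set $K\subseteq X$ is relatively weakly $p$-compact if $K\subseteq p\text{-}\mathrm{conv}(x_n)$ for some $(x_n)\in\ell_p^w(X)$, and $m_{\mathcal K_{wp}}(K)$ is the infimum of $\|(x_n)\|_p^w$ over all such sequences. $\mathcal H^\infty_{v\mathcal K_{wp}}(U,F)$ is the set of $f\in\mathcal H_v^\infty(U,F)$ such that $(vf)(U)=\{v(x)f(x):x\in U\}$ is relatively weakly $p$-compact, with $\|f\|_{\mathcal H^\infty_{v\mathcal K_{wp}}}=m_{\mathcal K_{wp}}((vf)(U))$. *)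

theory Defs
  imports "HOL-Analysis.Analysis" "HOL-Algebra.AbelCoset" "HOL-Algebra.Module"
begin

text \<open>
  The theorem quantifies existentially over Banach spaces, so spaces are given by explicit
  carriers: modules of HOL-Algebra over the field of complex numbers, together with a norm.
  The record fields \<open>mult\<close> and \<open>one\<close>, which modules inherit from rings, play no role.
\<close>

record 'a normed_module = "(complex, 'a) module" +
  vnorm :: "'a \<Rightarrow> real"

definition complex_scalars :: "complex normed_module" where
  "complex_scalars = \<lparr>carrier = UNIV, mult = (*), one = 1, zero = 0, add = (+),
     smult = (*), vnorm = cmod\<rparr>"

text \<open>\<open>Metric_space\<close> wants a symmetric nonnegative function on the whole type, hence the
  totalization outside the carrier.\<close>

definition ndist :: "'a normed_module \<Rightarrow> 'a \<Rightarrow> 'a \<Rightarrow> real" where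
  "ndist X x y =
     (if x \<in> carrier X \<and> y \<in> carrier X then vnorm X (x \<ominus>\<^bsub>X\<^esub> y) else 0)"

abbreviation norm_topology :: "'a normed_module \<Rightarrow> 'a topology" where
  "norm_topology X \<equiv> Metric_space.mtopology (carrier X) (ndist X)"

locale complex_normed_space = Module.module complex_scalars X
  for X :: "'a normed_module" (structure) +
  assumes vnorm_eq_0_iff: "x \<in> carrier X \<Longrightarrow> vnorm X x = 0 \<longleftrightarrow> x = \<zero>"
    and vnorm_triangle:
      "\<lbrakk>x \<in> carrier X; y \<in> carrier X\<rbrakk> \<Longrightarrow> vnorm X (x \<oplus> y) \<le> vnorm X x + vnorm X y"
    and vnorm_smult: "x \<in> carrier X \<Longrightarrow> vnorm X (c \<odot> x) = cmod c * vnorm X x"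

locale complex_banach_space = complex_normed_space +
  assumes complete: "Metric_space.mcomplete (carrier X) (ndist X)"

definition bounded_operators ::
    "'a normed_module \<Rightarrow> 'b normed_module \<Rightarrow> ('a \<Rightarrow> 'b) set" where
  "bounded_operators X Y = {T \<in> carrier X \<rightarrow>\<^sub>E carrier Y.
     (\<forall>x\<in>carrier X. \<forall>y\<in>carrier X. T (x \<oplus>\<^bsub>X\<^esub> y) = T x \<oplus>\<^bsub>Y\<^esub> T y) \<and>
     (\<forall>c. \<forall>x\<in>carrier X. T (c \<odot>\<^bsub>X\<^esub> x) = c \<odot>\<^bsub>Y\<^esub> T x) \<and>
     (\<exists>C. \<forall>x\<in>carrier X. vnorm Y (T x) \<le> C * vnorm X x)}"

definition op_norm :: "'a normed_module \<Rightarrow> 'b normed_module \<Rightarrow> ('a \<Rightarrow> 'b) \<Rightarrow> real" where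
  "op_norm X Y T = (SUP x\<in>{x \<in> carrier X. vnorm X x \<le> 1}. vnorm Y (T x))"

definition dual_space :: "'a normed_module \<Rightarrow> ('a \<Rightarrow> complex) normed_module" where
  "dual_space X = \<lparr>carrier = bounded_operators X complex_scalars,
     mult = undefined, one = undefined,
     zero = (\<lambda>x\<in>carrier X. 0),
     add = (\<lambda>\<phi> \<psi>. \<lambda>x\<in>carrier X. \<phi> x + \<psi> x),
     smult = (\<lambda>c \<phi>. \<lambda>x\<in>carrier X. c * \<phi> x),
     vnorm = op_norm X complex_scalars\<rparr>"

definition reflexive_space :: "'a normed_module \<Rightarrow> bool" where
  "reflexive_space X \<longleftrightarrow>
     (\<lambda>x. \<lambda>\<phi>\<in>carrier (dual_space X). \<phi> x) ` carrier X = carrier (dual_space (dual_space X))"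

definition lp_space :: "real \<Rightarrow> (nat \<Rightarrow> complex) normed_module" where
  "lp_space q = \<lparr>carrier = {a. summable (\<lambda>n. cmod (a n) powr q)},
     mult = undefined, one = undefined,
     zero = (\<lambda>n. 0),
     add = (\<lambda>a b n. a n + b n),
     smult = (\<lambda>c a n. c * a n),
     vnorm = (\<lambda>a. (\<Sum>n. cmod (a n) powr q) powr (1 / q))\<rparr>"

definition conj_index :: "real \<Rightarrow> real" where
  "conj_index p = p / (p - 1)"

definition closed_subspace :: "'a set \<Rightarrow> 'a normed_module \<Rightarrow> bool" where
  "closed_subspace N X \<longleftrightarrow> submodule N complex_scalars X \<and> closedin (norm_topology X) N"

text \<open>In \<open>smult\<close>, adding \<open>N\<close> makes the formula correct for the scalar \<open>0\<close> as well.\<close>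

definition quotient_space :: "'a normed_module \<Rightarrow> 'a set \<Rightarrow> 'a set normed_module" where
  "quotient_space X N = \<lparr>carrier = a_rcosets\<^bsub>X\<^esub> N,
     mult = undefined, one = undefined,
     zero = N,
     add = (\<lambda>A B. A <+>\<^bsub>X\<^esub> B),
     smult = (\<lambda>c A. N <+>\<^bsub>X\<^esub> ((\<lambda>x. c \<odot>\<^bsub>X\<^esub> x) ` A)),
     vnorm = (\<lambda>A. INF x\<in>A. vnorm X x)\<rparr>"

text \<open>Weakly \<open>p\<close>-summable sequences, the \<open>p\<close>-convex hull, and weakly \<open>p\<close>-compact sets\<close>

definition dual_ball :: "'a normed_module \<Rightarrow> ('a \<Rightarrow> complex) set" where
  "dual_ball X = {\<phi> \<in> carrier (dual_space X). vnorm (dual_space X) \<phi> \<le> 1}"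

definition weak_lp :: "real \<Rightarrow> 'a normed_module \<Rightarrow> (nat \<Rightarrow> 'a) set" where
  "weak_lp p X = {x. range x \<subseteq> carrier X \<and>
     (\<forall>\<phi>\<in>dual_ball X. (\<lambda>n. \<phi> (x n)) \<in> carrier (lp_space p)) \<and>
     bdd_above ((\<lambda>\<phi>. vnorm (lp_space p) (\<lambda>n. \<phi> (x n))) ` dual_ball X)}"

definition weak_lp_norm :: "real \<Rightarrow> 'a normed_module \<Rightarrow> (nat \<Rightarrow> 'a) \<Rightarrow> real" where
  "weak_lp_norm p X x = (SUP \<phi>\<in>dual_ball X. vnorm (lp_space p) (\<lambda>n. \<phi> (x n)))"

definition p_conv :: "real \<Rightarrow> 'a normed_module \<Rightarrow> (nat \<Rightarrow> 'a) \<Rightarrow> 'a set" where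
  "p_conv p X x = {y. \<exists>a\<in>carrier (lp_space (conj_index p)).
     vnorm (lp_space (conj_index p)) a \<le> 1 \<and>
     limitin (norm_topology X) (\<lambda>k. \<Oplus>\<^bsub>X\<^esub>n\<in>{..<k}. a n \<odot>\<^bsub>X\<^esub> x n) y sequentially}"

definition rel_weakly_p_compact :: "real \<Rightarrow> 'a normed_module \<Rightarrow> 'a set \<Rightarrow> bool" where
  "rel_weakly_p_compact p X K \<longleftrightarrow> K \<subseteq> carrier X \<and> (\<exists>x\<in>weak_lp p X. K \<subseteq> p_conv p X x)"

definition m_Kwp :: "real \<Rightarrow> 'a normed_module \<Rightarrow> 'a set \<Rightarrow> real" where
  "m_Kwp p X K = Inf {weak_lp_norm p X x | x. x \<in> weak_lp p X \<and> K \<subseteq> p_conv p X x}"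

definition weight_on :: "'e normed_module \<Rightarrow> 'e set \<Rightarrow> ('e \<Rightarrow> real) \<Rightarrow> bool" where
  "weight_on E U v \<longleftrightarrow>
     continuous_map (subtopology (norm_topology E) U) euclideanreal v \<and> (\<forall>x\<in>U. v x > 0)"

text \<open>Holomorphic means complex Frechet differentiable at every point of the open set \<open>U\<close>. Here
  and below, only the values on \<open>U\<close> of a mapping defined on \<open>U\<close> matter.\<close>

definition holomorphic_map ::
    "'e normed_module \<Rightarrow> 'e set \<Rightarrow> 'f normed_module \<Rightarrow> ('e \<Rightarrow> 'f) \<Rightarrow> bool" where
  "holomorphic_map E U F f \<longleftrightarrow> f \<in> U \<rightarrow> carrier F \<and>
     (\<forall>a\<in>U. \<exists>A\<in>bounded_operators E F. \<forall>\<epsilon>>0. \<exists>\<delta>>0. \<forall>x\<in>U. vnorm E (x \<ominus>\<^bsub>E\<^esub> a) < \<delta> \<longrightarrow>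
        vnorm F ((f x \<ominus>\<^bsub>F\<^esub> f a) \<ominus>\<^bsub>F\<^esub> A (x \<ominus>\<^bsub>E\<^esub> a)) \<le> \<epsilon> * vnorm E (x \<ominus>\<^bsub>E\<^esub> a))"

definition Hv_inf ::
    "'e normed_module \<Rightarrow> 'e set \<Rightarrow> ('e \<Rightarrow> real) \<Rightarrow> 'f normed_module \<Rightarrow> ('e \<Rightarrow> 'f) set" where
  "Hv_inf E U v F =
     {f. holomorphic_map E U F f \<and> bdd_above ((\<lambda>x. v x * vnorm F (f x)) ` U)}"

definition weighted_range ::
    "'e set \<Rightarrow> ('e \<Rightarrow> real) \<Rightarrow> 'f normed_module \<Rightarrow> ('e \<Rightarrow> 'f) \<Rightarrow> 'f set" where
  "weighted_range U v F f = (\<lambda>x. complex_of_real (v x) \<odot>\<^bsub>F\<^esub> f x) ` U"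

definition HvK_wp :: "real \<Rightarrow> 'e normed_module \<Rightarrow> 'e set \<Rightarrow> ('e \<Rightarrow> real) \<Rightarrow> 'f normed_module \<Rightarrow>
    ('e \<Rightarrow> 'f) set" where
  "HvK_wp p E U v F = {f \<in> Hv_inf E U v F. rel_weakly_p_compact p F (weighted_range U v F f)}"

definition HvK_wp_norm :: "real \<Rightarrow> 'e set \<Rightarrow> ('e \<Rightarrow> real) \<Rightarrow> 'f normed_module \<Rightarrow>
    ('e \<Rightarrow> 'f) \<Rightarrow> real" where
  "HvK_wp_norm p U v F f = m_Kwp p F (weighted_range U v F f)"

text \<open>
  HOL cannot quantify existentially over all types, so the reflexive spaces \<open>H\<close> range over all
  carriers inside a type \<open>'h\<close>. The theorem holds for every \<open>'h\<close> with at least as many elements as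
  \<open>nat \<Rightarrow> complex\<close>. Such a type contains a copy of every separable Banach space; and replacing \<open>H\<close> by
  the closure of the range of \<open>T\<close>, which is separable and reflexive, changes neither \<open>Q \<circ> T\<close> nor
  the norm of \<open>T\<close> and does not increase the norm of \<open>Q\<close>.
  The spaces \<open>G\<close> are spaces of cosets and need no such universe.
\<close>

definition is_factorization :: "real \<Rightarrow> 'e normed_module \<Rightarrow> 'e set \<Rightarrow> ('e \<Rightarrow> real) \<Rightarrow>
    'f normed_module \<Rightarrow> ('e \<Rightarrow> 'f) \<Rightarrow> (nat \<Rightarrow> complex) set normed_module \<Rightarrow> 'h normed_module \<Rightarrow>
    ((nat \<Rightarrow> complex) set \<Rightarrow> 'h) \<Rightarrow> ('h \<Rightarrow> 'f) \<Rightarrow> ('e \<Rightarrow> (nat \<Rightarrow> complex) set) \<Rightarrow> bool" where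
  "is_factorization p E U v F f G H T Q g \<longleftrightarrow>
     (\<exists>N. closed_subspace N (lp_space (conj_index p)) \<and>
          G = quotient_space (lp_space (conj_index p)) N) \<and>
     complex_banach_space H \<and> reflexive_space H \<and>
     T \<in> bounded_operators G H \<and> Q \<in> bounded_operators H F \<and>
     g \<in> HvK_wp p E U v G \<and>
     (\<forall>x\<in>U. f x = (Q \<circ> T \<circ> g) x)"

end

theory Submission
  imports Defs "HOL-Complex_Analysis.Cauchy_Integral_Formula"
begin

text \<open>
  Let \<open>q\<close> be the conjugate index of \<open>p\<close>. A weakly \<open>p\<close>-summable sequence \<open>(x\<^sub>n)\<close> in \<open>F\<close> gives the
  operator \<open>\<Phi> a = \<Sum> a\<^sub>n x\<^sub>n\<close> from \<open>\<ell>\<^sub>q\<close> to \<open>F\<close>, whose norm is at most the weak norm of \<open>(x\<^sub>n)\<close>. With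
  \<open>G = \<ell>\<^sub>q / ker \<Phi>\<close>, a map \<open>f\<close> with \<open>(vf)(U)\<close> in the \<open>p\<close>-convex hull of \<open>(x\<^sub>n)\<close> lifts through the
  injective operator induced by \<open>\<Phi>\<close> to a map \<open>g\<close> into \<open>G\<close>, and for \<open>H\<close> one can take \<open>G\<close> itself.

  Everything rests on one duality argument of Helly type: by the Hahn--Banach theorem in \<open>\<ell>\<^sub>p\<close> and
  \<open>\<ell>\<^sub>p\<^sup>* = \<ell>\<^sub>q\<close>, a linear \<open>\<Lambda>\<close> on the dual of a space containing \<open>(x\<^sub>n)\<close> with
  \<open>\<bar>\<Lambda> \<phi>\<bar> \<le> C \<parallel>(\<phi> x\<^sub>n)\<parallel>\<^sub>p\<close> is \<open>\<phi> \<mapsto> \<Sum> a\<^sub>n \<phi> x\<^sub>n\<close> for some \<open>a\<close> of norm at most \<open>C\<close>. Applied to the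
  images of the unit vectors in \<open>G\<close> it shows that \<open>G\<close> is reflexive. Applied to evaluation at a point
  \<open>y\<close> of \<open>F\<close> it shows that \<open>y\<close> is in \<open>\<Phi>\<close> of the ball of radius \<open>C\<close> as soon as
  \<open>\<bar>\<phi> y\<bar> \<le> C \<parallel>(\<phi> x\<^sub>n)\<parallel>\<^sub>p\<close> for all \<open>\<phi>\<close>. Hence the derivatives of \<open>f\<close> and the first order Taylor
  remainders lift to \<open>G\<close> with the estimates that the Cauchy inequalities give for the scalar
  functions \<open>\<phi> \<circ> f\<close> on complex lines, and \<open>g\<close> is Frechet differentiable.
\<close>

section \<open>Normed spaces and bounded operators\<close>

text \<open>The operator induced by \<open>\<Phi>\<close> on G is injective, but in general its
  inverse is unbounded, so differentiability of f does not pass to g by composition. What lifts is a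
  vector whose functionals are controlled by S \<phi>, the l_p norm of the values of \<phi> at the
  x_n, rather than by the norm of \<phi>. Near each point v is at least some m > 0, hence |\<phi> (f
  t)| \<le> S \<phi> / m there. The Cauchy inequalities are linear in the bound of the function, so
  derivatives and remainders inherit a multiple of S \<phi> whose factor does not involve \<phi>.
  The types force H to be a copy of G: the elements of G are sets of sequences, while H has to live
  in \<open>'h\<close>. T is the copying map and Q \<circ> T the induced operator, of norm at most
  the weak norm of (x_n). The norm of g is at most 1, because v g takes values in the image of the
  unit ball of l_q. This gives the first norm inequality; the second holds because bounded operators
  map p-convex hulls into p-convex hulls of the image sequences. Completeness of H is deduced from
  its reflexivity.\<close>

lemma complex_scalars_simps [simp]:
  "carrier complex_scalars = UNIV"
  "a \<oplus>\<^bsub>complex_scalars\<^esub> b = a + b"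
  "a \<otimes>\<^bsub>complex_scalars\<^esub> b = a * b"
  "\<zero>\<^bsub>complex_scalars\<^esub> = 0"
  "\<one>\<^bsub>complex_scalars\<^esub> = 1"
  "a \<odot>\<^bsub>complex_scalars\<^esub> b = a * b"
  "vnorm complex_scalars = cmod"
  by (simp_all add: complex_scalars_def)

lemma cring_complex_scalars: "cring complex_scalars"
proof (intro cringI abelian_groupI comm_monoidI)
  show "\<exists>y\<in>carrier complex_scalars. y \<oplus>\<^bsub>complex_scalars\<^esub> x = \<zero>\<^bsub>complex_scalars\<^esub>" for x
    by (rule bexI[of _ "- x"]) auto
qed (auto simp: algebra_simps)

text \<open>Negatives are not among the assumptions: (-1) \<odot> x is one, by
  \<open>l_distr\<close> and \<open>null\<close>. This suits sequence spaces and quotients, whose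
  records specify no subtraction.\<close>

lemma complex_normed_spaceI:
  fixes X (structure)
  assumes zero: "\<zero> \<in> carrier X"
    and add: "\<And>x y. x \<in> carrier X \<Longrightarrow> y \<in> carrier X \<Longrightarrow> x \<oplus> y \<in> carrier X"
    and assoc: "\<And>x y z. x \<in> carrier X \<Longrightarrow> y \<in> carrier X \<Longrightarrow> z \<in> carrier X
      \<Longrightarrow> (x \<oplus> y) \<oplus> z = x \<oplus> (y \<oplus> z)"
    and comm: "\<And>x y. x \<in> carrier X \<Longrightarrow> y \<in> carrier X \<Longrightarrow> x \<oplus> y = y \<oplus> x"
    and l_zero: "\<And>x. x \<in> carrier X \<Longrightarrow> \<zero> \<oplus> x = x"
    and smult: "\<And>c x. x \<in> carrier X \<Longrightarrow> c \<odot> x \<in> carrier X"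
    and l_distr: "\<And>c d x. x \<in> carrier X \<Longrightarrow> (c + d) \<odot> x = c \<odot> x \<oplus> d \<odot> x"
    and r_distr: "\<And>c x y. x \<in> carrier X \<Longrightarrow> y \<in> carrier X
      \<Longrightarrow> c \<odot> (x \<oplus> y) = c \<odot> x \<oplus> c \<odot> y"
    and smult_assoc: "\<And>c d x. x \<in> carrier X \<Longrightarrow> (c * d) \<odot> x = c \<odot> (d \<odot> x)"
    and one: "\<And>x. x \<in> carrier X \<Longrightarrow> 1 \<odot> x = x"
    and null: "\<And>x. x \<in> carrier X \<Longrightarrow> 0 \<odot> x = \<zero>"
    and norm_0: "\<And>x. x \<in> carrier X \<Longrightarrow> vnorm X x = 0 \<longleftrightarrow> x = \<zero>"
    and triangle: "\<And>x y. x \<in> carrier X \<Longrightarrow> y \<in> carrier X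
      \<Longrightarrow> vnorm X (x \<oplus> y) \<le> vnorm X x + vnorm X y"
    and norm_smult: "\<And>c x. x \<in> carrier X \<Longrightarrow> vnorm X (c \<odot> x) = cmod c * vnorm X x"
  shows "complex_normed_space X"
proof -
  have inv: "\<exists>y\<in>carrier X. y \<oplus> x = \<zero>" if "x \<in> carrier X" for x
    using l_distr[OF that, of "-1" 1] smult[OF that, of "-1"] null[OF that] one[OF that]
    by (intro bexI[of _ "(-1) \<odot> x"]) auto
  have "abelian_group X"
    by (intro abelian_groupI) (use assms inv in auto)
  then have "Module.module complex_scalars X"
    by (intro moduleI) (use assms cring_complex_scalars in auto)
  then show ?thesis
    by (intro complex_normed_space.intro complex_normed_space_axioms.intro)
      (use norm_0 triangle norm_smult in auto)
qed

lemma complex_normed_space_scalars: "complex_normed_space complex_scalars"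
  by (rule complex_normed_spaceI) (auto simp: algebra_simps norm_mult norm_triangle_ineq)

lemma complex_scalars_minus [simp]:
  "\<ominus>\<^bsub>complex_scalars\<^esub> a = - a" "a \<ominus>\<^bsub>complex_scalars\<^esub> b = a - b"
proof -
  interpret cring complex_scalars by (rule cring_complex_scalars)
  show *: "\<ominus>\<^bsub>complex_scalars\<^esub> a = - a" for a
    by (rule minus_equality) auto
  show "a \<ominus>\<^bsub>complex_scalars\<^esub> b = a - b" by (simp add: minus_eq *)
qed

context complex_normed_space
begin

lemma smult_cl [simp, intro]: "x \<in> carrier X \<Longrightarrow> c \<odot> x \<in> carrier X"
  using smult_closed by auto

lemma add_smult: "x \<in> carrier X \<Longrightarrow> (c + d) \<odot> x = c \<odot> x \<oplus> d \<odot> x"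
  using smult_l_distr[of c d x] by simp

lemma smult_add: "x \<in> carrier X \<Longrightarrow> y \<in> carrier X \<Longrightarrow> c \<odot> (x \<oplus> y) = c \<odot> x \<oplus> c \<odot> y"
  using smult_r_distr[of c x y] by simp

lemma smult_smult: "x \<in> carrier X \<Longrightarrow> c \<odot> (d \<odot> x) = (c * d) \<odot> x"
  using smult_assoc1[of c d x] by simp

lemma one_smult [simp]: "x \<in> carrier X \<Longrightarrow> 1 \<odot> x = x"
  using smult_one[of x] by simp

lemma zero_smult [simp]: "x \<in> carrier X \<Longrightarrow> 0 \<odot> x = \<zero>"
  using smult_l_null[of x] by simp

lemma minus_eq_smult: "x \<in> carrier X \<Longrightarrow> \<ominus> x = (-1) \<odot> x"
  using add_smult[of x "-1" 1] by (intro M.minus_equality) auto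

lemma smult_minus: "x \<in> carrier X \<Longrightarrow> c \<odot> (\<ominus> x) = \<ominus> (c \<odot> x)"
  by (simp add: minus_eq_smult smult_smult)

lemma diff_smult: "x \<in> carrier X \<Longrightarrow> (c - d) \<odot> x = c \<odot> x \<ominus> d \<odot> x"
  using add_smult[of x c "- d"] smult_smult[of x "-1" d] by (simp add: M.minus_eq minus_eq_smult)

lemma diff_closed [simp, intro]:
  "x \<in> carrier X \<Longrightarrow> y \<in> carrier X \<Longrightarrow> x \<ominus> y \<in> carrier X"
  by (simp add: M.minus_eq)

lemma diff_eq_zero_iff: "x \<in> carrier X \<Longrightarrow> y \<in> carrier X \<Longrightarrow> x \<ominus> y = \<zero> \<longleftrightarrow> x = y"
  by (metis M.minus_eq M.minus_equality M.minus_minus M.r_neg M.a_inv_closed)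

lemma vnorm_zero [simp]: "vnorm X \<zero> = 0"
  by (simp add: vnorm_eq_0_iff)

lemma vnorm_minus [simp]: "x \<in> carrier X \<Longrightarrow> vnorm X (\<ominus> x) = vnorm X x"
  by (simp add: minus_eq_smult vnorm_smult)

lemma vnorm_nonneg [simp]: "x \<in> carrier X \<Longrightarrow> 0 \<le> vnorm X x"
  using vnorm_triangle[of x "\<ominus> x"] by (simp add: M.r_neg)

lemma diff_swap: "x \<in> carrier X \<Longrightarrow> y \<in> carrier X \<Longrightarrow> \<ominus> (x \<ominus> y) = y \<ominus> x"
  by (simp add: M.minus_eq M.minus_add M.a_comm)

lemma vnorm_diff_commute:
  "x \<in> carrier X \<Longrightarrow> y \<in> carrier X \<Longrightarrow> vnorm X (x \<ominus> y) = vnorm X (y \<ominus> x)"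
  by (metis diff_closed diff_swap vnorm_minus)

lemma diff_add_diff:
  "x \<in> carrier X \<Longrightarrow> y \<in> carrier X \<Longrightarrow> z \<in> carrier X \<Longrightarrow> (x \<ominus> y) \<oplus> (y \<ominus> z) = x \<ominus> z"
  by (simp add: M.minus_eq M.a_assoc M.r_neg2 M.r_neg1)

lemma diff_add_cancel: "x \<in> carrier X \<Longrightarrow> y \<in> carrier X \<Longrightarrow> (x \<ominus> y) \<oplus> y = x"
  by (simp add: M.minus_eq M.a_assoc M.l_neg)

lemma add_diff_cancel: "x \<in> carrier X \<Longrightarrow> y \<in> carrier X \<Longrightarrow> (x \<oplus> y) \<ominus> x = y"
  using M.r_neg1[of x y] by (simp add: M.minus_eq M.a_ac)

lemma diff_zero: "x \<in> carrier X \<Longrightarrow> x \<ominus> \<zero> = x"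
  by (simp add: M.minus_eq)

lemma add_diff_add:
  "\<lbrakk>x \<in> carrier X; y \<in> carrier X; z \<in> carrier X; w \<in> carrier X\<rbrakk>
    \<Longrightarrow> (x \<oplus> y) \<ominus> (z \<oplus> w) = (x \<ominus> z) \<oplus> (y \<ominus> w)"
  by (simp add: M.minus_eq M.minus_add M.a_ac)

lemma vnorm_triangle_diff:
  "x \<in> carrier X \<Longrightarrow> y \<in> carrier X \<Longrightarrow> z \<in> carrier X
    \<Longrightarrow> vnorm X (x \<ominus> z) \<le> vnorm X (x \<ominus> y) + vnorm X (y \<ominus> z)"
  using vnorm_triangle[of "x \<ominus> y" "y \<ominus> z"] by (simp add: diff_add_diff)

lemma vnorm_le_diff:
  "x \<in> carrier X \<Longrightarrow> y \<in> carrier X \<Longrightarrow> vnorm X x \<le> vnorm X (x \<ominus> y) + vnorm X y"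
  using vnorm_triangle[of "x \<ominus> y" y] by (simp add: diff_add_cancel)

sublocale metric: Metric_space "carrier X" "ndist X"
proof
  show "0 \<le> ndist X x y" for x y by (simp add: ndist_def)
  show "ndist X x y = ndist X y x" for x y by (simp add: ndist_def vnorm_diff_commute)
  show "ndist X x y = 0 \<longleftrightarrow> x = y" if "x \<in> carrier X" "y \<in> carrier X" for x y
    using that by (simp add: ndist_def vnorm_eq_0_iff diff_eq_zero_iff)
  show "ndist X x z \<le> ndist X x y + ndist X y z"
    if "x \<in> carrier X" "y \<in> carrier X" "z \<in> carrier X" for x y z
    using that by (simp add: ndist_def vnorm_triangle_diff)
qed

lemma limitin_norm_iff:
  assumes "\<And>n. s n \<in> carrier X"
  shows "limitin (norm_topology X) s l sequentially
    \<longleftrightarrow> l \<in> carrier X \<and> (\<lambda>n. vnorm X (s n \<ominus> l)) \<longlonglongrightarrow> 0"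
proof (cases "l \<in> carrier X")
  case True
  have "(\<lambda>n. vnorm X (s n \<ominus> l)) \<longlonglongrightarrow> 0
    \<longleftrightarrow> (\<forall>e>0. \<exists>N. \<forall>n\<ge>N. vnorm X (s n \<ominus> l) < e)"
    using assms True by (simp add: LIMSEQ_iff)
  then show ?thesis
    using assms True unfolding metric.limit_metric_sequentially by (auto simp: ndist_def)
next
  case False
  then show ?thesis unfolding metric.limit_metric_sequentially by auto
qed

lemma psum_Suc:
  assumes "\<And>n. s n \<in> carrier X"
  shows "(\<Oplus>n\<in>{..<Suc k}. s n) = (\<Oplus>n\<in>{..<k}. s n) \<oplus> s k"
  using assms by (simp add: lessThan_Suc M.finsum_insert M.a_comm Pi_def)

lemma psum_closed: "(\<And>n. s n \<in> carrier X) \<Longrightarrow> (\<Oplus>n\<in>{..<k::nat}. s n) \<in> carrier X"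
  by (rule M.finsum_closed) auto

end

section \<open>Bounded operators and the operator norm\<close>

lemma bounded_operatorsI:
  assumes "complex_normed_space X"
    and "\<And>x. x \<in> carrier X \<Longrightarrow> T x \<in> carrier Y"
    and "\<And>x y. x \<in> carrier X \<Longrightarrow> y \<in> carrier X \<Longrightarrow> T (x \<oplus>\<^bsub>X\<^esub> y) = T x \<oplus>\<^bsub>Y\<^esub> T y"
    and "\<And>c x. x \<in> carrier X \<Longrightarrow> T (c \<odot>\<^bsub>X\<^esub> x) = c \<odot>\<^bsub>Y\<^esub> T x"
    and "\<And>x. x \<in> carrier X \<Longrightarrow> vnorm Y (T x) \<le> C * vnorm X x"
  shows "restrict T (carrier X) \<in> bounded_operators X Y"
proof -
  interpret complex_normed_space X by fact
  show ?thesis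
    unfolding bounded_operators_def using assms by (auto intro!: exI[of _ C])
qed

lemma
  assumes "T \<in> bounded_operators X Y"
  shows bop_closed: "x \<in> carrier X \<Longrightarrow> T x \<in> carrier Y"
    and bop_add: "x \<in> carrier X \<Longrightarrow> y \<in> carrier X \<Longrightarrow> T (x \<oplus>\<^bsub>X\<^esub> y) = T x \<oplus>\<^bsub>Y\<^esub> T y"
    and bop_smult: "x \<in> carrier X \<Longrightarrow> T (c \<odot>\<^bsub>X\<^esub> x) = c \<odot>\<^bsub>Y\<^esub> T x"
    and bop_extensional: "T \<in> extensional (carrier X)"
    and bop_bound: "\<exists>C. \<forall>x\<in>carrier X. vnorm Y (T x) \<le> C * vnorm X x"
  using assms unfolding bounded_operators_def PiE_def by auto

locale normed_spaces = X: complex_normed_space X + Y: complex_normed_space Y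
  for X :: "'a normed_module" and Y :: "'b normed_module"
begin

lemma bop_zero:
  assumes "T \<in> bounded_operators X Y"
  shows "T \<zero>\<^bsub>X\<^esub> = \<zero>\<^bsub>Y\<^esub>"
  using bop_smult[OF assms, of "\<zero>\<^bsub>X\<^esub>" 0] bop_closed[OF assms, of "\<zero>\<^bsub>X\<^esub>"] by simp

lemma bop_diff:
  assumes "T \<in> bounded_operators X Y" "x \<in> carrier X" "y \<in> carrier X"
  shows "T (x \<ominus>\<^bsub>X\<^esub> y) = T x \<ominus>\<^bsub>Y\<^esub> T y"
  using assms bop_add[OF assms(1), of x "\<ominus>\<^bsub>X\<^esub> y"] bop_smult[OF assms(1), of y "-1"]
    bop_closed[OF assms(1)]
  by (simp add: X.M.minus_eq Y.M.minus_eq X.minus_eq_smult Y.minus_eq_smult)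

lemma bop_psum:
  assumes T: "T \<in> bounded_operators X Y" and s: "\<And>n. s n \<in> carrier X"
  shows "T (\<Oplus>\<^bsub>X\<^esub>n\<in>{..<k::nat}. s n) = (\<Oplus>\<^bsub>Y\<^esub>n\<in>{..<k}. T (s n))"
proof (induction k)
  case 0
  then show ?case using bop_zero[OF T] by simp
next
  case (Suc k)
  then show ?case
    using s by (simp add: X.psum_Suc Y.psum_Suc bop_closed[OF T] bop_add[OF T] X.psum_closed)
qed

lemma op_norm_bdd:
  assumes T: "\<And>x. x \<in> carrier X \<Longrightarrow> vnorm Y (T x) \<le> C * vnorm X x"
  shows "bdd_above ((\<lambda>x. vnorm Y (T x)) ` {x \<in> carrier X. vnorm X x \<le> 1})"
proof (rule bdd_aboveI2)
  fix x assume x: "x \<in> {x \<in> carrier X. vnorm X x \<le> 1}"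
  then have "vnorm Y (T x) \<le> C * vnorm X x" using T by auto
  also have "\<dots> \<le> \<bar>C\<bar> * 1" using x by (intro mult_mono) auto
  finally show "vnorm Y (T x) \<le> \<bar>C\<bar>" by simp
qed

text \<open>Scaling x to norm one turns the supremum over the unit ball into a homogeneous bound.
  The constant \<open>C\<close> only guarantees that the supremum is taken over a bounded
  set.\<close>

lemma vnorm_le_op_norm_gen:
  assumes closed: "\<And>x. x \<in> carrier X \<Longrightarrow> T x \<in> carrier Y"
    and smult: "\<And>c x. x \<in> carrier X \<Longrightarrow> T (c \<odot>\<^bsub>X\<^esub> x) = c \<odot>\<^bsub>Y\<^esub> T x"
    and bound: "\<And>x. x \<in> carrier X \<Longrightarrow> vnorm Y (T x) \<le> C * vnorm X x"
    and x: "x \<in> carrier X"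
  shows "vnorm Y (T x) \<le> op_norm X Y T * vnorm X x"
proof (cases "vnorm X x = 0")
  case True
  then show ?thesis using bound[OF x] by simp
next
  case False
  then have pos: "0 < vnorm X x" using X.vnorm_nonneg[OF x] by simp
  define c where "c = complex_of_real (1 / vnorm X x)"
  have "vnorm X (c \<odot>\<^bsub>X\<^esub> x) = 1" using pos x by (simp add: c_def X.vnorm_smult norm_divide)
  then have "vnorm Y (T (c \<odot>\<^bsub>X\<^esub> x)) \<le> op_norm X Y T"
    unfolding op_norm_def by (intro cSUP_upper op_norm_bdd[OF bound]) (use x in auto)
  moreover have "vnorm Y (T (c \<odot>\<^bsub>X\<^esub> x)) = vnorm Y (T x) / vnorm X x"
    using pos x by (simp add: smult Y.vnorm_smult closed c_def norm_divide)
  ultimately show ?thesis using pos by (simp add: divide_simps)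
qed

lemma vnorm_le_op_norm:
  assumes "T \<in> bounded_operators X Y" "x \<in> carrier X"
  shows "vnorm Y (T x) \<le> op_norm X Y T * vnorm X x"
proof -
  obtain C where "\<forall>x\<in>carrier X. vnorm Y (T x) \<le> C * vnorm X x" using bop_bound[OF assms(1)] by auto
  then show ?thesis
    by (intro vnorm_le_op_norm_gen[of T C]) (use assms bop_closed[OF assms(1)] bop_smult[OF assms(1)] in auto)
qed

lemma op_norm_le:
  assumes "\<And>x. x \<in> carrier X \<Longrightarrow> vnorm Y (T x) \<le> C * vnorm X x" "0 \<le> C"
  shows "op_norm X Y T \<le> C"
  unfolding op_norm_def
proof (rule cSUP_least)
  show "{x \<in> carrier X. vnorm X x \<le> 1} \<noteq> {}" by (auto intro!: exI[of _ "\<zero>\<^bsub>X\<^esub>"])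
  fix x assume x: "x \<in> {x \<in> carrier X. vnorm X x \<le> 1}"
  then have "vnorm Y (T x) \<le> C * vnorm X x" using assms by auto
  also have "\<dots> \<le> C * 1" using x assms by (intro mult_left_mono) auto
  finally show "vnorm Y (T x) \<le> C" by simp
qed

text \<open>Stated for arbitrary functions because the theorem takes the norm of
  \<open>Q \<circ> T\<close>, which need not be extensional and so need not belong to
  \<open>bounded_operators\<close>.\<close>

lemma op_norm_nonneg:
  assumes "\<And>x. x \<in> carrier X \<Longrightarrow> T x \<in> carrier Y"
    and "\<And>x. x \<in> carrier X \<Longrightarrow> vnorm Y (T x) \<le> C * vnorm X x"
  shows "0 \<le> op_norm X Y T"
proof -
  have "vnorm Y (T \<zero>\<^bsub>X\<^esub>) \<le> op_norm X Y T"
    unfolding op_norm_def by (intro cSUP_upper op_norm_bdd[OF assms(2)]) auto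
  moreover have "0 \<le> vnorm Y (T \<zero>\<^bsub>X\<^esub>)" using assms(1) by simp
  ultimately show ?thesis by linarith
qed

lemma bop_norm_nonneg: "T \<in> bounded_operators X Y \<Longrightarrow> 0 \<le> op_norm X Y T"
  using bop_bound op_norm_nonneg bop_closed by metis

lemma bop_limit:
  assumes T: "T \<in> bounded_operators X Y" and s: "\<And>n. s n \<in> carrier X"
    and l: "limitin (norm_topology X) s l sequentially"
  shows "limitin (norm_topology Y) (\<lambda>n. T (s n)) (T l) sequentially"
proof -
  have lX: "l \<in> carrier X" and lim: "(\<lambda>n. vnorm X (s n \<ominus>\<^bsub>X\<^esub> l)) \<longlonglongrightarrow> 0"
    using l s by (auto simp: X.limitin_norm_iff)
  have "(\<lambda>n. op_norm X Y T * vnorm X (s n \<ominus>\<^bsub>X\<^esub> l)) \<longlonglongrightarrow> op_norm X Y T * 0"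
    by (intro tendsto_intros lim)
  then have "(\<lambda>n. vnorm Y (T (s n) \<ominus>\<^bsub>Y\<^esub> T l)) \<longlonglongrightarrow> 0"
  proof (rule Lim_null_comparison[rotated, OF tendsto_eq_rhs])
    show "\<forall>\<^sub>F n in sequentially. norm (vnorm Y (T (s n) \<ominus>\<^bsub>Y\<^esub> T l))
        \<le> op_norm X Y T * vnorm X (s n \<ominus>\<^bsub>X\<^esub> l)"
      using vnorm_le_op_norm[OF T] s lX
      by (simp add: bop_diff[OF T, symmetric] bop_closed[OF T])
  qed simp
  then show ?thesis using s lX by (simp add: Y.limitin_norm_iff bop_closed[OF T])
qed

end

locale normed_space_dual = complex_normed_space
begin

sublocale dual: normed_spaces X complex_scalars
  by (intro normed_spaces.intro complex_normed_space_scalars) unfold_locales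

end

section \<open>The Hahn--Banach theorem\<close>

context complex_normed_space
begin

text \<open>Functionals on subspaces are represented by their graphs. No graph has to be assumed
  single-valued: the domination by the norm forces this.\<close>

definition real_graph :: "real \<Rightarrow> ('a \<times> real) set \<Rightarrow> bool" where
  "real_graph C g \<longleftrightarrow> g \<subseteq> carrier X \<times> UNIV \<and> (\<zero>, 0) \<in> g \<and>
     (\<forall>x t y u. (x, t) \<in> g \<longrightarrow> (y, u) \<in> g \<longrightarrow> (x \<oplus> y, t + u) \<in> g) \<and>
     (\<forall>x t r. (x, t) \<in> g \<longrightarrow> (complex_of_real r \<odot> x, r * t) \<in> g) \<and>
     (\<forall>x t. (x, t) \<in> g \<longrightarrow> t \<le> C * vnorm X x)"

lemma
  assumes "real_graph C g"
  shows real_graph_carrier: "(x, t) \<in> g \<Longrightarrow> x \<in> carrier X"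
    and real_graph_zero: "(\<zero>, 0) \<in> g"
    and real_graph_add: "(x, t) \<in> g \<Longrightarrow> (y, u) \<in> g \<Longrightarrow> (x \<oplus> y, t + u) \<in> g"
    and real_graph_smult: "(x, t) \<in> g \<Longrightarrow> (complex_of_real r \<odot> x, r * t) \<in> g"
    and real_graph_le: "(x, t) \<in> g \<Longrightarrow> t \<le> C * vnorm X x"
  using assms unfolding real_graph_def by blast+

text \<open>The difference of two values over the same x is a value over \<zero>, where the
  domination allows only numbers \<le> 0; exchanging the two values gives equality.\<close>

lemma real_graph_unique:
  assumes g: "real_graph C g" and xt: "(x, t) \<in> g" and xu: "(x, u) \<in> g"
  shows "t = u"
proof -
  have le: "t \<le> u" if "(x, t) \<in> g" "(x, u) \<in> g" for t u
  proof -
    have x: "x \<in> carrier X" using real_graph_carrier[OF g that(1)] .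
    have "(x \<oplus> complex_of_real (-1) \<odot> x, t + (-1) * u) \<in> g"
      using that by (intro real_graph_add[OF g] real_graph_smult[OF g])
    moreover have "x \<oplus> complex_of_real (-1) \<odot> x = \<zero>"
      using x by (simp add: minus_eq_smult[symmetric] M.r_neg)
    ultimately have "t + (-1) * u \<le> C * vnorm X \<zero>" using real_graph_le[OF g] by metis
    then show ?thesis by simp
  qed
  show ?thesis using le[OF xt xu] le[OF xu xt] by simp
qed

text \<open>A value c at \<open>x0\<close> respects the domination if it lies above all t - C ||x -
  x0|| and below all C ||y + x0|| - u, for (x, t) and (y, u) in \<open>g\<close>. The triangle
  inequality for (x - x0) + (y + x0) shows that no number of the first kind exceeds one of the
  second kind, and c is the supremum of the first kind. Whether \<open>x0\<close> is already in the
  domain does not matter, since a dominated graph is single-valued in any case.\<close>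

lemma real_graph_extend:
  assumes g: "real_graph C g" and C: "0 \<le> C" and x0: "x0 \<in> carrier X"
  shows "\<exists>c. real_graph C {(x \<oplus> complex_of_real r \<odot> x0, t + r * c) | x t r. (x, t) \<in> g}"
proof -
  define S where "S = {t - C * vnorm X (x \<ominus> x0) | x t. (x, t) \<in> g}"
  define c where "c = Sup S"
  have bound: "s \<le> C * vnorm X (x \<oplus> x0) - t" if s: "s \<in> S" and xt: "(x, t) \<in> g" for s x t
  proof -
    obtain y u where yu: "(y, u) \<in> g" "s = u - C * vnorm X (y \<ominus> x0)"
      using s unfolding S_def by blast
    have x: "x \<in> carrier X" "y \<in> carrier X" using real_graph_carrier[OF g] xt yu by auto
    have "u + t \<le> C * vnorm X (y \<oplus> x)"
      using real_graph_le[OF g real_graph_add[OF g yu(1) xt]] .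
    also have "y \<oplus> x = (y \<ominus> x0) \<oplus> (x \<oplus> x0)"
      using x x0 M.a_assoc[of "y \<ominus> x0" x0 x] by (simp add: diff_add_cancel M.a_comm[of x x0])
    also have "C * vnorm X ((y \<ominus> x0) \<oplus> (x \<oplus> x0)) \<le> C * (vnorm X (y \<ominus> x0) + vnorm X (x \<oplus> x0))"
      using x x0 C by (intro mult_left_mono vnorm_triangle) auto
    finally show ?thesis using yu by (simp add: algebra_simps)
  qed
  have S_ne: "S \<noteq> {}" using real_graph_zero[OF g] unfolding S_def by blast
  have upper: "c \<le> C * vnorm X (x \<oplus> x0) - t" if "(x, t) \<in> g" for x t
    unfolding c_def using S_ne bound[OF _ that] by (rule cSup_least)
  have S_bdd: "bdd_above S"
    using bound[OF _ real_graph_zero[OF g]] by (rule bdd_aboveI)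
  have lower: "t - C * vnorm X (x \<ominus> x0) \<le> c" if "(x, t) \<in> g" for x t
    unfolding c_def using that S_bdd by (intro cSup_upper) (unfold S_def, blast+)
  \<comment> \<open>The choice of c settles the coefficients 1 and -1 of \<open>x0\<close>; any
    other nonzero r is reduced to these by scaling (x, t) with 1 / |r|.\<close>
  have dom: "t + r * c \<le> C * vnorm X (x \<oplus> complex_of_real r \<odot> x0)" if xt: "(x, t) \<in> g" for x t r
  proof -
    have x: "x \<in> carrier X" using real_graph_carrier[OF g xt] .
    have scaled: "(complex_of_real (1/\<bar>r\<bar>) \<odot> x, (1/\<bar>r\<bar>) * t) \<in> g"
      using xt by (rule real_graph_smult[OF g])
    consider "r = 0" | "r > 0" | "r < 0" by linarith
    then show ?thesis
    proof cases
      case 1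
      then show ?thesis using x x0 real_graph_le[OF g xt] by simp
    next
      case 2
      have "x \<oplus> complex_of_real r \<odot> x0
          = complex_of_real r \<odot> (complex_of_real (1/\<bar>r\<bar>) \<odot> x \<oplus> x0)"
        using 2 x x0 by (simp add: smult_add smult_smult)
      then have "C * vnorm X (x \<oplus> complex_of_real r \<odot> x0)
          = r * (C * vnorm X (complex_of_real (1/\<bar>r\<bar>) \<odot> x \<oplus> x0))"
        using 2 x x0 by (simp add: vnorm_smult)
      moreover have "r * c \<le> r * (C * vnorm X (complex_of_real (1/\<bar>r\<bar>) \<odot> x \<oplus> x0) - (1/\<bar>r\<bar>) * t)"
        using upper[OF scaled] 2 by (intro mult_left_mono) auto
      ultimately show ?thesis using 2 by (auto simp: algebra_simps)
    next
      case 3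
      have "x \<oplus> complex_of_real r \<odot> x0
          = complex_of_real (- r) \<odot> (complex_of_real (1/\<bar>r\<bar>) \<odot> x \<ominus> x0)"
        using 3 x x0 by (simp add: smult_add smult_smult M.minus_eq minus_eq_smult)
      then have "C * vnorm X (x \<oplus> complex_of_real r \<odot> x0)
          = - r * (C * vnorm X (complex_of_real (1/\<bar>r\<bar>) \<odot> x \<ominus> x0))"
        using 3 x x0 by (simp add: vnorm_smult)
      moreover have "- r * ((1/\<bar>r\<bar>) * t - C * vnorm X (complex_of_real (1/\<bar>r\<bar>) \<odot> x \<ominus> x0)) \<le> - r * c"
        using lower[OF scaled] 3 by (intro mult_left_mono) auto
      ultimately show ?thesis using 3 by (auto simp: algebra_simps)
    qed
  qed
  let ?h = "{(x \<oplus> complex_of_real r \<odot> x0, t + r * c) | x t r. (x, t) \<in> g}"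
  have "real_graph C ?h"
    unfolding real_graph_def
  proof (intro conjI allI impI)
    show "?h \<subseteq> carrier X \<times> UNIV" using real_graph_carrier[OF g] x0 by auto
    show "(\<zero>, 0) \<in> ?h"
      using real_graph_zero[OF g] x0
      by (auto intro!: exI[of _ \<zero>] exI[of _ "0::real"])
  next
    fix x t y u assume "(x, t) \<in> ?h" "(y, u) \<in> ?h"
    then obtain x' t' r y' u' s where
      *: "(x', t') \<in> g" "(y', u') \<in> g" "x = x' \<oplus> complex_of_real r \<odot> x0" "t = t' + r * c"
        "y = y' \<oplus> complex_of_real s \<odot> x0" "u = u' + s * c" by auto
    have "x \<oplus> y = (x' \<oplus> y') \<oplus> complex_of_real (r + s) \<odot> x0"
      using * x0 real_graph_carrier[OF g *(1)] real_graph_carrier[OF g *(2)]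
      by (simp add: add_smult M.a_ac)
    moreover have "t + u = (t' + u') + (r + s) * c" using * by (simp add: algebra_simps)
    ultimately show "(x \<oplus> y, t + u) \<in> ?h" using real_graph_add[OF g *(1,2)] by blast
  next
    fix x t q assume "(x, t) \<in> ?h"
    then obtain x' t' r where
      *: "(x', t') \<in> g" "x = x' \<oplus> complex_of_real r \<odot> x0" "t = t' + r * c" by auto
    have "complex_of_real q \<odot> x
        = complex_of_real q \<odot> x' \<oplus> complex_of_real (q * r) \<odot> x0"
      using * x0 real_graph_carrier[OF g *(1)] by (simp add: smult_add smult_smult)
    moreover have "q * t = q * t' + (q * r) * c" using * by (simp add: algebra_simps)
    ultimately show "(complex_of_real q \<odot> x, q * t) \<in> ?h" using real_graph_smult[OF g *(1)] by blast
  next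
    fix x t assume "(x, t) \<in> ?h"
    then show "t \<le> C * vnorm X x" using dom by auto
  qed
  then show ?thesis by blast
qed

text \<open>Zorn's lemma for the dominated graphs that contain \<open>g\<close>, ordered by
  inclusion. A maximal one is defined on the whole carrier, because \<open>real_graph_extend\<close>
  at an arbitrary point cannot enlarge it.\<close>

theorem hahn_banach_real:
  assumes g: "real_graph C g" and C: "0 \<le> C"
  obtains U where "\<And>x t. (x, t) \<in> g \<Longrightarrow> U x = t"
    and "\<And>x y. x \<in> carrier X \<Longrightarrow> y \<in> carrier X \<Longrightarrow> U (x \<oplus> y) = U x + U y"
    and "\<And>r x. x \<in> carrier X \<Longrightarrow> U (complex_of_real r \<odot> x) = r * U x"
    and "\<And>x. x \<in> carrier X \<Longrightarrow> U x \<le> C * vnorm X x"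
proof -
  let ?A = "{h. real_graph C h \<and> g \<subseteq> h}"
  have "\<exists>M\<in>?A. \<forall>h\<in>?A. M \<subseteq> h \<longrightarrow> h = M"
  proof (rule subset_Zorn_nonempty)
    show "?A \<noteq> {}" using g by auto
    fix \<C> assume ne: "\<C> \<noteq> {}" and chain: "subset.chain ?A \<C>"
    have sub: "\<And>h. h \<in> \<C> \<Longrightarrow> real_graph C h \<and> g \<subseteq> h"
      using chain by (auto simp: subset_chain_def)
    have lin: "\<And>h k. h \<in> \<C> \<Longrightarrow> k \<in> \<C> \<Longrightarrow> h \<subseteq> k \<or> k \<subseteq> h"
      using chain by (auto simp: subset_chain_def)
    have "real_graph C (\<Union>\<C>)"
      unfolding real_graph_def
    proof (intro conjI allI impI)
      show "\<Union>\<C> \<subseteq> carrier X \<times> UNIV" using sub real_graph_carrier by fastforce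
      show "(\<zero>, 0) \<in> \<Union>\<C>" using ne sub real_graph_zero by blast
    next
      fix x t y u assume "(x, t) \<in> \<Union>\<C>" "(y, u) \<in> \<Union>\<C>"
      then obtain h k where "h \<in> \<C>" "k \<in> \<C>" "(x, t) \<in> h" "(y, u) \<in> k" by auto
      then obtain h where "h \<in> \<C>" "(x, t) \<in> h" "(y, u) \<in> h" using lin by blast
      then show "(x \<oplus> y, t + u) \<in> \<Union>\<C>" using sub real_graph_add by blast
    next
      fix x t r assume "(x, t) \<in> \<Union>\<C>"
      then show "(complex_of_real r \<odot> x, r * t) \<in> \<Union>\<C>" using sub real_graph_smult by blast
    next
      fix x t assume "(x, t) \<in> \<Union>\<C>"
      then show "t \<le> C * vnorm X x" using sub real_graph_le by blast
    qed
    then show "\<Union>\<C> \<in> ?A" using sub ne by blast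
  qed
  then obtain M where M: "real_graph C M" "g \<subseteq> M"
    and max: "\<And>h. real_graph C h \<Longrightarrow> g \<subseteq> h \<Longrightarrow> M \<subseteq> h \<Longrightarrow> h = M" by auto
  have total: "\<exists>t. (x, t) \<in> M" if x: "x \<in> carrier X" for x
  proof -
    obtain c where c: "real_graph C {(y \<oplus> complex_of_real r \<odot> x, t + r * c) | y t r. (y, t) \<in> M}"
      (is "real_graph C ?h") using real_graph_extend[OF M(1) C x] by blast
    have "M \<subseteq> ?h"
    proof
      fix z assume z: "z \<in> M"
      obtain y t where yt: "z = (y, t)" by (cases z)
      then have "y = y \<oplus> complex_of_real 0 \<odot> x" "t = t + 0 * c"
        using x real_graph_carrier[OF M(1)] z by auto
      then show "z \<in> ?h" using z yt by blast
    qed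
    then have "?h = M" using max[OF c] M(2) by blast
    moreover have "(\<zero> \<oplus> complex_of_real 1 \<odot> x, 0 + 1 * c) \<in> ?h"
      using real_graph_zero[OF M(1)] by blast
    ultimately show ?thesis using x by auto
  qed
  define U where "U x = (THE t. (x, t) \<in> M)" for x
  have U: "U x = t" if "(x, t) \<in> M" for x t
    unfolding U_def using that real_graph_unique[OF M(1)] by blast
  have UM: "(x, U x) \<in> M" if "x \<in> carrier X" for x
    using total[OF that] U by auto
  show ?thesis
  proof (rule that[of U])
    show "U x = t" if "(x, t) \<in> g" for x t using that M(2) U by blast
    show "U (x \<oplus> y) = U x + U y" if "x \<in> carrier X" "y \<in> carrier X" for x y
      using that by (intro U real_graph_add[OF M(1)] UM)
    show "U (complex_of_real r \<odot> x) = r * U x" if "x \<in> carrier X" for r x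
      using that by (intro U real_graph_smult[OF M(1)] UM)
    show "U x \<le> C * vnorm X x" if "x \<in> carrier X" for x
      using that by (intro real_graph_le[OF M(1)] UM)
  qed
qed

text \<open>The real version, applied to real parts. That \<open>g\<close> is single-valued is part
  of the conclusion: in \<open>helly\<close> the graph is parametrised by functionals, several of
  which may define the same sequence, and the last property then says that the value depends on the
  sequence alone.\<close>

theorem hahn_banach:
  fixes g :: "('a \<times> complex) set"
  assumes C: "0 \<le> C" and ne: "g \<noteq> {}"
    and carr: "\<And>x t. (x, t) \<in> g \<Longrightarrow> x \<in> carrier X"
    and add: "\<And>x t y u. (x, t) \<in> g \<Longrightarrow> (y, u) \<in> g \<Longrightarrow> (x \<oplus> y, t + u) \<in> g"
    and smult: "\<And>x t c. (x, t) \<in> g \<Longrightarrow> (c \<odot> x, c * t) \<in> g"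
    and bound: "\<And>x t. (x, t) \<in> g \<Longrightarrow> cmod t \<le> C * vnorm X x"
  obtains \<phi> where "\<phi> \<in> bounded_operators X complex_scalars"
    and "\<And>x. x \<in> carrier X \<Longrightarrow> cmod (\<phi> x) \<le> C * vnorm X x"
    and "\<And>x t. (x, t) \<in> g \<Longrightarrow> \<phi> x = t"
proof -
  have rg: "real_graph C ((\<lambda>(x, t). (x, Re t)) ` g)" (is "real_graph C ?g")
    unfolding real_graph_def
  proof (intro conjI allI impI)
    show "?g \<subseteq> carrier X \<times> UNIV" using carr by auto
    obtain x t where xt: "(x, t) \<in> g" using ne by auto
    then have "(\<zero>, 0) \<in> g" using smult[of x t 0] carr by simp
    then show "(\<zero>, 0) \<in> ?g" by force
  next
    fix x t y u assume "(x, t) \<in> ?g" "(y, u) \<in> ?g"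
    then obtain t' u' where "(x, t') \<in> g" "(y, u') \<in> g" "t = Re t'" "u = Re u'" by auto
    then show "(x \<oplus> y, t + u) \<in> ?g" using add[of x t' y u'] by force
  next
    fix x t r assume "(x, t) \<in> ?g"
    then obtain t' where "(x, t') \<in> g" "t = Re t'" by auto
    then show "(complex_of_real r \<odot> x, r * t) \<in> ?g"
      using smult[of x t' "complex_of_real r"] by force
  next
    fix x t assume "(x, t) \<in> ?g"
    then obtain t' where "(x, t') \<in> g" "t = Re t'" by auto
    then show "t \<le> C * vnorm X x" using bound[of x t'] complex_Re_le_cmod[of t'] by linarith
  qed
  obtain U where Ug: "\<And>x t. (x, t) \<in> ?g \<Longrightarrow> U x = t"
    and Uadd: "\<And>x y. x \<in> carrier X \<Longrightarrow> y \<in> carrier X \<Longrightarrow> U (x \<oplus> y) = U x + U y"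
    and Usm: "\<And>r x. x \<in> carrier X \<Longrightarrow> U (complex_of_real r \<odot> x) = r * U x"
    and Ule: "\<And>x. x \<in> carrier X \<Longrightarrow> U x \<le> C * vnorm X x"
    by (rule hahn_banach_real[OF rg C]) blast
  \<comment> \<open>The complex linear functional with real part U: its imaginary part at x is minus
    its real part at \<i> x.\<close>
  define \<phi> where "\<phi> x = Complex (U x) (- U (\<i> \<odot> x))" for x
  have split: "U (c \<odot> x) = Re c * U x + Im c * U (\<i> \<odot> x)" if x: "x \<in> carrier X" for c x
  proof -
    have "c \<odot> x = complex_of_real (Re c) \<odot> x \<oplus> complex_of_real (Im c) \<odot> (\<i> \<odot> x)"
      using x complex_eq[of c] by (simp add: smult_smult add_smult[symmetric] mult.commute)
    then show ?thesis using x by (simp add: Uadd Usm)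
  qed
  have \<phi>add: "\<phi> (x \<oplus> y) = \<phi> x + \<phi> y" if "x \<in> carrier X" "y \<in> carrier X" for x y
    using that by (simp add: \<phi>_def Uadd smult_add complex_eq_iff)
  have \<phi>sm: "\<phi> (c \<odot> x) = c * \<phi> x" if x: "x \<in> carrier X" for c x
    using split[OF x, of c] split[OF x, of "\<i> * c"] x
    by (simp add: \<phi>_def smult_smult complex_eq_iff)
  have \<phi>le: "cmod (\<phi> x) \<le> C * vnorm X x" if x: "x \<in> carrier X" for x
  proof (cases "\<phi> x = 0")
    case True
    then show ?thesis using C x by simp
  next
    case False
    \<comment> \<open>A scalar of modulus one for which \<phi> (c x) is the real number |\<phi> x|.
      There \<phi> coincides with U, so the bound of U bounds the modulus with the same
      constant.\<close>
    define c where "c = cnj (sgn (\<phi> x))"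
    have c: "cmod c = 1" using False by (simp add: c_def norm_sgn)
    have "c * \<phi> x = complex_of_real (cmod (\<phi> x))"
      using False complex_norm_square[of "\<phi> x"]
      by (simp add: c_def sgn_div_norm scaleR_conv_of_real mult.commute divide_simps power2_eq_square)
    then have "\<phi> (c \<odot> x) = complex_of_real (cmod (\<phi> x))" using \<phi>sm[OF x] by simp
    then have "cmod (\<phi> x) = U (c \<odot> x)" by (simp add: \<phi>_def complex_eq_iff)
    also have "\<dots> \<le> C * vnorm X x" using Ule[of "c \<odot> x"] x c by (simp add: vnorm_smult)
    finally show ?thesis .
  qed
  have \<phi>g: "\<phi> x = t" if "(x, t) \<in> g" for x t
  proof -
    have "(x, Re t) \<in> ?g" "(\<i> \<odot> x, Re (\<i> * t)) \<in> ?g"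
      using that smult[OF that, of \<i>] by force+
    then show ?thesis using Ug by (simp add: \<phi>_def complex_eq_iff)
  qed
  show ?thesis
  proof (rule that[of "restrict \<phi> (carrier X)"])
    show "restrict \<phi> (carrier X) \<in> bounded_operators X complex_scalars"
      by (rule bounded_operatorsI[where C = C]) (use \<phi>add \<phi>sm \<phi>le in \<open>auto intro: complex_normed_space_axioms\<close>)
  qed (use \<phi>le \<phi>g carr in auto)
qed

end

section \<open>Dual spaces and separation by functionals\<close>

lemma dual_space_simps [simp]:
  "carrier (dual_space X) = bounded_operators X complex_scalars"
  "vnorm (dual_space X) = op_norm X complex_scalars"
  "\<phi> \<oplus>\<^bsub>dual_space X\<^esub> \<psi> = (\<lambda>x\<in>carrier X. \<phi> x + \<psi> x)"
  "c \<odot>\<^bsub>dual_space X\<^esub> \<phi> = (\<lambda>x\<in>carrier X. c * \<phi> x)"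
  by (simp_all add: dual_space_def)

context normed_space_dual
begin

lemma functional_bound:
  "\<phi> \<in> bounded_operators X complex_scalars \<Longrightarrow> x \<in> carrier X
    \<Longrightarrow> cmod (\<phi> x) \<le> op_norm X complex_scalars \<phi> * vnorm X x"
  using dual.vnorm_le_op_norm[of \<phi> x] by simp

lemma functional_add_closed:
  assumes "\<phi> \<in> bounded_operators X complex_scalars" "\<psi> \<in> bounded_operators X complex_scalars"
  shows "(\<lambda>x\<in>carrier X. \<phi> x + \<psi> x) \<in> bounded_operators X complex_scalars"
proof (rule bounded_operatorsI)
  fix x assume x: "x \<in> carrier X"
  show "vnorm complex_scalars (\<phi> x + \<psi> x)
      \<le> (op_norm X complex_scalars \<phi> + op_norm X complex_scalars \<psi>) * vnorm X x"
    using functional_bound[OF assms(1) x] functional_bound[OF assms(2) x]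
      norm_triangle_ineq[of "\<phi> x" "\<psi> x"] by (simp add: algebra_simps)
qed (use assms in \<open>auto simp: bop_add bop_smult algebra_simps intro: complex_normed_space_axioms\<close>)

lemma functional_smult_closed:
  assumes "\<phi> \<in> bounded_operators X complex_scalars"
  shows "(\<lambda>x\<in>carrier X. c * \<phi> x) \<in> bounded_operators X complex_scalars"
proof (rule bounded_operatorsI)
  fix x assume x: "x \<in> carrier X"
  show "vnorm complex_scalars (c * \<phi> x) \<le> (cmod c * op_norm X complex_scalars \<phi>) * vnorm X x"
    using functional_bound[OF assms(1) x]
    by (simp add: norm_mult mult_left_mono mult.assoc)
qed (use assms in \<open>auto simp: bop_add bop_smult algebra_simps intro: complex_normed_space_axioms\<close>)

lemma dual_ball_iff:
  "\<phi> \<in> dual_ball X \<longleftrightarrow> \<phi> \<in> bounded_operators X complex_scalars \<and>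
     (\<forall>x\<in>carrier X. cmod (\<phi> x) \<le> vnorm X x)"
proof
  assume "\<phi> \<in> dual_ball X"
  then have *: "\<phi> \<in> bounded_operators X complex_scalars" "op_norm X complex_scalars \<phi> \<le> 1"
    by (auto simp: dual_ball_def)
  have "cmod (\<phi> x) \<le> vnorm X x" if x: "x \<in> carrier X" for x
    using functional_bound[OF *(1) x] mult_right_mono[OF *(2) vnorm_nonneg[OF x]] by simp
  then show "\<phi> \<in> bounded_operators X complex_scalars \<and> (\<forall>x\<in>carrier X. cmod (\<phi> x) \<le> vnorm X x)"
    using * by simp
next
  assume "\<phi> \<in> bounded_operators X complex_scalars \<and> (\<forall>x\<in>carrier X. cmod (\<phi> x) \<le> vnorm X x)"
  then show "\<phi> \<in> dual_ball X"
    using dual.op_norm_le[of \<phi> 1] by (simp add: dual_ball_def)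
qed

text \<open>Hahn-Banach for c x \<mapsto> c ||x|| on the line through x. With x = \<zero> it also
  shows that the dual ball is nonempty.\<close>

lemma norming_functional:
  assumes x: "x \<in> carrier X"
  obtains \<phi> where "\<phi> \<in> dual_ball X" "\<phi> x = complex_of_real (vnorm X x)"
proof -
  let ?g = "range (\<lambda>c. (c \<odot> x, c * complex_of_real (vnorm X x)))"
  have add: "(y \<oplus> z, t + u) \<in> ?g" if yt: "(y, t) \<in> ?g" and zu: "(z, u) \<in> ?g" for y t z u
  proof -
    obtain c d where "y = c \<odot> x" "t = c * complex_of_real (vnorm X x)"
      "z = d \<odot> x" "u = d * complex_of_real (vnorm X x)" using yt zu by blast
    then show ?thesis using x
      by (intro image_eqI[of _ _ "c + d"]) (auto simp: add_smult algebra_simps)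
  qed
  have smult: "(d \<odot> y, d * t) \<in> ?g" if yt: "(y, t) \<in> ?g" for y t d
  proof -
    obtain c where "y = c \<odot> x" "t = c * complex_of_real (vnorm X x)" using yt by blast
    then show ?thesis using x
      by (intro image_eqI[of _ _ "d * c"]) (auto simp: smult_smult algebra_simps)
  qed
  obtain \<phi> where \<phi>: "\<phi> \<in> bounded_operators X complex_scalars"
      "\<And>y. y \<in> carrier X \<Longrightarrow> cmod (\<phi> y) \<le> 1 * vnorm X y"
      "\<And>y t. (y, t) \<in> ?g \<Longrightarrow> \<phi> y = t"
    by (rule hahn_banach[of 1 ?g]) (use x add smult in \<open>auto simp: vnorm_smult norm_mult\<close>)
  have "(1 \<odot> x, 1 * complex_of_real (vnorm X x)) \<in> ?g" by (rule rangeI)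
  then have "\<phi> x = complex_of_real (vnorm X x)" using \<phi>(3) x by simp
  then show ?thesis using \<phi> by (intro that[of \<phi>]) (simp_all add: dual_ball_iff)
qed

lemma vnorm_le_if_functionals_le:
  assumes "x \<in> carrier X" "\<And>\<phi>. \<phi> \<in> dual_ball X \<Longrightarrow> cmod (\<phi> x) \<le> c"
  shows "vnorm X x \<le> c"
proof -
  obtain \<phi> where "\<phi> \<in> dual_ball X" "\<phi> x = complex_of_real (vnorm X x)"
    using norming_functional[OF assms(1)] .
  then show ?thesis using assms(2)[of \<phi>] vnorm_nonneg[OF assms(1)] by simp
qed

text \<open>Identities between vectors, such as the linearity of \<open>synthesis\<close>, are
  reduced by this to identities between sums of scalar series.\<close>

lemma eq_if_functionals_eq:
  assumes "x \<in> carrier X" "y \<in> carrier X"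
    and "\<And>\<phi>. \<phi> \<in> bounded_operators X complex_scalars \<Longrightarrow> \<phi> x = \<phi> y"
  shows "x = y"
proof -
  have "vnorm X (x \<ominus> y) \<le> 0"
  proof (rule vnorm_le_if_functionals_le)
    fix \<phi> assume "\<phi> \<in> dual_ball X"
    then have \<phi>: "\<phi> \<in> bounded_operators X complex_scalars" by (simp add: dual_ball_iff)
    from dual.bop_diff[OF \<phi> assms(1,2)] show "cmod (\<phi> (x \<ominus> y)) \<le> 0"
      using assms(1,2) assms(3)[OF \<phi>] by simp
  qed (use assms in auto)
  then have "vnorm X (x \<ominus> y) = 0" using assms(1,2) by (intro antisym) auto
  then show ?thesis using assms(1,2) by (simp add: vnorm_eq_0_iff diff_eq_zero_iff)
qed

end

section \<open>Sequence spaces\<close>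

lemma conj_index_gt_1: "1 < p \<Longrightarrow> 1 < conj_index p"
  by (simp add: conj_index_def)

lemma conj_index_sum: "1 < p \<Longrightarrow> 1 / p + 1 / conj_index p = 1"
  by (simp add: conj_index_def field_simps)

lemma conj_index_involutive: "1 < p \<Longrightarrow> conj_index (conj_index p) = p"
  by (simp add: conj_index_def field_simps)

lemma lp_space_simps [simp]:
  "a \<in> carrier (lp_space q) \<longleftrightarrow> summable (\<lambda>n. cmod (a n) powr q)"
  "\<zero>\<^bsub>lp_space q\<^esub> = (\<lambda>n. 0)"
  "a \<oplus>\<^bsub>lp_space q\<^esub> b = (\<lambda>n. a n + b n)"
  "c \<odot>\<^bsub>lp_space q\<^esub> a = (\<lambda>n. c * a n)"
  by (simp_all add: lp_space_def)

lemma vnorm_lp: "vnorm (lp_space q) a = (\<Sum>n. cmod (a n) powr q) powr (1 / q)"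
  by (simp add: lp_space_def)

lemma vnorm_lp_nonneg: "0 \<le> vnorm (lp_space q) a"
  by (simp add: vnorm_lp)

text \<open>Membership and norm bound together become one condition on finite sums. The inequalities
  of Minkowski and Hoelder and the converse of the latter are all proved on finite sums.\<close>

lemma lp_bounded_iff:
  assumes q: "0 < q" and C: "0 \<le> C"
  shows "a \<in> carrier (lp_space q) \<and> vnorm (lp_space q) a \<le> C
    \<longleftrightarrow> (\<forall>k. (\<Sum>n<k. cmod (a n) powr q) \<le> C powr q)"
proof safe
  fix k assume a: "a \<in> carrier (lp_space q)" and le: "vnorm (lp_space q) a \<le> C"
  have "(\<Sum>n<k. cmod (a n) powr q) \<le> (\<Sum>n. cmod (a n) powr q)"
    using a by (intro sum_le_suminf) auto
  also have "\<dots> = vnorm (lp_space q) a powr q"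
    using q a by (simp add: vnorm_lp powr_powr suminf_nonneg)
  also have "\<dots> \<le> C powr q" using le q by (intro powr_mono2) (auto simp: vnorm_lp_nonneg)
  finally show "(\<Sum>n<k. cmod (a n) powr q) \<le> C powr q" .
next
  assume *: "\<forall>k. (\<Sum>n<k. cmod (a n) powr q) \<le> C powr q"
  then show a: "a \<in> carrier (lp_space q)"
    by (auto intro!: summableI_nonneg_bounded[where x = "C powr q"])
  have "(\<Sum>n. cmod (a n) powr q) \<le> C powr q"
    using * a by (intro suminf_le_const) auto
  then have "vnorm (lp_space q) a \<le> (C powr q) powr (1 / q)"
    unfolding vnorm_lp using q a by (intro powr_mono2) (auto intro: suminf_nonneg)
  then show "vnorm (lp_space q) a \<le> C" using q C by (simp add: powr_powr)
qed

lemma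
  assumes "0 < q" "0 \<le> C" "\<And>k. (\<Sum>n<k. cmod (a n) powr q) \<le> C powr q"
  shows lp_memberI: "a \<in> carrier (lp_space q)" and vnorm_lp_le: "vnorm (lp_space q) a \<le> C"
  using lp_bounded_iff[OF assms(1,2), of a] assms(3) by blast+

lemma lp_psum_le:
  assumes "0 < q" "a \<in> carrier (lp_space q)" "vnorm (lp_space q) a \<le> C"
  shows "(\<Sum>n<k. cmod (a n) powr q) \<le> C powr q"
  using lp_bounded_iff[OF assms(1), of C a] vnorm_lp_nonneg[of q a] assms by fastforce

text \<open>Convexity of the power function on the positive reals. If s or t is 0, what remains is
  (w r)^q \<le> w r^q, which holds because w \<le> 1 \<le> q.\<close>

lemma powr_convex_combination:
  fixes s t u q :: real
  assumes q: "1 \<le> q" and s: "0 \<le> s" and t: "0 \<le> t" and u: "0 \<le> u" "u \<le> 1"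
  shows "(u * s + (1 - u) * t) powr q \<le> u * s powr q + (1 - u) * t powr q"
proof -
  have scale: "(w * r) powr q \<le> w * r powr q" if "0 \<le> w" "w \<le> 1" "0 \<le> r" for w r :: real
  proof (cases "w = 0")
    case False
    then have "w powr q \<le> w powr 1" using that q by (intro powr_mono') auto
    then show ?thesis using that False by (simp add: powr_mult mult_right_mono)
  qed simp
  consider "s = 0" | "t = 0" | "0 < s" "0 < t" using s t by linarith
  then show ?thesis
  proof cases
    case 1
    then show ?thesis using scale[of "1 - u" t] u t by simp
  next
    case 2
    then show ?thesis using scale[of u s] u s by simp
  next
    case 3
    then show ?thesis
      using convex_onD[OF powr_convex[OF q], of "1 - u" s t] u by simp
  qed
qed

text \<open>For positive majorants \<alpha>, \<beta> of the two norms, |a_n + b_n| / (\<alpha> +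
  \<beta>) is at most the convex combination of |a_n| / \<alpha> and |b_n| / \<beta> with weights
  \<alpha> / (\<alpha> + \<beta>) and \<beta> / (\<alpha> + \<beta>), and convexity of the power
  applies. Majorants in place of the norms permit division when a norm is 0; they exceed the norms
  by an arbitrary e, which disappears at the end.\<close>

theorem minkowski:
  assumes q: "1 \<le> q" and a: "a \<in> carrier (lp_space q)" and b: "b \<in> carrier (lp_space q)"
  shows lp_add_closed: "(\<lambda>n. a n + b n) \<in> carrier (lp_space q)"
    and vnorm_lp_triangle:
      "vnorm (lp_space q) (\<lambda>n. a n + b n) \<le> vnorm (lp_space q) a + vnorm (lp_space q) b"
proof -
  have main: "(\<Sum>n<k. cmod (a n + b n) powr q) \<le> (\<alpha> + \<beta>) powr q"
    if \<alpha>: "0 < \<alpha>" "vnorm (lp_space q) a \<le> \<alpha>" and \<beta>: "0 < \<beta>" "vnorm (lp_space q) b \<le> \<beta>" for \<alpha> \<beta> k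
  proof -
    define u where "u = \<alpha> / (\<alpha> + \<beta>)"
    have u: "0 \<le> u" "u \<le> 1" "1 - u = \<beta> / (\<alpha> + \<beta>)" using \<alpha> \<beta> by (auto simp: u_def field_simps)
    have pointwise: "cmod (a n + b n) powr q \<le> (\<alpha> + \<beta>) powr q *
        (u * (cmod (a n) powr q / \<alpha> powr q) + (1 - u) * (cmod (b n) powr q / \<beta> powr q))" for n
    proof -
      have "cmod (a n + b n) powr q \<le> (cmod (a n) + cmod (b n)) powr q"
        using q by (intro powr_mono2 norm_triangle_ineq) auto
      also have "cmod (a n) + cmod (b n)
          = (\<alpha> + \<beta>) * (u * (cmod (a n) / \<alpha>) + (1 - u) * (cmod (b n) / \<beta>))"
      proof -
        have "u * (cmod (a n) / \<alpha>) = cmod (a n) / (\<alpha> + \<beta>)"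
          "(1 - u) * (cmod (b n) / \<beta>) = cmod (b n) / (\<alpha> + \<beta>)"
          unfolding u(3) using \<alpha> \<beta> by (simp_all add: u_def)
        then show ?thesis using \<alpha> \<beta> by (simp add: add_divide_distrib[symmetric])
      qed
      also have "\<dots> powr q
          = (\<alpha> + \<beta>) powr q * (u * (cmod (a n) / \<alpha>) + (1 - u) * (cmod (b n) / \<beta>)) powr q"
        using \<alpha> \<beta> u by (intro powr_mult)
      also have "\<dots> \<le> (\<alpha> + \<beta>) powr q *
          (u * (cmod (a n) / \<alpha>) powr q + (1 - u) * (cmod (b n) / \<beta>) powr q)"
        using \<alpha> \<beta> u q by (intro mult_left_mono powr_convex_combination) auto
      also have "\<dots> = (\<alpha> + \<beta>) powr q *
        (u * (cmod (a n) powr q / \<alpha> powr q) + (1 - u) * (cmod (b n) powr q / \<beta> powr q))"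
        using \<alpha> \<beta> by (simp add: powr_divide)
      finally show ?thesis .
    qed
    have "(\<Sum>n<k. cmod (a n + b n) powr q) \<le> (\<Sum>n<k. (\<alpha> + \<beta>) powr q *
        (u * (cmod (a n) powr q / \<alpha> powr q) + (1 - u) * (cmod (b n) powr q / \<beta> powr q)))"
      by (intro sum_mono pointwise)
    also have "\<dots> = (\<alpha> + \<beta>) powr q * (u * ((\<Sum>n<k. cmod (a n) powr q) / \<alpha> powr q)
        + (1 - u) * ((\<Sum>n<k. cmod (b n) powr q) / \<beta> powr q))"
      by (simp add: sum_distrib_left sum.distrib sum_divide_distrib distrib_left)
    also have "\<dots> \<le> (\<alpha> + \<beta>) powr q * (u * 1 + (1 - u) * 1)"
      using lp_psum_le[of q a \<alpha> k] lp_psum_le[of q b \<beta> k] a b \<alpha> \<beta> u q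
      by (intro mult_left_mono add_mono) (auto simp: divide_le_eq)
    finally show ?thesis by simp
  qed
  have *: "(\<lambda>n. a n + b n) \<in> carrier (lp_space q) \<and> vnorm (lp_space q) (\<lambda>n. a n + b n)
      \<le> (vnorm (lp_space q) a + e) + (vnorm (lp_space q) b + e)" if e: "0 < e" for e
    using main[of "vnorm (lp_space q) a + e" "vnorm (lp_space q) b + e"] e q
      vnorm_lp_nonneg[of q a] vnorm_lp_nonneg[of q b]
    by (subst lp_bounded_iff) auto
  show "(\<lambda>n. a n + b n) \<in> carrier (lp_space q)" using *[of 1] by simp
  show "vnorm (lp_space q) (\<lambda>n. a n + b n) \<le> vnorm (lp_space q) a + vnorm (lp_space q) b"
  proof (rule field_le_epsilon)
    fix e :: real assume "0 < e"
    then show "vnorm (lp_space q) (\<lambda>n. a n + b n)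
        \<le> vnorm (lp_space q) a + vnorm (lp_space q) b + e"
      using *[of "e / 2"] by simp
  qed
qed

lemma lp_smult_closed: "a \<in> carrier (lp_space q) \<Longrightarrow> (\<lambda>n. c * a n) \<in> carrier (lp_space q)"
  by (simp add: norm_mult powr_mult summable_mult)

lemma vnorm_lp_smult:
  assumes "0 < q" "a \<in> carrier (lp_space q)"
  shows "vnorm (lp_space q) (\<lambda>n. c * a n) = cmod c * vnorm (lp_space q) a"
proof -
  have "(\<Sum>n. cmod (c * a n) powr q) = cmod c powr q * (\<Sum>n. cmod (a n) powr q)"
    using assms by (simp add: norm_mult powr_mult suminf_mult)
  then show ?thesis
    using assms by (simp add: vnorm_lp powr_mult powr_powr suminf_nonneg)
qed

lemma vnorm_lp_eq_0_iff:
  assumes "0 < q" "a \<in> carrier (lp_space q)"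
  shows "vnorm (lp_space q) a = 0 \<longleftrightarrow> a = (\<lambda>n. 0)"
proof -
  have "vnorm (lp_space q) a = 0 \<longleftrightarrow> (\<Sum>n. cmod (a n) powr q) = 0"
    using assms by (simp add: vnorm_lp)
  also have "\<dots> \<longleftrightarrow> (\<forall>n. cmod (a n) powr q = 0)"
    using assms by (intro suminf_eq_zero_iff) auto
  finally show ?thesis using assms by (auto simp: fun_eq_iff)
qed

theorem complex_normed_space_lp: "1 \<le> q \<Longrightarrow> complex_normed_space (lp_space q)"
proof (rule complex_normed_spaceI, goal_cases)
  case (2 x y)
  then show ?case using lp_add_closed by simp
next
  case (6 c x)
  then show ?case using lp_smult_closed by simp
next
  case (12 x)
  then show ?case using vnorm_lp_eq_0_iff by simp
next
  case (13 x y)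
  then show ?case using vnorm_lp_triangle by simp
next
  case (14 c x)
  then show ?case using vnorm_lp_smult by simp
qed (auto simp: algebra_simps)

text \<open>Young's inequality for |a_n| / \<alpha> and |b_n| / \<beta>, summed over n. As in
  \<open>minkowski\<close>, \<alpha> and \<beta> are positive majorants that tend to the norms at
  the end.\<close>

theorem hoelder:
  assumes p: "1 < p" and a: "a \<in> carrier (lp_space (conj_index p))" and b: "b \<in> carrier (lp_space p)"
  shows hoelder_summable: "summable (\<lambda>n. cmod (a n * b n))"
    and hoelder_suminf: "(\<Sum>n. cmod (a n * b n))
      \<le> vnorm (lp_space (conj_index p)) a * vnorm (lp_space p) b"
proof -
  let ?q = "conj_index p"
  have q: "1 < ?q" and pq: "1 / ?q + 1 / p = 1"
    using conj_index_gt_1[OF p] conj_index_sum[OF p] by auto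
  have main: "(\<Sum>n<k. cmod (a n * b n)) \<le> \<alpha> * \<beta>"
    if \<alpha>: "0 < \<alpha>" "vnorm (lp_space ?q) a \<le> \<alpha>" and \<beta>: "0 < \<beta>" "vnorm (lp_space p) b \<le> \<beta>" for \<alpha> \<beta> k
  proof -
    have pointwise: "cmod (a n * b n) \<le> \<alpha> * \<beta> *
        ((cmod (a n) powr ?q / \<alpha> powr ?q) / ?q + (cmod (b n) powr p / \<beta> powr p) / p)" for n
    proof -
      have "cmod (a n * b n) = \<alpha> * \<beta> * ((cmod (a n) / \<alpha>) * (cmod (b n) / \<beta>))"
        using \<alpha> \<beta> by (simp add: norm_mult)
      also have "\<dots> \<le> \<alpha> * \<beta> * ((cmod (a n) / \<alpha>) powr ?q / ?q + (cmod (b n) / \<beta>) powr p / p)"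
        using \<alpha> \<beta> p q pq by (intro mult_left_mono Youngs_inequality) auto
      finally show ?thesis using \<alpha> \<beta> by (simp add: powr_divide)
    qed
    have "(\<Sum>n<k. cmod (a n * b n)) \<le> (\<Sum>n<k. \<alpha> * \<beta> *
        ((cmod (a n) powr ?q / \<alpha> powr ?q) / ?q + (cmod (b n) powr p / \<beta> powr p) / p))"
      by (intro sum_mono pointwise)
    also have "\<dots> = \<alpha> * \<beta> * (((\<Sum>n<k. cmod (a n) powr ?q) / \<alpha> powr ?q) / ?q
        + ((\<Sum>n<k. cmod (b n) powr p) / \<beta> powr p) / p)"
      by (simp add: sum_distrib_left sum.distrib sum_divide_distrib distrib_left)
    also have "\<dots> \<le> \<alpha> * \<beta> * (1 / ?q + 1 / p)"
      using lp_psum_le[of ?q a \<alpha> k] lp_psum_le[of p b \<beta> k] a b \<alpha> \<beta> p q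
      by (intro mult_left_mono add_mono divide_right_mono) (auto simp: divide_le_eq)
    finally show ?thesis using pq by simp
  qed
  let ?A = "vnorm (lp_space ?q) a" and ?B = "vnorm (lp_space p) b"
  have nn: "0 \<le> ?A" "0 \<le> ?B" by (simp_all add: vnorm_lp_nonneg)
  show s: "summable (\<lambda>n. cmod (a n * b n))"
    using main[of "?A + 1" "?B + 1"] nn
    by (intro summableI_nonneg_bounded[where x = "(?A + 1) * (?B + 1)"]) auto
  have "(\<Sum>n. cmod (a n * b n)) \<le> (?A + e) * (?B + e)" if "0 < e" for e
    using main[of "?A + e" "?B + e"] nn that s by (intro suminf_le_const) auto
  moreover have "((\<lambda>e. (?A + e) * (?B + e)) \<longlongrightarrow> (?A + 0) * (?B + 0)) (at_right 0)"
    by (intro tendsto_intros)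
  ultimately show "(\<Sum>n. cmod (a n * b n)) \<le> ?A * ?B"
    using tendsto_lowerbound[of "\<lambda>e. (?A + e) * (?B + e)" "?A * ?B" "at_right 0"]
    by (simp add: eventually_at_right_less eventually_mono[OF eventually_at_right_less])
qed

lemma hoelder_norm_le:
  assumes "1 < p" "a \<in> carrier (lp_space (conj_index p))" "b \<in> carrier (lp_space p)"
  shows "cmod (\<Sum>n. a n * b n) \<le> vnorm (lp_space (conj_index p)) a * vnorm (lp_space p) b"
  using summable_norm[OF hoelder_summable[OF assms]] hoelder_suminf[OF assms] by (rule order_trans)

section \<open>Unit vectors, truncation and the expansion of a sequence\<close>

definition unit_seq :: "nat \<Rightarrow> nat \<Rightarrow> complex" where
  "unit_seq n = (\<lambda>m. if m = n then 1 else 0)"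

definition truncate_seq :: "nat \<Rightarrow> (nat \<Rightarrow> complex) \<Rightarrow> nat \<Rightarrow> complex" where
  "truncate_seq k a = (\<lambda>n. if n < k then a n else 0)"

lemma finite_support_lp:
  assumes "0 < q" "\<And>n. k \<le> n \<Longrightarrow> a n = 0"
  shows "a \<in> carrier (lp_space q)"
    and "vnorm (lp_space q) a = (\<Sum>n<k. cmod (a n) powr q) powr (1 / q)"
proof -
  have "(\<lambda>n. cmod (a n) powr q) sums (\<Sum>n<k. cmod (a n) powr q)"
    using assms by (intro sums_finite) auto
  then show "a \<in> carrier (lp_space q)"
    and "vnorm (lp_space q) a = (\<Sum>n<k. cmod (a n) powr q) powr (1 / q)"
    by (auto simp: sums_iff vnorm_lp)
qed

lemma truncate_seq_lp: "0 < q \<Longrightarrow> truncate_seq k a \<in> carrier (lp_space q)"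
  by (rule finite_support_lp(1)[where k = k]) (auto simp: truncate_seq_def)

lemma unit_seq_lp: "0 < q \<Longrightarrow> unit_seq n \<in> carrier (lp_space q)"
  by (rule finite_support_lp(1)[where k = "Suc n"]) (auto simp: unit_seq_def)

lemma truncate_seq_eq_finsum:
  assumes q: "1 \<le> q"
  shows "(\<Oplus>\<^bsub>lp_space q\<^esub>n\<in>{..<k}. a n \<odot>\<^bsub>lp_space q\<^esub> unit_seq n) = truncate_seq k a"
proof -
  interpret complex_normed_space "lp_space q" using q by (rule complex_normed_space_lp)
  have u: "c \<odot>\<^bsub>lp_space q\<^esub> unit_seq n \<in> carrier (lp_space q)" for c n
    using q by (intro smult_cl unit_seq_lp) auto
  show ?thesis
  proof (induction k)
    case 0
    then show ?case by (simp add: truncate_seq_def)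
  next
    case (Suc k)
    have "(\<Oplus>\<^bsub>lp_space q\<^esub>n\<in>{..<Suc k}. a n \<odot>\<^bsub>lp_space q\<^esub> unit_seq n)
        = truncate_seq k a \<oplus>\<^bsub>lp_space q\<^esub> (a k \<odot>\<^bsub>lp_space q\<^esub> unit_seq k)"
      unfolding Suc.IH[symmetric] by (rule psum_Suc) (rule u)
    also have "\<dots> = truncate_seq (Suc k) a"
      by (auto simp: truncate_seq_def unit_seq_def fun_eq_iff less_Suc_eq)
    finally show ?case .
  qed
qed

text \<open>The error after k terms has the norm of the tail of a from index k on, which tends to 0
  because the series of \<open>q\<close>-th powers converges.\<close>

lemma lp_expansion:
  assumes q: "1 \<le> q" and a: "a \<in> carrier (lp_space q)"
  shows "limitin (norm_topology (lp_space q))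
    (\<lambda>k. \<Oplus>\<^bsub>lp_space q\<^esub>n\<in>{..<k}. a n \<odot>\<^bsub>lp_space q\<^esub> unit_seq n) a sequentially"
proof -
  interpret complex_normed_space "lp_space q" using q by (rule complex_normed_space_lp)
  have tr: "truncate_seq k a \<in> carrier (lp_space q)" for k using truncate_seq_lp q by simp
  have "(\<lambda>k. vnorm (lp_space q) (truncate_seq k a \<ominus>\<^bsub>lp_space q\<^esub> a)) \<longlonglongrightarrow> 0"
  proof -
    have "vnorm (lp_space q) (truncate_seq k a \<ominus>\<^bsub>lp_space q\<^esub> a)
        = (\<Sum>n. cmod (a (n + k)) powr q) powr (1 / q)" for k
    proof -
      have "a \<ominus>\<^bsub>lp_space q\<^esub> truncate_seq k a = (\<lambda>n. if n < k then 0 else a n)"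
        using a tr[of k] by (simp only: M.minus_eq minus_eq_smult)
          (auto simp: truncate_seq_def fun_eq_iff)
      then have "vnorm (lp_space q) (truncate_seq k a \<ominus>\<^bsub>lp_space q\<^esub> a)
          = (\<Sum>n. cmod (if n < k then 0 else a n) powr q) powr (1 / q)"
        using vnorm_diff_commute[OF a tr[of k]] by (simp add: vnorm_lp)
      also have "(\<lambda>n. cmod (if n < k then 0 else a n) powr q) sums (\<Sum>n. cmod (a (n + k)) powr q)"
      proof -
        have "summable (\<lambda>n. cmod (a (n + k)) powr q)"
          using a by (subst summable_iff_shift[of "\<lambda>n. cmod (a n) powr q"]) simp
        then have "(\<lambda>n. cmod (if n + k < k then 0 else a (n + k)) powr q)
            sums (\<Sum>n. cmod (a (n + k)) powr q)" by (simp add: summable_sums)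
        then show ?thesis
          by (subst (asm) sums_iff_shift[of "\<lambda>n. cmod (if n < k then 0 else a n) powr q" k]) simp
      qed
      then have "(\<Sum>n. cmod (if n < k then 0 else a n) powr q) = (\<Sum>n. cmod (a (n + k)) powr q)"
        by (simp add: sums_iff)
      finally show ?thesis .
    qed
    moreover have "(\<lambda>k. (\<Sum>n. cmod (a (n + k)) powr q) powr (1 / q)) \<longlonglongrightarrow> 0"
    proof (rule tendsto_eq_rhs)
      have "(\<lambda>k. \<Sum>n. cmod (a (n + k)) powr q) \<longlonglongrightarrow> 0"
        using suminf_exist_split2[of "\<lambda>n. cmod (a n) powr q"] a by simp
      then show "(\<lambda>k. (\<Sum>n. cmod (a (n + k)) powr q) powr (1 / q)) \<longlonglongrightarrow> 0 powr (1 / q)"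
      proof (rule tendsto_powr2)
        show "\<forall>\<^sub>F k in sequentially. 0 \<le> (\<Sum>n. cmod (a (n + k)) powr q)"
        proof (rule always_eventually, rule allI)
          fix k
          have "summable (\<lambda>n. cmod (a (n + k)) powr q)"
            using a by (subst summable_iff_shift[of "\<lambda>n. cmod (a n) powr q"]) simp
          then show "0 \<le> (\<Sum>n. cmod (a (n + k)) powr q)" by (intro suminf_nonneg) auto
        qed
      qed (use q in auto)
    qed simp
    ultimately show ?thesis by simp
  qed
  then show ?thesis
    unfolding truncate_seq_eq_finsum[OF q] by (subst limitin_norm_iff) (use tr a in auto)
qed

section \<open>Functionals on the sequence spaces\<close>

lemma finsum_scalars:
  "(\<Oplus>\<^bsub>complex_scalars\<^esub>n\<in>{..<k::nat}. s n) = (\<Sum>n<k. s n)"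
proof -
  interpret abelian_monoid complex_scalars
    using cring_complex_scalars by (simp add: cring_def ring_def abelian_group_def)
  show ?thesis
    by (induction k) (simp_all add: lessThan_Suc finsum_insert add.commute)
qed

lemma limitin_scalars:
  "limitin (norm_topology complex_scalars) s l sequentially \<longleftrightarrow> s \<longlonglongrightarrow> l"
  using complex_normed_space.limitin_norm_iff[OF complex_normed_space_scalars, of s l]
  by (simp add: tendsto_norm_zero_iff LIM_zero_iff)

text \<open>A bounded functional commutes with the limit in \<open>lp_expansion\<close>, so it is
  determined by its values at the unit vectors.\<close>

lemma lp_functional_sums:
  assumes q: "1 \<le> q" and \<psi>: "\<psi> \<in> bounded_operators (lp_space q) complex_scalars"
    and a: "a \<in> carrier (lp_space q)"
  shows "(\<lambda>n. a n * \<psi> (unit_seq n)) sums \<psi> a"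
proof -
  interpret lp: normed_spaces "lp_space q" complex_scalars
    using q by (intro normed_spaces.intro complex_normed_space_lp complex_normed_space_scalars)
  have u: "unit_seq n \<in> carrier (lp_space q)" for n using unit_seq_lp q by simp
  then have cu: "c \<odot>\<^bsub>lp_space q\<^esub> unit_seq n \<in> carrier (lp_space q)" for c n
    by (rule lp.X.smult_cl)
  have "limitin (norm_topology complex_scalars)
      (\<lambda>k. \<psi> (\<Oplus>\<^bsub>lp_space q\<^esub>n\<in>{..<k}. a n \<odot>\<^bsub>lp_space q\<^esub> unit_seq n)) (\<psi> a) sequentially"
    by (rule lp.bop_limit[OF \<psi> _ lp_expansion[OF q a]]) (rule lp.X.psum_closed[OF cu])
  moreover have "\<psi> (\<Oplus>\<^bsub>lp_space q\<^esub>n\<in>{..<k}. a n \<odot>\<^bsub>lp_space q\<^esub> unit_seq n)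
      = (\<Sum>n<k. a n * \<psi> (unit_seq n))" for k
    unfolding lp.bop_psum[OF \<psi> cu] finsum_scalars by (simp add: bop_smult[OF \<psi> u] del: lp_space_simps)
  ultimately show ?thesis unfolding sums_def limitin_scalars by simp
qed

text \<open>The test vector \<open>b\<close> is the extremal one in Hoelder's inequality.\<close>

lemma
  assumes p: "1 < p" and C: "0 \<le> C"
    and bound: "\<And>b k. (\<And>n. k \<le> n \<Longrightarrow> b n = 0)
      \<Longrightarrow> cmod (\<Sum>n<k. b n * c n) \<le> C * vnorm (lp_space p) b"
  shows hoelder_converse_lp: "c \<in> carrier (lp_space (conj_index p))"
    and hoelder_converse_norm: "vnorm (lp_space (conj_index p)) c \<le> C"
proof -
  define q where "q = conj_index p"
  have q: "1 < q" "1 / p + 1 / q = 1" "(q - 1) * p = q"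
    using conj_index_gt_1[OF p] conj_index_sum[OF p] p
    by (auto simp: q_def conj_index_def field_simps)
  have "(\<Sum>n<k. cmod (c n) powr q) \<le> C powr q" for k
  proof -
    define S where "S = (\<Sum>n<k. cmod (c n) powr q)"
    define b where "b n = (if n < k then cnj (sgn (c n)) * complex_of_real (cmod (c n) powr (q - 1)) else 0)" for n
    have "b n * c n = complex_of_real (cmod (c n) powr q)" if "n < k" for n
    proof (cases "c n = 0")
      case False
      have "cnj (sgn (c n)) * c n = complex_of_real (cmod (c n))"
        using False complex_norm_square[of "c n"]
        by (simp add: sgn_div_norm scaleR_conv_of_real mult.commute divide_simps power2_eq_square)
      then have "b n * c n = complex_of_real (cmod (c n) * cmod (c n) powr (q - 1))"
        using that by (simp add: b_def ac_simps)
      also have "cmod (c n) * cmod (c n) powr (q - 1) = cmod (c n) powr q"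
        using False powr_mult_base[of "cmod (c n)" "q - 1"] by simp
      finally show ?thesis .
    qed (use that q in \<open>simp add: b_def\<close>)
    then have sum_bc: "(\<Sum>n<k. b n * c n) = complex_of_real S" by (simp add: S_def)
    have "cmod (b n) powr p = cmod (c n) powr q" if "n < k" for n
      using that q by (cases "c n = 0") (auto simp: b_def norm_mult norm_sgn powr_powr)
    then have norm_b: "vnorm (lp_space p) b = S powr (1 / p)"
      using finite_support_lp(2)[of p k b] p by (simp add: S_def b_def)
    have S0: "0 \<le> S" by (simp add: S_def sum_nonneg)
    have "cmod (\<Sum>n<k. b n * c n) \<le> C * vnorm (lp_space p) b"
      by (rule bound) (simp add: b_def)
    \<comment> \<open>Since (q - 1) p = q, both b_n c_n and |b_n|^p equal |c_n|^q for n < k, so S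
      occurs on both sides. Division by S^(1/p) leaves S^(1/q) \<le> C.\<close>
    then have le: "S \<le> C * S powr (1 / p)" using S0 by (simp add: sum_bc norm_b)
    have "S \<le> C powr q"
    proof (cases "S = 0")
      case False
      then have S: "0 < S" using S0 by simp
      have "S powr (1 / p) * S powr (1 / q) = S" using S q by (simp add: powr_add[symmetric])
      then have "S powr (1 / p) * S powr (1 / q) \<le> S powr (1 / p) * C" using le by (simp add: mult.commute)
      then have "S powr (1 / q) \<le> C" using S by simp
      then have "(S powr (1 / q)) powr q \<le> C powr q" using q by (intro powr_mono2) auto
      then show ?thesis using S q by (simp add: powr_powr)
    qed simp
    then show ?thesis by (simp add: S_def)
  qed
  then show "c \<in> carrier (lp_space (conj_index p))" "vnorm (lp_space (conj_index p)) c \<le> C"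
    unfolding q_def[symmetric] using lp_memberI[of q C c] vnorm_lp_le[of q C c] q C by auto
qed

text \<open>On finitely supported sequences \<open>\<psi>\<close> is a finite sum, which is the form
  that \<open>hoelder_converse_lp\<close> asks for. Both exponents occur later: \<open>p\<close>
  itself in \<open>helly\<close>, and its conjugate for functionals on quotients.\<close>

lemma
  assumes p: "1 < p" and \<psi>: "\<psi> \<in> bounded_operators (lp_space p) complex_scalars" and C: "0 \<le> C"
    and bound: "\<And>b. b \<in> carrier (lp_space p) \<Longrightarrow> cmod (\<psi> b) \<le> C * vnorm (lp_space p) b"
  shows lp_dual_lp: "(\<lambda>n. \<psi> (unit_seq n)) \<in> carrier (lp_space (conj_index p))"
    and lp_dual_norm: "vnorm (lp_space (conj_index p)) (\<lambda>n. \<psi> (unit_seq n)) \<le> C"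
proof -
  have *: "cmod (\<Sum>n<k. b n * \<psi> (unit_seq n)) \<le> C * vnorm (lp_space p) b"
    if b: "\<And>n. k \<le> n \<Longrightarrow> b n = 0" for b k
  proof -
    have bl: "b \<in> carrier (lp_space p)" using finite_support_lp(1)[of p k b] b p by simp
    have "(\<lambda>n. b n * \<psi> (unit_seq n)) sums (\<Sum>n<k. b n * \<psi> (unit_seq n))"
      using b by (intro sums_finite) auto
    moreover have "(\<lambda>n. b n * \<psi> (unit_seq n)) sums \<psi> b"
      using p by (intro lp_functional_sums[OF _ \<psi> bl]) simp
    ultimately show ?thesis using bound[OF bl] sums_unique2 by metis
  qed
  show "(\<lambda>n. \<psi> (unit_seq n)) \<in> carrier (lp_space (conj_index p))"
    "vnorm (lp_space (conj_index p)) (\<lambda>n. \<psi> (unit_seq n)) \<le> C"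
    using hoelder_converse_lp[OF p C *] hoelder_converse_norm[OF p C *] by auto
qed

text \<open>The bound makes \<Lambda> \<phi> a function of the sequence (\<phi> (x n)), linear and
  bounded on a subspace of l_p. Its Hahn-Banach extension has the same bound C and is represented by
  the values at the unit vectors. No \<epsilon> is lost, so the coefficient sequence has norm at
  most C itself.\<close>

theorem (in normed_space_dual) helly:
  assumes p: "1 < p" and x: "\<And>n. x n \<in> carrier X"
    and xp: "\<And>\<phi>. \<phi> \<in> bounded_operators X complex_scalars \<Longrightarrow> (\<lambda>n. \<phi> (x n)) \<in> carrier (lp_space p)"
    and C: "0 \<le> C"
    and add: "\<And>\<phi> \<psi>. \<phi> \<in> bounded_operators X complex_scalars \<Longrightarrow> \<psi> \<in> bounded_operators X complex_scalars
      \<Longrightarrow> \<Lambda> (\<lambda>x\<in>carrier X. \<phi> x + \<psi> x) = \<Lambda> \<phi> + \<Lambda> \<psi>"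
    and smult: "\<And>c \<phi>. \<phi> \<in> bounded_operators X complex_scalars
      \<Longrightarrow> \<Lambda> (\<lambda>x\<in>carrier X. c * \<phi> x) = c * \<Lambda> \<phi>"
    and bound: "\<And>\<phi>. \<phi> \<in> bounded_operators X complex_scalars
      \<Longrightarrow> cmod (\<Lambda> \<phi>) \<le> C * vnorm (lp_space p) (\<lambda>n. \<phi> (x n))"
  obtains a where "a \<in> carrier (lp_space (conj_index p))" "vnorm (lp_space (conj_index p)) a \<le> C"
    "\<And>\<phi>. \<phi> \<in> bounded_operators X complex_scalars \<Longrightarrow> (\<lambda>n. a n * \<phi> (x n)) sums \<Lambda> \<phi>"
proof -
  interpret lp: complex_normed_space "lp_space p" using p by (intro complex_normed_space_lp) simp
  let ?D = "bounded_operators X complex_scalars"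
  let ?g = "(\<lambda>\<phi>. ((\<lambda>n. \<phi> (x n)), \<Lambda> \<phi>)) ` ?D"
  obtain \<psi> where \<psi>: "\<psi> \<in> bounded_operators (lp_space p) complex_scalars"
      "\<And>b. b \<in> carrier (lp_space p) \<Longrightarrow> cmod (\<psi> b) \<le> C * vnorm (lp_space p) b"
      "\<And>b t. (b, t) \<in> ?g \<Longrightarrow> \<psi> b = t"
  proof (rule lp.hahn_banach[OF C, of ?g])
    obtain \<phi> where "\<phi> \<in> dual_ball X" using norming_functional[of \<zero>] by auto
    then show "?g \<noteq> {}" by (auto simp: dual_ball_iff)
    show "b \<in> carrier (lp_space p)" if "(b, t) \<in> ?g" for b t using that xp by auto
    show "(b \<oplus>\<^bsub>lp_space p\<^esub> d, t + u) \<in> ?g" if "(b, t) \<in> ?g" "(d, u) \<in> ?g" for b t d u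
    proof -
      from that obtain \<phi>' \<phi>'' where "\<phi>' \<in> ?D" "b = (\<lambda>n. \<phi>' (x n))" "t = \<Lambda> \<phi>'"
        "\<phi>'' \<in> ?D" "d = (\<lambda>n. \<phi>'' (x n))" "u = \<Lambda> \<phi>''" by blast
      then show ?thesis
        using x by (intro image_eqI[of _ _ "\<lambda>x\<in>carrier X. \<phi>' x + \<phi>'' x"])
          (auto simp: add functional_add_closed)
    qed
    show "(c \<odot>\<^bsub>lp_space p\<^esub> b, c * t) \<in> ?g" if "(b, t) \<in> ?g" for b t c
    proof -
      from that obtain \<phi>' where "\<phi>' \<in> ?D" "b = (\<lambda>n. \<phi>' (x n))" "t = \<Lambda> \<phi>'" by blast
      then show ?thesis
        using x by (intro image_eqI[of _ _ "\<lambda>x\<in>carrier X. c * \<phi>' x"])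
          (auto simp: smult functional_smult_closed)
    qed
    show "cmod t \<le> C * vnorm (lp_space p) b" if "(b, t) \<in> ?g" for b t using that bound by auto
  qed blast
  show ?thesis
  proof (rule that[of "\<lambda>n. \<psi> (unit_seq n)"])
    show "(\<lambda>n. \<psi> (unit_seq n)) \<in> carrier (lp_space (conj_index p))"
      "vnorm (lp_space (conj_index p)) (\<lambda>n. \<psi> (unit_seq n)) \<le> C"
      using lp_dual_lp[OF p \<psi>(1) C \<psi>(2)] lp_dual_norm[OF p \<psi>(1) C \<psi>(2)] by auto
    show "(\<lambda>n. \<psi> (unit_seq n) * \<phi> (x n)) sums \<Lambda> \<phi>" if \<phi>: "\<phi> \<in> ?D" for \<phi>
    proof -
      have "\<psi> (\<lambda>n. \<phi> (x n)) = \<Lambda> \<phi>" using \<psi>(3) \<phi> by blast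
      then show ?thesis
        using lp_functional_sums[OF _ \<psi>(1) xp[OF \<phi>]] p by (simp add: mult.commute)
    qed
  qed
qed

section \<open>Reflexive spaces and quotients\<close>

lemma (in normed_space_dual) evaluation_bounded:
  assumes x: "x \<in> carrier X"
  shows "(\<lambda>\<phi>\<in>carrier (dual_space X). \<phi> x) \<in> bounded_operators (dual_space X) complex_scalars"
  unfolding bounded_operators_def
proof (intro CollectI conjI ballI allI exI)
  show "vnorm complex_scalars ((\<lambda>\<phi>\<in>carrier (dual_space X). \<phi> x) \<phi>)
      \<le> vnorm X x * vnorm (dual_space X) \<phi>"
    if "\<phi> \<in> carrier (dual_space X)" for \<phi>
    using that functional_bound[of \<phi> x] x by (simp add: mult.commute)
qed (use x in \<open>auto simp: functional_add_closed functional_smult_closed\<close>)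

text \<open>A Cauchy sequence converges pointwise on the dual, and since it is bounded, the limit is
  an element of the bidual, hence evaluation at some x. This yields completeness of the quotients of
  l_q together with their reflexivity.\<close>

lemma (in normed_space_dual) reflexive_imp_complete:
  assumes refl: "reflexive_space X"
  shows "metric.mcomplete"
  unfolding metric.mcomplete_def
proof (intro allI impI)
  fix s assume s: "metric.MCauchy s"
  let ?D = "bounded_operators X complex_scalars"
  have sX: "s n \<in> carrier X" for n using s by (auto simp: metric.MCauchy_def)
  have cauchy: "\<exists>N. \<forall>m\<ge>N. \<forall>n\<ge>N. vnorm X (s m \<ominus> s n) < e" if "0 < e" for e
    using s that sX unfolding metric.MCauchy_def by (simp add: ndist_def)
  have diff_le: "cmod (\<phi> (s m) - \<phi> (s n)) \<le> op_norm X complex_scalars \<phi> * vnorm X (s m \<ominus> s n)"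
    if "\<phi> \<in> ?D" for \<phi> m n
    using functional_bound[OF that diff_closed[OF sX[of m] sX[of n]]] dual.bop_diff[OF that sX[of m] sX[of n]]
    by simp
  have "convergent (\<lambda>n. \<phi> (s n))" if \<phi>: "\<phi> \<in> ?D" for \<phi>
  proof -
    have "Cauchy (\<lambda>n. \<phi> (s n))"
    proof (rule metric_CauchyI)
      fix e :: real assume e: "0 < e"
      define K where "K = op_norm X complex_scalars \<phi> + 1"
      have K: "0 < K" "op_norm X complex_scalars \<phi> \<le> K"
        using dual.bop_norm_nonneg[OF \<phi>] by (auto simp: K_def)
      obtain N where N: "\<And>m n. m \<ge> N \<Longrightarrow> n \<ge> N \<Longrightarrow> vnorm X (s m \<ominus> s n) < e / K"
        using cauchy[of "e / K"] e K by auto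
      have "dist (\<phi> (s m)) (\<phi> (s n)) < e" if mn: "m \<ge> N" "n \<ge> N" for m n
      proof -
        have "cmod (\<phi> (s m) - \<phi> (s n)) \<le> K * vnorm X (s m \<ominus> s n)"
          using order_trans[OF diff_le[OF \<phi>] mult_right_mono[OF K(2)]] sX by simp
        also have "\<dots> < K * (e / K)" using N[OF mn] K by (intro mult_strict_left_mono) auto
        finally show ?thesis using K by (simp add: dist_norm)
      qed
      then show "\<exists>N. \<forall>m\<ge>N. \<forall>n\<ge>N. dist (\<phi> (s m)) (\<phi> (s n)) < e" by blast
    qed
    then show ?thesis by (simp add: Cauchy_convergent_iff)
  qed
  then have lim: "(\<lambda>n. \<phi> (s n)) \<longlonglongrightarrow> lim (\<lambda>n. \<phi> (s n))" if "\<phi> \<in> ?D" for \<phi>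
    using that by (simp add: convergent_LIMSEQ_iff)
  define \<Lambda> where "\<Lambda> = (\<lambda>\<phi>\<in>carrier (dual_space X). lim (\<lambda>n. \<phi> (s n)))"
  have bdd: "\<exists>B. \<forall>n. vnorm X (s n) \<le> B"
  proof -
    obtain N where N: "\<And>m n. m \<ge> N \<Longrightarrow> n \<ge> N \<Longrightarrow> vnorm X (s m \<ominus> s n) < 1"
      using cauchy[of 1] by auto
    have "vnorm X (s n) \<le> Max ((\<lambda>n. vnorm X (s n)) ` {..N}) + 1" for n
    proof (cases "n \<le> N")
      case True
      then have "vnorm X (s n) \<le> Max ((\<lambda>n. vnorm X (s n)) ` {..N})" by (intro Max_ge) auto
      then show ?thesis by simp
    next
      case False
      then have "vnorm X (s n) \<le> 1 + vnorm X (s N)"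
        using vnorm_le_diff[OF sX[of n] sX[of N]] N[of n N] by simp
      moreover have "vnorm X (s N) \<le> Max ((\<lambda>n. vnorm X (s n)) ` {..N})" by (intro Max_ge) auto
      ultimately show ?thesis by linarith
    qed
    then show ?thesis by blast
  qed
  then obtain B where B: "\<And>n. vnorm X (s n) \<le> B" by auto
  have "\<Lambda> \<in> carrier (dual_space (dual_space X))"
    unfolding dual_space_simps(1)[of "dual_space X"] bounded_operators_def
  proof (intro CollectI conjI ballI allI exI)
    fix \<phi> \<psi> assume \<phi>\<psi>: "\<phi> \<in> carrier (dual_space X)" "\<psi> \<in> carrier (dual_space X)"
    have "(\<lambda>n. \<phi> (s n) + \<psi> (s n)) \<longlonglongrightarrow> \<Lambda> \<phi> + \<Lambda> \<psi>"
      using \<phi>\<psi> lim by (simp add: \<Lambda>_def tendsto_add)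
    then show "\<Lambda> (\<phi> \<oplus>\<^bsub>dual_space X\<^esub> \<psi>) = \<Lambda> \<phi> \<oplus>\<^bsub>complex_scalars\<^esub> \<Lambda> \<psi>"
      using \<phi>\<psi> sX by (simp add: \<Lambda>_def functional_add_closed limI)
  next
    fix c \<phi> assume \<phi>: "\<phi> \<in> carrier (dual_space X)"
    have "(\<lambda>n. c * \<phi> (s n)) \<longlonglongrightarrow> c * \<Lambda> \<phi>"
      using \<phi> lim by (simp add: \<Lambda>_def tendsto_mult_left)
    then show "\<Lambda> (c \<odot>\<^bsub>dual_space X\<^esub> \<phi>) = c \<odot>\<^bsub>complex_scalars\<^esub> \<Lambda> \<phi>"
      using \<phi> sX by (simp add: \<Lambda>_def functional_smult_closed limI)
  next
    fix \<phi> assume \<phi>: "\<phi> \<in> carrier (dual_space X)"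
    have "cmod (\<phi> (s n)) \<le> B * op_norm X complex_scalars \<phi>" for n
    proof -
      have "cmod (\<phi> (s n)) \<le> op_norm X complex_scalars \<phi> * vnorm X (s n)"
        using functional_bound[of \<phi> "s n"] \<phi> sX by simp
      also have "\<dots> \<le> op_norm X complex_scalars \<phi> * B"
        using B \<phi> dual.bop_norm_nonneg[of \<phi>] by (intro mult_left_mono) auto
      finally show ?thesis by (simp add: mult.commute)
    qed
    moreover have "(\<lambda>n. cmod (\<phi> (s n))) \<longlonglongrightarrow> cmod (\<Lambda> \<phi>)"
      using \<phi> lim by (simp add: \<Lambda>_def tendsto_norm)
    ultimately show "vnorm complex_scalars (\<Lambda> \<phi>) \<le> B * vnorm (dual_space X) \<phi>"
      by (simp add: LIMSEQ_le_const2)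
  qed (simp add: \<Lambda>_def)
  then obtain x where x: "x \<in> carrier X" "\<Lambda> = (\<lambda>\<phi>\<in>carrier (dual_space X). \<phi> x)"
    using refl unfolding reflexive_space_def by blast
  have lim_x: "(\<lambda>n. \<phi> (s n)) \<longlonglongrightarrow> \<phi> x" if "\<phi> \<in> ?D" for \<phi>
    using lim[OF that] fun_cong[OF x(2), of \<phi>] that by (simp add: \<Lambda>_def)
  have "(\<lambda>n. vnorm X (s n \<ominus> x)) \<longlonglongrightarrow> 0"
  proof (rule LIMSEQ_I)
    fix e :: real assume e: "0 < e"
    obtain N where N: "\<And>m n. m \<ge> N \<Longrightarrow> n \<ge> N \<Longrightarrow> vnorm X (s m \<ominus> s n) < e / 2"
      using cauchy[of "e / 2"] e by auto
    have "vnorm X (s n \<ominus> x) \<le> e / 2" if n: "n \<ge> N" for n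
    proof (rule vnorm_le_if_functionals_le)
      fix \<phi> assume \<phi>: "\<phi> \<in> dual_ball X"
      then have \<phi>D: "\<phi> \<in> ?D" by (simp add: dual_ball_iff)
      \<comment> \<open>With n fixed, letting m tend to infinity gives a bound that is the same for
        all \<phi> in the dual ball, and therefore a bound of the norm.\<close>
      have "(\<lambda>m. cmod (\<phi> (s n) - \<phi> (s m))) \<longlonglongrightarrow> cmod (\<phi> (s n) - \<phi> x)"
        by (intro tendsto_intros lim_x \<phi>D)
      moreover have "\<forall>m\<ge>N. cmod (\<phi> (s n) - \<phi> (s m)) \<le> e / 2"
      proof (intro allI impI)
        fix m assume m: "m \<ge> N"
        have "cmod (\<phi> (s n) - \<phi> (s m)) \<le> vnorm X (s n \<ominus> s m)"
          using \<phi> sX dual.bop_diff[OF \<phi>D sX[of n] sX[of m]] unfolding dual_ball_iff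
          by (metis complex_scalars_minus(2) diff_closed)
        then show "cmod (\<phi> (s n) - \<phi> (s m)) \<le> e / 2" using N[OF n m] by simp
      qed
      ultimately have "cmod (\<phi> (s n) - \<phi> x) \<le> e / 2" by (blast intro: LIMSEQ_le_const2)
      then show "cmod (\<phi> (s n \<ominus> x)) \<le> e / 2" using dual.bop_diff[OF \<phi>D sX[of n] x(1)] by simp
    qed (use sX x in auto)
    moreover have "vnorm X (s n \<ominus> x) \<ge> 0" for n using sX x by simp
    ultimately have "\<forall>n\<ge>N. norm (vnorm X (s n \<ominus> x) - 0) < e" using e by fastforce
    then show "\<exists>N. \<forall>n\<ge>N. norm (vnorm X (s n \<ominus> x) - 0) < e" by blast
  qed
  then show "\<exists>x. limitin metric.mtopology s x sequentially"
    using limitin_norm_iff[of s x] sX x(1) by blast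
qed

text \<open>Quotients are handled through the quotient map, because \<open>G\<close> is a space of cosets while \<open>H\<close>
  is a copy of such a space inside another type.\<close>

locale quotient_map = X: complex_normed_space X for X :: "'a normed_module" +
  fixes Y :: "'b normed_module" and \<pi> :: "'a \<Rightarrow> 'b"
  assumes carrier_eq: "carrier Y = \<pi> ` carrier X"
    and map_zero: "\<zero>\<^bsub>Y\<^esub> = \<pi> \<zero>\<^bsub>X\<^esub>"
    and map_add: "x \<in> carrier X \<Longrightarrow> y \<in> carrier X \<Longrightarrow> \<pi> x \<oplus>\<^bsub>Y\<^esub> \<pi> y = \<pi> (x \<oplus>\<^bsub>X\<^esub> y)"
    and map_smult: "x \<in> carrier X \<Longrightarrow> c \<odot>\<^bsub>Y\<^esub> \<pi> x = \<pi> (c \<odot>\<^bsub>X\<^esub> x)"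
    and norm_map_le: "x \<in> carrier X \<Longrightarrow> vnorm Y (\<pi> x) \<le> vnorm X x"
    and lift: "z \<in> carrier Y \<Longrightarrow> 0 < e \<Longrightarrow> \<exists>x\<in>carrier X. \<pi> x = z \<and> vnorm X x < vnorm Y z + e"
    and closed_kernel: "x \<in> carrier X
      \<Longrightarrow> (\<And>e. 0 < e \<Longrightarrow> \<exists>y\<in>carrier X. \<pi> y = \<pi> \<zero>\<^bsub>X\<^esub> \<and> vnorm X (x \<ominus>\<^bsub>X\<^esub> y) < e)
      \<Longrightarrow> \<pi> x = \<pi> \<zero>\<^bsub>X\<^esub>"
begin

lemma map_closed: "x \<in> carrier X \<Longrightarrow> \<pi> x \<in> carrier Y"
  by (simp add: carrier_eq)

lemma map_diff_eq_zero:
  assumes "x \<in> carrier X" "y \<in> carrier X" "\<pi> x = \<pi> y"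
  shows "\<pi> (x \<ominus>\<^bsub>X\<^esub> y) = \<pi> \<zero>\<^bsub>X\<^esub>"
proof -
  have "\<pi> (x \<ominus>\<^bsub>X\<^esub> y) = \<pi> x \<oplus>\<^bsub>Y\<^esub> (-1) \<odot>\<^bsub>Y\<^esub> \<pi> y"
    using assms(1,2) by (simp add: map_smult map_add X.M.minus_eq X.minus_eq_smult)
  also have "\<dots> = \<pi> (y \<ominus>\<^bsub>X\<^esub> y)"
    unfolding assms(3)
    using assms(1,2) by (simp add: map_smult map_add X.M.minus_eq X.minus_eq_smult)
  also have "y \<ominus>\<^bsub>X\<^esub> y = \<zero>\<^bsub>X\<^esub>" using assms by (simp add: X.diff_eq_zero_iff)
  finally show ?thesis .
qed

lemma quotient_norm_nonneg:
  assumes "y \<in> carrier Y"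
  shows "0 \<le> vnorm Y y"
proof (rule field_le_epsilon)
  fix e :: real assume "0 < e"
  then obtain x where "x \<in> carrier X" "vnorm X x < vnorm Y y + e" using lift[OF assms] by blast
  then show "0 \<le> vnorm Y y + e" using X.vnorm_nonneg[of x] by linarith
qed

text \<open>Half of homogeneity, from nearly optimal preimages of y. The other half follows by
  applying this one to the inverse scalar.\<close>

lemma quotient_norm_smult_le:
  assumes "y \<in> carrier Y"
  shows "vnorm Y (c \<odot>\<^bsub>Y\<^esub> y) \<le> cmod c * vnorm Y y"
proof -
  have "vnorm Y (c \<odot>\<^bsub>Y\<^esub> y) \<le> cmod c * (vnorm Y y + e)" if e: "0 < e" for e
  proof -
    obtain x where x: "x \<in> carrier X" "\<pi> x = y" "vnorm X x < vnorm Y y + e"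
      using lift[OF assms e] by blast
    have "vnorm Y (c \<odot>\<^bsub>Y\<^esub> y) \<le> vnorm X (c \<odot>\<^bsub>X\<^esub> x)"
      using x norm_map_le[of "c \<odot>\<^bsub>X\<^esub> x"] by (auto simp: map_smult)
    also have "\<dots> \<le> cmod c * (vnorm Y y + e)" using x by (simp add: X.vnorm_smult mult_left_mono)
    finally show ?thesis .
  qed
  moreover have "((\<lambda>e. cmod c * (vnorm Y y + e)) \<longlongrightarrow> cmod c * (vnorm Y y + 0)) (at_right 0)"
    by (intro tendsto_intros)
  ultimately show ?thesis
    using tendsto_lowerbound[of "\<lambda>e. cmod c * (vnorm Y y + e)"]
    by (simp add: eventually_mono[OF eventually_at_right_less])
qed

theorem complex_normed_space_quotient: "complex_normed_space Y"
proof (rule complex_normed_spaceI)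
  show "x \<oplus>\<^bsub>Y\<^esub> y \<oplus>\<^bsub>Y\<^esub> z = x \<oplus>\<^bsub>Y\<^esub> (y \<oplus>\<^bsub>Y\<^esub> z)"
    if "x \<in> carrier Y" "y \<in> carrier Y" "z \<in> carrier Y" for x y z
    using that by (auto simp: carrier_eq map_add X.M.a_assoc)
  show "x \<oplus>\<^bsub>Y\<^esub> y = y \<oplus>\<^bsub>Y\<^esub> x" if "x \<in> carrier Y" "y \<in> carrier Y" for x y
    using that by (auto simp: carrier_eq map_add X.M.a_comm)
  show "vnorm Y y = 0 \<longleftrightarrow> y = \<zero>\<^bsub>Y\<^esub>" if y: "y \<in> carrier Y" for y
  proof
    assume y0: "vnorm Y y = 0"
    obtain x where x: "x \<in> carrier X" "\<pi> x = y" using y by (auto simp: carrier_eq)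
    have "\<pi> x = \<pi> \<zero>\<^bsub>X\<^esub>"
    proof (rule closed_kernel[OF x(1)])
      fix e :: real assume "0 < e"
      then obtain z where z: "z \<in> carrier X" "\<pi> z = y" "vnorm X z < e" using lift[OF y, of e] y0 by auto
      \<comment> \<open>x - z is an element of the kernel at distance ||z|| from x, so x is a limit
        of points of the kernel.\<close>
      have "\<pi> (x \<ominus>\<^bsub>X\<^esub> z) = \<pi> \<zero>\<^bsub>X\<^esub>" using x z by (intro map_diff_eq_zero) auto
      moreover have "x \<ominus>\<^bsub>X\<^esub> (x \<ominus>\<^bsub>X\<^esub> z) = z"
        using x z by (simp add: X.M.minus_eq X.M.minus_add X.M.r_neg1 X.M.r_neg2)
      ultimately show "\<exists>w\<in>carrier X. \<pi> w = \<pi> \<zero>\<^bsub>X\<^esub> \<and> vnorm X (x \<ominus>\<^bsub>X\<^esub> w) < e"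
        using x z by (intro bexI[of _ "x \<ominus>\<^bsub>X\<^esub> z"]) auto
    qed
    then show "y = \<zero>\<^bsub>Y\<^esub>" using x by (simp add: map_zero)
  next
    assume "y = \<zero>\<^bsub>Y\<^esub>"
    then show "vnorm Y y = 0"
      using norm_map_le[of "\<zero>\<^bsub>X\<^esub>"] quotient_norm_nonneg[OF y] by (simp add: map_zero)
  qed
  show "vnorm Y (x \<oplus>\<^bsub>Y\<^esub> y) \<le> vnorm Y x + vnorm Y y" if xy: "x \<in> carrier Y" "y \<in> carrier Y" for x y
  proof (rule field_le_epsilon)
    fix e :: real assume e: "0 < e"
    obtain x' where x': "x' \<in> carrier X" "\<pi> x' = x" "vnorm X x' < vnorm Y x + e / 2"
      using lift[OF xy(1), of "e / 2"] e by auto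
    obtain y' where y': "y' \<in> carrier X" "\<pi> y' = y" "vnorm X y' < vnorm Y y + e / 2"
      using lift[OF xy(2), of "e / 2"] e by auto
    have "x \<oplus>\<^bsub>Y\<^esub> y = \<pi> (x' \<oplus>\<^bsub>X\<^esub> y')" using x' y' map_add by blast
    then have "vnorm Y (x \<oplus>\<^bsub>Y\<^esub> y) \<le> vnorm X (x' \<oplus>\<^bsub>X\<^esub> y')" using norm_map_le x' y' by simp
    also have "\<dots> \<le> vnorm X x' + vnorm X y'" using x' y' by (intro X.vnorm_triangle)
    finally show "vnorm Y (x \<oplus>\<^bsub>Y\<^esub> y) \<le> vnorm Y x + vnorm Y y + e" using x' y' by linarith
  qed
  show "vnorm Y (c \<odot>\<^bsub>Y\<^esub> y) = cmod c * vnorm Y y" if y: "y \<in> carrier Y" for c y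
  proof (rule antisym[OF quotient_norm_smult_le[OF y]])
    have cy: "c \<odot>\<^bsub>Y\<^esub> y \<in> carrier Y" using y by (auto simp: carrier_eq map_smult)
    show "cmod c * vnorm Y y \<le> vnorm Y (c \<odot>\<^bsub>Y\<^esub> y)"
    proof (cases "c = 0")
      case True
      then show ?thesis using quotient_norm_nonneg[OF cy] by simp
    next
      case False
      have "inverse c \<odot>\<^bsub>Y\<^esub> (c \<odot>\<^bsub>Y\<^esub> y) = y"
        using y False by (auto simp: carrier_eq map_smult X.smult_smult)
      then have "vnorm Y y \<le> cmod (inverse c) * vnorm Y (c \<odot>\<^bsub>Y\<^esub> y)"
        using quotient_norm_smult_le[OF cy, of "inverse c"] by simp
      then show ?thesis using False by (simp add: norm_divide field_simps)
    qed
  qed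
qed (auto simp: carrier_eq map_zero map_add map_smult X.smult_add X.add_smult X.smult_smult)

sublocale Y: normed_space_dual Y
  by (intro normed_space_dual.intro complex_normed_space_quotient)

sublocale normed_spaces X Y
  by (intro normed_spaces.intro) unfold_locales

lemma quotient_map_bounded: "restrict \<pi> (carrier X) \<in> bounded_operators X Y"
  by (rule bounded_operatorsI[where C = 1])
    (auto simp: map_closed map_add map_smult norm_map_le intro: X.complex_normed_space_axioms)

end

text \<open>Interpreted twice: by the space of cosets, which is G, and by its copy in the type
  \<open>'h\<close>, which is H. Reflexivity and completeness are thereby proved once for
  both.\<close>

locale lp_quotient = quotient_map "lp_space (conj_index p)" Y \<pi>
  for p :: real and Y :: "'b normed_module" and \<pi> :: "(nat \<Rightarrow> complex) \<Rightarrow> 'b" +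
  assumes p_gt_1: "1 < p"
begin

lemma unit_in_lp: "unit_seq n \<in> carrier (lp_space (conj_index p))"
  using conj_index_gt_1[OF p_gt_1] by (intro unit_seq_lp) simp

lemma unit_image_closed: "\<pi> (unit_seq n) \<in> carrier Y"
  by (intro map_closed unit_in_lp)

lemma quotient_expansion:
  assumes a: "a \<in> carrier (lp_space (conj_index p))"
  shows "limitin (norm_topology Y) (\<lambda>k. \<Oplus>\<^bsub>Y\<^esub>n\<in>{..<k}. a n \<odot>\<^bsub>Y\<^esub> \<pi> (unit_seq n)) (\<pi> a) sequentially"
proof -
  let ?\<pi> = "restrict \<pi> (carrier (lp_space (conj_index p)))"
  have cu: "c \<odot>\<^bsub>lp_space (conj_index p)\<^esub> unit_seq n \<in> carrier (lp_space (conj_index p))" for c n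
    by (intro X.smult_cl unit_in_lp)
  have "limitin (norm_topology Y)
      (\<lambda>k. ?\<pi> (\<Oplus>\<^bsub>lp_space (conj_index p)\<^esub>n\<in>{..<k}. a n \<odot>\<^bsub>lp_space (conj_index p)\<^esub> unit_seq n)) (?\<pi> a) sequentially"
    using conj_index_gt_1[OF p_gt_1]
    by (intro bop_limit quotient_map_bounded lp_expansion a X.psum_closed cu) simp
  moreover have "?\<pi> (\<Oplus>\<^bsub>lp_space (conj_index p)\<^esub>n\<in>{..<k}. a n \<odot>\<^bsub>lp_space (conj_index p)\<^esub> unit_seq n)
      = (\<Oplus>\<^bsub>Y\<^esub>n\<in>{..<k}. a n \<odot>\<^bsub>Y\<^esub> \<pi> (unit_seq n))" for k
    unfolding bop_psum[OF quotient_map_bounded cu]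
    using cu by (simp only: restrict_apply' map_smult unit_in_lp)
  ultimately show ?thesis using a by (simp only: restrict_apply')
qed

lemma functional_compose_bounded:
  assumes \<phi>: "\<phi> \<in> bounded_operators Y complex_scalars"
  shows "(\<lambda>a\<in>carrier (lp_space (conj_index p)). \<phi> (\<pi> a))
    \<in> bounded_operators (lp_space (conj_index p)) complex_scalars"
proof (rule bounded_operatorsI)
  fix a assume a: "a \<in> carrier (lp_space (conj_index p))"
  have "cmod (\<phi> (\<pi> a)) \<le> op_norm Y complex_scalars \<phi> * vnorm Y (\<pi> a)"
    using Y.functional_bound[OF \<phi> map_closed[OF a]] .
  also have "\<dots> \<le> op_norm Y complex_scalars \<phi> * vnorm (lp_space (conj_index p)) a"
    by (intro mult_left_mono norm_map_le[OF a] Y.dual.bop_norm_nonneg[OF \<phi>])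
  finally show "vnorm complex_scalars (\<phi> (\<pi> a))
      \<le> op_norm Y complex_scalars \<phi> * vnorm (lp_space (conj_index p)) a" by simp
qed (use \<phi> X.complex_normed_space_axioms in
    \<open>auto simp: bop_add bop_smult map_closed map_add[symmetric] map_smult[symmetric] simp del: lp_space_simps\<close>)

lemma functional_sums:
  assumes \<phi>: "\<phi> \<in> bounded_operators Y complex_scalars" and a: "a \<in> carrier (lp_space (conj_index p))"
  shows "(\<lambda>n. a n * \<phi> (\<pi> (unit_seq n))) sums \<phi> (\<pi> a)"
  using lp_functional_sums[OF _ functional_compose_bounded[OF \<phi>] a] conj_index_gt_1[OF p_gt_1]
    unit_in_lp a by (simp del: lp_space_simps)

text \<open>Together with \<open>functional_norm_le\<close> this says that \<phi> \<mapsto> (\<phi>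
  (\<pi> e_n)), with e_n the unit vectors, embeds the dual of Y isometrically into l_p: the dual of
  a quotient of l_q is a subspace of the dual of l_q.\<close>

lemma functional_coefficients:
  assumes \<phi>: "\<phi> \<in> bounded_operators Y complex_scalars"
  shows "(\<lambda>n. \<phi> (\<pi> (unit_seq n))) \<in> carrier (lp_space p)"
    and "vnorm (lp_space p) (\<lambda>n. \<phi> (\<pi> (unit_seq n))) \<le> op_norm Y complex_scalars \<phi>"
proof -
  let ?\<psi> = "\<lambda>a\<in>carrier (lp_space (conj_index p)). \<phi> (\<pi> a)"
  have bound: "cmod (?\<psi> a) \<le> op_norm Y complex_scalars \<phi> * vnorm (lp_space (conj_index p)) a"
    if a: "a \<in> carrier (lp_space (conj_index p))" for a
  proof -
    have "cmod (\<phi> (\<pi> a)) \<le> op_norm Y complex_scalars \<phi> * vnorm Y (\<pi> a)"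
      using Y.functional_bound[OF \<phi> map_closed[OF a]] .
    also have "\<dots> \<le> op_norm Y complex_scalars \<phi> * vnorm (lp_space (conj_index p)) a"
      by (intro mult_left_mono norm_map_le[OF a] Y.dual.bop_norm_nonneg[OF \<phi>])
    finally show ?thesis using a by (simp del: lp_space_simps)
  qed
  \<comment> \<open>The duality of the sequence spaces with the exponents exchanged; the conjugate
    of the conjugate exponent is \<open>p\<close> again.\<close>
  note * = lp_dual_lp[OF conj_index_gt_1[OF p_gt_1] functional_compose_bounded[OF \<phi>]
      Y.dual.bop_norm_nonneg[OF \<phi>] bound]
    lp_dual_norm[OF conj_index_gt_1[OF p_gt_1] functional_compose_bounded[OF \<phi>]
      Y.dual.bop_norm_nonneg[OF \<phi>] bound]
  then show "(\<lambda>n. \<phi> (\<pi> (unit_seq n))) \<in> carrier (lp_space p)"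
    and "vnorm (lp_space p) (\<lambda>n. \<phi> (\<pi> (unit_seq n))) \<le> op_norm Y complex_scalars \<phi>"
    using unit_in_lp by (simp_all add: conj_index_involutive[OF p_gt_1] del: lp_space_simps)
qed

text \<open>Hoelder's inequality for preimages of y whose norms are arbitrarily close to the norm of
  y.\<close>

lemma functional_norm_le:
  assumes \<phi>: "\<phi> \<in> bounded_operators Y complex_scalars"
  shows "op_norm Y complex_scalars \<phi> \<le> vnorm (lp_space p) (\<lambda>n. \<phi> (\<pi> (unit_seq n)))"
    (is "_ \<le> ?S")
proof (rule Y.dual.op_norm_le)
  fix y assume y: "y \<in> carrier Y"
  have "cmod (\<phi> y) \<le> (vnorm Y y + e) * ?S" if e: "0 < e" for e
  proof -
    obtain a where a: "a \<in> carrier (lp_space (conj_index p))" "\<pi> a = y"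
      "vnorm (lp_space (conj_index p)) a < vnorm Y y + e" using lift[OF y e] by blast
    have "cmod (\<phi> y) \<le> vnorm (lp_space (conj_index p)) a * ?S"
      using functional_sums[OF \<phi> a(1)] hoelder_norm_le[OF p_gt_1 a(1) functional_coefficients(1)[OF \<phi>]] a(2)
      by (simp add: sums_iff)
    also have "\<dots> \<le> (vnorm Y y + e) * ?S"
      using a by (intro mult_right_mono vnorm_lp_nonneg) simp
    finally show ?thesis .
  qed
  moreover have "((\<lambda>e. (vnorm Y y + e) * ?S) \<longlongrightarrow> (vnorm Y y + 0) * ?S) (at_right 0)"
    by (intro tendsto_intros)
  ultimately show "vnorm complex_scalars (\<phi> y) \<le> ?S * vnorm Y y"
    using tendsto_lowerbound[of "\<lambda>e. (vnorm Y y + e) * ?S"]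
    by (simp add: eventually_mono[OF eventually_at_right_less] mult.commute)
qed (rule vnorm_lp_nonneg)

text \<open>By \<open>functional_norm_le\<close>, a bounded \<Lambda> on the dual satisfies the
  hypothesis of \<open>helly\<close> for the images of the unit vectors. For the resulting a,
  \<open>functional_sums\<close> identifies \<Lambda> with evaluation at \<pi> a. The constant is
  |C| because the one in \<open>bounded_operators\<close> may be negative.\<close>

theorem reflexive: "reflexive_space Y"
  unfolding reflexive_space_def
proof (intro equalityI subsetI)
  fix \<Lambda> assume "\<Lambda> \<in> (\<lambda>x. \<lambda>\<phi>\<in>carrier (dual_space Y). \<phi> x) ` carrier Y"
  then show "\<Lambda> \<in> carrier (dual_space (dual_space Y))" using Y.evaluation_bounded by auto
next
  fix \<Lambda> assume "\<Lambda> \<in> carrier (dual_space (dual_space Y))"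
  then have \<Lambda>: "\<Lambda> \<in> bounded_operators (dual_space Y) complex_scalars" by simp
  let ?D = "bounded_operators Y complex_scalars"
  obtain C where C: "\<And>\<phi>. \<phi> \<in> ?D \<Longrightarrow> cmod (\<Lambda> \<phi>) \<le> C * op_norm Y complex_scalars \<phi>"
    using bop_bound[OF \<Lambda>] by auto
  obtain a where a: "a \<in> carrier (lp_space (conj_index p))"
    "\<And>\<phi>. \<phi> \<in> ?D \<Longrightarrow> (\<lambda>n. a n * \<phi> (\<pi> (unit_seq n))) sums \<Lambda> \<phi>"
  proof (rule Y.helly[OF p_gt_1, of "\<lambda>n. \<pi> (unit_seq n)" "\<bar>C\<bar>" \<Lambda>])
    show "cmod (\<Lambda> \<phi>) \<le> \<bar>C\<bar> * vnorm (lp_space p) (\<lambda>n. \<phi> (\<pi> (unit_seq n)))" if \<phi>: "\<phi> \<in> ?D" for \<phi>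
    proof -
      have "cmod (\<Lambda> \<phi>) \<le> C * op_norm Y complex_scalars \<phi>" by (rule C[OF \<phi>])
      also have "\<dots> \<le> \<bar>C\<bar> * vnorm (lp_space p) (\<lambda>n. \<phi> (\<pi> (unit_seq n)))"
        using functional_norm_le[OF \<phi>] Y.dual.bop_norm_nonneg[OF \<phi>] by (intro mult_mono) auto
      finally show ?thesis .
    qed
    show "\<Lambda> (\<lambda>x\<in>carrier Y. \<phi> x + \<psi> x) = \<Lambda> \<phi> + \<Lambda> \<psi>" if "\<phi> \<in> ?D" "\<psi> \<in> ?D" for \<phi> \<psi>
      using bop_add[OF \<Lambda>, of \<phi> \<psi>] that by simp
    show "\<Lambda> (\<lambda>x\<in>carrier Y. c * \<phi> x) = c * \<Lambda> \<phi>" if "\<phi> \<in> ?D" for c \<phi>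
      using bop_smult[OF \<Lambda>, of \<phi> c] that by simp
  qed (use unit_image_closed functional_coefficients(1) in \<open>auto simp del: lp_space_simps\<close>)
  have "\<Lambda> = (\<lambda>\<phi>\<in>carrier (dual_space Y). \<phi> (\<pi> a))"
  proof (rule extensionalityI[of _ "carrier (dual_space Y)"])
    show "\<Lambda> \<in> extensional (carrier (dual_space Y))" by (rule bop_extensional[OF \<Lambda>])
    show "\<Lambda> \<phi> = (\<lambda>\<phi>\<in>carrier (dual_space Y). \<phi> (\<pi> a)) \<phi>" if "\<phi> \<in> carrier (dual_space Y)" for \<phi>
      using that sums_unique2[OF a(2)[of \<phi>] functional_sums[of \<phi> a]] a(1) by simp
  qed auto
  then show "\<Lambda> \<in> (\<lambda>x. \<lambda>\<phi>\<in>carrier (dual_space Y). \<phi> x) ` carrier Y"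
    using map_closed[OF a(1)] by blast
qed

theorem complex_banach_space_quotient: "complex_banach_space Y"
  by (intro complex_banach_space.intro complex_banach_space_axioms.intro complex_normed_space_quotient
    Y.reflexive_imp_complete reflexive)

text \<open>With \<open>quotient_in_p_conv\<close> this shows that the image of the closed unit ball
  of l_q lies in the p-convex hull of a sequence of weak norm at most 1. The bound 1 for the norm of
  g comes from here.\<close>

lemma unit_images_weak_lp: "(\<lambda>n. \<pi> (unit_seq n)) \<in> weak_lp p Y"
  and weak_lp_norm_unit_images: "weak_lp_norm p Y (\<lambda>n. \<pi> (unit_seq n)) \<le> 1"
proof -
  have le: "vnorm (lp_space p) (\<lambda>n. \<phi> (\<pi> (unit_seq n))) \<le> 1" if "\<phi> \<in> dual_ball Y" for \<phi>
    using that functional_coefficients(2)[of \<phi>] by (simp add: dual_ball_def)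
  then show "(\<lambda>n. \<pi> (unit_seq n)) \<in> weak_lp p Y"
    using unit_image_closed functional_coefficients(1)
    by (auto simp: weak_lp_def dual_ball_def simp del: lp_space_simps intro!: bdd_aboveI2[where M = 1])
  have "dual_ball Y \<noteq> {}" using Y.norming_functional[of "\<zero>\<^bsub>Y\<^esub>"] by auto
  then show "weak_lp_norm p Y (\<lambda>n. \<pi> (unit_seq n)) \<le> 1"
    unfolding weak_lp_norm_def using le by (intro cSUP_least)
qed

lemma quotient_in_p_conv:
  assumes "a \<in> carrier (lp_space (conj_index p))" "vnorm (lp_space (conj_index p)) a \<le> 1"
  shows "\<pi> a \<in> p_conv p Y (\<lambda>n. \<pi> (unit_seq n))"
  unfolding p_conv_def using assms quotient_expansion[OF assms(1)] by blast

end

section \<open>Spaces of cosets\<close>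

lemma (in complex_normed_space) mem_coset_iff:
  assumes "N \<subseteq> carrier X" "x \<in> carrier X"
  shows "y \<in> N +> x \<longleftrightarrow> y \<in> carrier X \<and> y \<ominus> x \<in> N"
proof
  assume "y \<in> N +> x"
  then obtain h where "h \<in> N" "y = h \<oplus> x" by (auto simp: a_r_coset_def')
  then show "y \<in> carrier X \<and> y \<ominus> x \<in> N"
    using assms add_diff_cancel[of x h] by (auto simp: M.a_comm subset_eq)
next
  assume "y \<in> carrier X \<and> y \<ominus> x \<in> N"
  then have "y = (y \<ominus> x) \<oplus> x" "y \<ominus> x \<in> N" using assms by (simp_all add: diff_add_cancel)
  then show "y \<in> N +> x" unfolding a_r_coset_def' by blast
qed

lemma (in complex_normed_space) coset_eq_iff:
  assumes N: "submodule N complex_scalars X" and x: "x \<in> carrier X" and y: "y \<in> carrier X"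
  shows "N +> x = N +> y \<longleftrightarrow> x \<ominus> y \<in> N"
proof
  have sub: "N \<subseteq> carrier X" by (rule submoduleE(1)[OF N])
  have "\<zero> \<in> N" using submoduleE(4)[OF N, of 0] submoduleE(2)[OF N] sub by fastforce
  then have "x \<in> N +> x" using x by (simp add: mem_coset_iff[OF sub] diff_eq_zero_iff[THEN iffD2])
  moreover assume "N +> x = N +> y"
  ultimately show "x \<ominus> y \<in> N" using mem_coset_iff[OF sub y] by blast
next
  have sub: "N \<subseteq> carrier X" by (rule submoduleE(1)[OF N])
  assume "x \<ominus> y \<in> N"
  then have "x \<in> N +> y" using x y by (simp add: mem_coset_iff[OF sub])
  then have "N +> y = N +> x" using y submodule.axioms(1)[OF N] by (rule M.a_repr_independence)
  then show "N +> x = N +> y" by simp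
qed

text \<open>The infimum over a coset need not be attained, hence the e in \<open>lift\<close>. The
  last axiom is where closedness of N enters: a point outside N is the centre of a ball that misses
  N.\<close>

lemma (in complex_normed_space) quotient_map_coset:
  assumes "closed_subspace N X"
  shows "quotient_map X (quotient_space X N) (\<lambda>x. N +> x)"
proof -
  have sub: "submodule N complex_scalars X" and closed: "closedin metric.mtopology N"
    using assms by (auto simp: closed_subspace_def)
  have N: "N \<subseteq> carrier X" using submoduleE(1)[OF sub] .
  have N_smult: "c \<odot> x \<in> N" if "x \<in> N" for c x using submoduleE(4)[OF sub] that by simp
  have N_add: "x \<oplus> y \<in> N" if "x \<in> N" "y \<in> N" for x y using submoduleE(5)[OF sub] that by simp
  have N_zero: "\<zero> \<in> N" using N_smult[of _ 0] submoduleE(2)[OF sub] N by fastforce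
  note mem = mem_coset_iff[OF N]
  have eq_zero: "N +> x = N +> \<zero> \<longleftrightarrow> x \<in> N" if x: "x \<in> carrier X" for x
    using x by (simp add: coset_eq_iff[OF sub] diff_zero)
  show ?thesis
  proof (intro quotient_map.intro quotient_map_axioms.intro complex_normed_space_axioms)
    show "carrier (quotient_space X N) = (\<lambda>x. N +> x) ` carrier X"
      by (auto simp: quotient_space_def A_RCOSETS_def')
    show "\<zero>\<^bsub>quotient_space X N\<^esub> = N +> \<zero>"
      using N by (auto simp: quotient_space_def mem diff_zero)
    show "(N +> x) \<oplus>\<^bsub>quotient_space X N\<^esub> (N +> y) = N +> (x \<oplus> y)"
      if x: "x \<in> carrier X" and y: "y \<in> carrier X" for x y
    proof -
      have "(N +> x) <+>\<^bsub>X\<^esub> (N +> y) = N +> (x \<oplus> y)"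
      proof (intro equalityI subsetI)
        fix z assume "z \<in> (N +> x) <+>\<^bsub>X\<^esub> (N +> y)"
        then obtain u w where "u \<in> N +> x" "w \<in> N +> y" "z = u \<oplus> w" by (auto simp: set_add_def')
        then show "z \<in> N +> (x \<oplus> y)" using x y N_add by (simp add: mem add_diff_add)
      next
        fix z assume "z \<in> N +> (x \<oplus> y)"
        then have z: "z \<in> carrier X" "z \<ominus> (x \<oplus> y) \<in> N" using x y by (auto simp: mem)
        have "z \<ominus> y \<in> N +> x"
          using x y z by (simp add: mem) (simp add: M.minus_eq M.minus_add M.a_ac)
        moreover have "y \<in> N +> y" using y N_zero by (simp add: mem diff_eq_zero_iff[THEN iffD2])
        moreover have "z = (z \<ominus> y) \<oplus> y" using z y by (simp add: diff_add_cancel)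
        ultimately show "z \<in> (N +> x) <+>\<^bsub>X\<^esub> (N +> y)" unfolding set_add_def' by blast
      qed
      then show ?thesis by (simp add: quotient_space_def)
    qed
    show "c \<odot>\<^bsub>quotient_space X N\<^esub> (N +> x) = N +> (c \<odot> x)" if x: "x \<in> carrier X" for c x
    proof -
      have "N <+>\<^bsub>X\<^esub> (\<lambda>x. c \<odot> x) ` (N +> x) = N +> (c \<odot> x)"
      proof (intro equalityI subsetI)
        fix z assume "z \<in> N <+>\<^bsub>X\<^esub> (\<lambda>x. c \<odot> x) ` (N +> x)"
        then obtain h u where hu: "h \<in> N" "u \<in> N +> x" "z = h \<oplus> c \<odot> u" by (auto simp: set_add_def')
        have c: "h \<in> carrier X" "u \<in> carrier X" "u \<ominus> x \<in> N" using hu x N by (auto simp: mem)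
        have "z \<ominus> c \<odot> x = h \<oplus> c \<odot> (u \<ominus> x)"
          using c x hu by (simp add: smult_add smult_minus M.minus_eq M.a_assoc)
        then show "z \<in> N +> (c \<odot> x)" using c x hu N_add N_smult by (simp add: mem)
      next
        fix z assume "z \<in> N +> (c \<odot> x)"
        then have z: "z \<in> carrier X" "z \<ominus> c \<odot> x \<in> N" using x by (auto simp: mem)
        moreover have "x \<in> N +> x" using x N_zero by (simp add: mem diff_eq_zero_iff[THEN iffD2])
        moreover have "z = (z \<ominus> c \<odot> x) \<oplus> c \<odot> x" using z x by (simp add: diff_add_cancel)
        ultimately show "z \<in> N <+>\<^bsub>X\<^esub> (\<lambda>x. c \<odot> x) ` (N +> x)" unfolding set_add_def' by blast
      qed
      then show ?thesis by (simp add: quotient_space_def)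
    qed
    have bdd: "bdd_below (vnorm X ` (N +> x))" if "x \<in> carrier X" for x
      using that by (intro bdd_belowI2[of _ 0]) (auto simp: mem)
    have self: "x \<in> N +> x" if "x \<in> carrier X" for x
      using that N_zero by (simp add: mem diff_eq_zero_iff[THEN iffD2])
    show "vnorm (quotient_space X N) (N +> x) \<le> vnorm X x" if x: "x \<in> carrier X" for x
      using cINF_lower[OF bdd[OF x] self[OF x]] by (simp add: quotient_space_def)
    show "\<exists>x\<in>carrier X. N +> x = y \<and> vnorm X x < vnorm (quotient_space X N) y + e"
      if y: "y \<in> carrier (quotient_space X N)" and e: "0 < e" for y e
    proof -
      obtain x where x: "x \<in> carrier X" "y = N +> x"
        using y by (auto simp: quotient_space_def A_RCOSETS_def')
      have "(INF x\<in>y. vnorm X x) < (INF x\<in>y. vnorm X x) + e" using e by simp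
      then obtain z where z: "z \<in> N +> x" "vnorm X z < (INF x\<in>y. vnorm X x) + e"
        using cINF_less_iff[OF _ bdd[OF x(1)]] self[OF x(1)] x(2) by blast
      then have "N +> z = y" using x by (simp add: mem coset_eq_iff[OF sub])
      then show ?thesis using z x by (auto simp: quotient_space_def mem)
    qed
    show "N +> x = N +> \<zero>" if x: "x \<in> carrier X"
      and ap: "\<And>e. 0 < e \<Longrightarrow> \<exists>y\<in>carrier X. N +> y = N +> \<zero> \<and> vnorm X (x \<ominus> y) < e" for x
    proof (rule ccontr)
      assume "N +> x \<noteq> N +> \<zero>"
      then have "x \<in> carrier X - N" using x by (simp add: eq_zero)
      then obtain r where r: "0 < r" "disjnt N (metric.mball x r)"
        using closed unfolding metric.closedin_metric by blast
      obtain y where "y \<in> carrier X" "N +> y = N +> \<zero>" "vnorm X (x \<ominus> y) < r" using ap[OF r(1)] by blast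
      then have "y \<in> N" "y \<in> metric.mball x r" using x by (auto simp: eq_zero ndist_def)
      then show False using r(2) by (auto simp: disjnt_def)
    qed
  qed
qed

text \<open>Transport of structure along j, meant for j injective on the carrier, where
  \<open>inv_into\<close> is a true inverse. It carries a space of cosets into the type in which H
  has to live.\<close>

definition transport :: "('b \<Rightarrow> 'c) \<Rightarrow> 'b normed_module \<Rightarrow> 'c normed_module" where
  "transport j Y = \<lparr>carrier = j ` carrier Y, mult = undefined, one = undefined,
     zero = j \<zero>\<^bsub>Y\<^esub>,
     add = (\<lambda>x y. j (inv_into (carrier Y) j x \<oplus>\<^bsub>Y\<^esub> inv_into (carrier Y) j y)),
     smult = (\<lambda>c x. j (c \<odot>\<^bsub>Y\<^esub> inv_into (carrier Y) j x)),
     vnorm = (\<lambda>x. vnorm Y (inv_into (carrier Y) j x))\<rparr>"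

context
  fixes j :: "'b \<Rightarrow> 'c" and Y :: "'b normed_module"
  assumes j: "inj_on j (carrier Y)"
begin

lemma transport_simps [simp]:
  "carrier (transport j Y) = j ` carrier Y"
  "\<zero>\<^bsub>transport j Y\<^esub> = j \<zero>\<^bsub>Y\<^esub>"
  "x \<in> carrier Y \<Longrightarrow> y \<in> carrier Y \<Longrightarrow> j x \<oplus>\<^bsub>transport j Y\<^esub> j y = j (x \<oplus>\<^bsub>Y\<^esub> y)"
  "x \<in> carrier Y \<Longrightarrow> c \<odot>\<^bsub>transport j Y\<^esub> j x = j (c \<odot>\<^bsub>Y\<^esub> x)"
  "x \<in> carrier Y \<Longrightarrow> vnorm (transport j Y) (j x) = vnorm Y x"
  using j by (simp_all add: transport_def)

text \<open>The copy is again a quotient of X, with the composed map, so that all results on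
  quotients apply to it.\<close>

lemma quotient_map_transport:
  assumes "quotient_map X Y \<pi>"
  shows "quotient_map X (transport j Y) (j \<circ> \<pi>)"
proof -
  interpret quotient_map X Y \<pi> by fact
  have eq_iff: "j (\<pi> x) = j (\<pi> y) \<longleftrightarrow> \<pi> x = \<pi> y" if "x \<in> carrier X" "y \<in> carrier X" for x y
    using that j by (simp add: inj_on_eq_iff map_closed)
  show ?thesis
  proof (intro quotient_map.intro quotient_map_axioms.intro X.complex_normed_space_axioms)
    show "\<exists>x\<in>carrier X. (j \<circ> \<pi>) x = y \<and> vnorm X x < vnorm (transport j Y) y + e"
      if y: "y \<in> carrier (transport j Y)" and e: "0 < e" for y e
    proof -
      obtain z where z: "z \<in> carrier Y" "y = j z" using y by auto
      then show ?thesis using lift[OF z(1) e] by auto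
    qed
    show "(j \<circ> \<pi>) x = (j \<circ> \<pi>) \<zero>\<^bsub>X\<^esub>" if x: "x \<in> carrier X"
      and ap: "\<And>e. 0 < e \<Longrightarrow> \<exists>y\<in>carrier X. (j \<circ> \<pi>) y = (j \<circ> \<pi>) \<zero>\<^bsub>X\<^esub> \<and> vnorm X (x \<ominus>\<^bsub>X\<^esub> y) < e"
      for x
    proof -
      have "\<pi> x = \<pi> \<zero>\<^bsub>X\<^esub>"
      proof (rule closed_kernel[OF x])
        fix e :: real assume "0 < e"
        then show "\<exists>y\<in>carrier X. \<pi> y = \<pi> \<zero>\<^bsub>X\<^esub> \<and> vnorm X (x \<ominus>\<^bsub>X\<^esub> y) < e"
          using ap[of e] eq_iff by auto
      qed
      then show ?thesis by simp
    qed
  qed (auto simp: map_closed map_zero map_add map_smult norm_map_le image_image carrier_eq)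
qed

end

section \<open>Weakly summable sequences\<close>

lemma (in normed_spaces) kernel_closed_subspace:
  assumes T: "T \<in> bounded_operators X Y"
  shows "closed_subspace {x \<in> carrier X. T x = \<zero>\<^bsub>Y\<^esub>} X"
  unfolding closed_subspace_def
proof
  let ?N = "{x \<in> carrier X. T x = \<zero>\<^bsub>Y\<^esub>}"
  show "submodule ?N complex_scalars X"
    by (rule X.submoduleI)
      (auto simp: bop_zero[OF T] bop_add[OF T] bop_smult[OF T] X.minus_eq_smult)
  show "closedin X.metric.mtopology ?N"
    unfolding X.metric.closedin_metric
  proof (intro conjI allI impI)
    fix x assume "x \<in> carrier X - ?N"
    then have x: "x \<in> carrier X" "T x \<noteq> \<zero>\<^bsub>Y\<^esub>" by auto
    then have pos: "0 < vnorm Y (T x)"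
      using bop_closed[OF T x(1)] by (simp add: less_le Y.vnorm_eq_0_iff eq_commute[of 0])
    \<comment> \<open>Within this distance of x the value of T changes by less than ||T x||, so T
      has no zero there. The added 1 keeps the denominator positive.\<close>
    define r where "r = vnorm Y (T x) / (op_norm X Y T + 1)"
    have r: "0 < r" using pos bop_norm_nonneg[OF T] by (simp add: r_def)
    have "y \<notin> X.metric.mball x r" if y: "y \<in> ?N" for y
    proof
      assume "y \<in> X.metric.mball x r"
      then have yr: "y \<in> carrier X" "vnorm X (x \<ominus>\<^bsub>X\<^esub> y) < r" using x by (auto simp: ndist_def)
      have "vnorm Y (T x) = vnorm Y (T (x \<ominus>\<^bsub>X\<^esub> y))"
        using y x by (simp add: bop_diff[OF T] Y.diff_zero bop_closed[OF T])
      also have "\<dots> \<le> op_norm X Y T * vnorm X (x \<ominus>\<^bsub>X\<^esub> y)"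
        using x yr by (intro vnorm_le_op_norm[OF T]) auto
      also have "\<dots> \<le> op_norm X Y T * r" using yr bop_norm_nonneg[OF T] by (intro mult_left_mono) auto
      also have "\<dots> < (op_norm X Y T + 1) * r" using r by simp
      also have "\<dots> = vnorm Y (T x)" using bop_norm_nonneg[OF T] by (simp add: r_def)
      finally show False by simp
    qed
    then show "\<exists>r>0. disjnt ?N (X.metric.mball x r)" using r unfolding disjnt_def by blast
  qed auto
qed

lemma bop_compose:
  assumes "complex_normed_space X" "complex_normed_space Y" "complex_normed_space Z"
    and T: "T \<in> bounded_operators X Y" and S: "S \<in> bounded_operators Y Z"
  shows "(\<lambda>x\<in>carrier X. S (T x)) \<in> bounded_operators X Z"
    and "x \<in> carrier X \<Longrightarrow> vnorm Z (S (T x)) \<le> op_norm Y Z S * op_norm X Y T * vnorm X x"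
proof -
  interpret XY: normed_spaces X Y by (intro normed_spaces.intro assms)
  interpret YZ: normed_spaces Y Z by (intro normed_spaces.intro assms)
  show *: "vnorm Z (S (T x)) \<le> op_norm Y Z S * op_norm X Y T * vnorm X x" if x: "x \<in> carrier X" for x
  proof -
    have "vnorm Z (S (T x)) \<le> op_norm Y Z S * vnorm Y (T x)"
      using x by (intro YZ.vnorm_le_op_norm S bop_closed[OF T])
    also have "\<dots> \<le> op_norm Y Z S * (op_norm X Y T * vnorm X x)"
      using x by (intro mult_left_mono XY.vnorm_le_op_norm T YZ.bop_norm_nonneg S)
    finally show ?thesis by simp
  qed
  show "(\<lambda>x\<in>carrier X. S (T x)) \<in> bounded_operators X Z"
    by (rule bounded_operatorsI[OF assms(1) _ _ _ *])
      (auto simp: bop_add[OF T] bop_add[OF S] bop_smult[OF T] bop_smult[OF S]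
        bop_closed[OF T] bop_closed[OF S])
qed

context normed_space_dual
begin

lemma weak_lp_closed: "x \<in> weak_lp p X \<Longrightarrow> x n \<in> carrier X"
  by (auto simp: weak_lp_def)

lemma vnorm_le_weak_lp_norm:
  "x \<in> weak_lp p X \<Longrightarrow> \<phi> \<in> dual_ball X \<Longrightarrow> vnorm (lp_space p) (\<lambda>n. \<phi> (x n)) \<le> weak_lp_norm p X x"
  unfolding weak_lp_norm_def by (rule cSUP_upper) (auto simp: weak_lp_def)

lemma dual_ball_nonempty: "dual_ball X \<noteq> {}"
  using norming_functional[of \<zero>] by auto

lemma weak_lp_norm_nonneg: "x \<in> weak_lp p X \<Longrightarrow> 0 \<le> weak_lp_norm p X x"
  using dual_ball_nonempty vnorm_le_weak_lp_norm order_trans[OF vnorm_lp_nonneg] by blast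

text \<open>\<open>weak_lp\<close> speaks about the dual ball only; scaling by 1 / C moves \<phi>
  there. For C = 0 the functional vanishes on the carrier.\<close>

lemma weak_lp_functional:
  assumes p: "0 < p" and x: "x \<in> weak_lp p X" and \<phi>: "\<phi> \<in> bounded_operators X complex_scalars"
    and C: "0 \<le> C" and bound: "\<And>z. z \<in> carrier X \<Longrightarrow> cmod (\<phi> z) \<le> C * vnorm X z"
  shows "(\<lambda>n. \<phi> (x n)) \<in> carrier (lp_space p)"
    and "vnorm (lp_space p) (\<lambda>n. \<phi> (x n)) \<le> C * weak_lp_norm p X x"
proof -
  have "(\<lambda>n. \<phi> (x n)) \<in> carrier (lp_space p)
      \<and> vnorm (lp_space p) (\<lambda>n. \<phi> (x n)) \<le> C * weak_lp_norm p X x"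
  proof (cases "C = 0")
    case True
    then have "(\<lambda>n. \<phi> (x n)) = (\<lambda>n. 0)" using bound weak_lp_closed[OF x] by fastforce
    then show ?thesis using True p by (simp add: vnorm_lp)
  next
    case False
    then have C: "0 < C" using C by simp
    define \<psi> where "\<psi> = (\<lambda>z\<in>carrier X. complex_of_real (1 / C) * \<phi> z)"
    have "\<psi> \<in> bounded_operators X complex_scalars"
      unfolding \<psi>_def by (rule functional_smult_closed[OF \<phi>])
    then have "\<psi> \<in> dual_ball X"
      using C bound by (auto simp: dual_ball_iff \<psi>_def norm_divide divide_le_eq mult.commute)
    then have \<psi>: "(\<lambda>n. \<psi> (x n)) \<in> carrier (lp_space p)"
      "vnorm (lp_space p) (\<lambda>n. \<psi> (x n)) \<le> weak_lp_norm p X x"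
      using x vnorm_le_weak_lp_norm[OF x] unfolding weak_lp_def by blast+
    have eq: "(\<lambda>n. \<phi> (x n)) = (\<lambda>n. complex_of_real C * \<psi> (x n))"
      using C weak_lp_closed[OF x] by (auto simp: \<psi>_def)
    show ?thesis
      unfolding eq using lp_smult_closed[OF \<psi>(1)] vnorm_lp_smult[OF p \<psi>(1)] \<psi>(2) C
      by (simp add: mult_left_mono del: lp_space_simps)
  qed
  then show "(\<lambda>n. \<phi> (x n)) \<in> carrier (lp_space p)"
    and "vnorm (lp_space p) (\<lambda>n. \<phi> (x n)) \<le> C * weak_lp_norm p X x" by blast+
qed

lemma weak_lp_functional_lp:
  assumes "0 < p" "x \<in> weak_lp p X" "\<phi> \<in> bounded_operators X complex_scalars"
  shows "(\<lambda>n. \<phi> (x n)) \<in> carrier (lp_space p)"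
  using weak_lp_functional(1)[OF assms dual.bop_norm_nonneg[OF assms(3)] functional_bound[OF assms(3)]] .

lemma m_Kwp_bdd_below: "bdd_below {weak_lp_norm p X x | x. x \<in> weak_lp p X \<and> K \<subseteq> p_conv p X x}"
  using weak_lp_norm_nonneg by (intro bdd_belowI[of _ 0]) auto

lemma m_Kwp_le: "x \<in> weak_lp p X \<Longrightarrow> K \<subseteq> p_conv p X x \<Longrightarrow> m_Kwp p X K \<le> weak_lp_norm p X x"
  unfolding m_Kwp_def by (intro cInf_lower m_Kwp_bdd_below) auto

text \<open>Compactness supplies an admissible sequence. Without one, \<open>m_Kwp\<close> would be
  the infimum of the empty set, about which lower bounds say nothing.\<close>

lemma m_Kwp_greatest:
  assumes "rel_weakly_p_compact p X K"
    and "\<And>x. x \<in> weak_lp p X \<Longrightarrow> K \<subseteq> p_conv p X x \<Longrightarrow> c \<le> weak_lp_norm p X x"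
  shows "c \<le> m_Kwp p X K"
  unfolding m_Kwp_def using assms by (intro cInf_greatest) (auto simp: rel_weakly_p_compact_def)

lemma m_Kwp_nonneg: "rel_weakly_p_compact p X K \<Longrightarrow> 0 \<le> m_Kwp p X K"
  by (rule m_Kwp_greatest) (auto intro: weak_lp_norm_nonneg)

end

context normed_spaces
begin

text \<open>A functional in the dual ball of Y, composed with T, is bounded by C on X. The bound is
  a parameter rather than the operator norm of T because it will be a product of two operator
  norms.\<close>

lemma bop_weak_lp:
  assumes p: "0 < p" and T: "T \<in> bounded_operators X Y" and x: "x \<in> weak_lp p X"
    and C: "0 \<le> C" and bound: "\<And>z. z \<in> carrier X \<Longrightarrow> vnorm Y (T z) \<le> C * vnorm X z"
  shows "(\<lambda>n. T (x n)) \<in> weak_lp p Y" and "weak_lp_norm p Y (\<lambda>n. T (x n)) \<le> C * weak_lp_norm p X x"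
proof -
  interpret DX: normed_space_dual X by unfold_locales
  interpret DY: normed_space_dual Y by unfold_locales
  have *: "(\<lambda>n. \<phi> (T (x n))) \<in> carrier (lp_space p)
      \<and> vnorm (lp_space p) (\<lambda>n. \<phi> (T (x n))) \<le> C * weak_lp_norm p X x" if \<phi>: "\<phi> \<in> dual_ball Y" for \<phi>
  proof -
    have \<phi>B: "\<phi> \<in> bounded_operators Y complex_scalars" using \<phi> by (simp add: DY.dual_ball_iff)
    let ?\<psi> = "\<lambda>z\<in>carrier X. \<phi> (T z)"
    have \<psi>: "?\<psi> \<in> bounded_operators X complex_scalars"
      by (rule bop_compose(1)[OF X.complex_normed_space_axioms Y.complex_normed_space_axioms
            complex_normed_space_scalars T \<phi>B])
    have "cmod (?\<psi> z) \<le> C * vnorm X z" if z: "z \<in> carrier X" for z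
      using \<phi> bound[OF z] bop_closed[OF T z] z unfolding DY.dual_ball_iff by fastforce
    from DX.weak_lp_functional[OF p x \<psi> C this] show ?thesis
      using DX.weak_lp_closed[OF x] by (simp del: lp_space_simps)
  qed
  then show "(\<lambda>n. T (x n)) \<in> weak_lp p Y"
    using DX.weak_lp_closed[OF x] bop_closed[OF T]
    by (auto simp: weak_lp_def simp del: lp_space_simps intro!: bdd_aboveI2[where M = "C * weak_lp_norm p X x"])
  show "weak_lp_norm p Y (\<lambda>n. T (x n)) \<le> C * weak_lp_norm p X x"
    unfolding weak_lp_norm_def[of p Y] using * DY.dual_ball_nonempty by (intro cSUP_least) auto
qed

lemma bop_p_conv:
  assumes T: "T \<in> bounded_operators X Y" and x: "\<And>n. x n \<in> carrier X" and y: "y \<in> p_conv p X x"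
  shows "T y \<in> p_conv p Y (\<lambda>n. T (x n))"
proof -
  obtain a where a: "a \<in> carrier (lp_space (conj_index p))" "vnorm (lp_space (conj_index p)) a \<le> 1"
    and lim: "limitin (norm_topology X) (\<lambda>k. \<Oplus>\<^bsub>X\<^esub>n\<in>{..<k}. a n \<odot>\<^bsub>X\<^esub> x n) y sequentially"
    using y unfolding p_conv_def by blast
  have ax: "a n \<odot>\<^bsub>X\<^esub> x n \<in> carrier X" for n using x by simp
  have "limitin (norm_topology Y) (\<lambda>k. T (\<Oplus>\<^bsub>X\<^esub>n\<in>{..<k}. a n \<odot>\<^bsub>X\<^esub> x n)) (T y) sequentially"
    by (rule bop_limit[OF T X.psum_closed[OF ax] lim])
  then have "limitin (norm_topology Y) (\<lambda>k. \<Oplus>\<^bsub>Y\<^esub>n\<in>{..<k}. a n \<odot>\<^bsub>Y\<^esub> T (x n)) (T y) sequentially"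
    unfolding bop_psum[OF T ax] bop_smult[OF T x] .
  then show ?thesis unfolding p_conv_def using a by blast
qed

end

section \<open>The synthesis operator of a weakly summable sequence\<close>

locale weak_lp_sequence = complex_banach_space F for F :: "'f normed_module" (structure) +
  fixes p :: real and x :: "nat \<Rightarrow> 'f"
  assumes exponent: "1 < p" and weakly_summable: "x \<in> weak_lp p F"
begin

sublocale normed_space_dual F
  by (intro normed_space_dual.intro) unfold_locales

sublocale lq: complex_normed_space "lp_space (conj_index p)"
  using conj_index_gt_1[OF exponent] by (intro complex_normed_space_lp) simp

sublocale lq_F: normed_spaces "lp_space (conj_index p)" F
  by (intro normed_spaces.intro) unfold_locales

lemma x_closed: "x n \<in> carrier F"
  by (rule weak_lp_closed[OF weakly_summable])

lemma ax_closed: "a n \<odot> x n \<in> carrier F"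
  using x_closed by simp

lemma x_functional: "\<phi> \<in> bounded_operators F complex_scalars \<Longrightarrow> (\<lambda>n. \<phi> (x n)) \<in> carrier (lp_space p)"
  using weak_lp_functional_lp[OF _ weakly_summable] exponent by simp

lemma functional_psum:
  assumes "\<phi> \<in> bounded_operators F complex_scalars"
  shows "\<phi> (\<Oplus>n\<in>{..<k}. a n \<odot> x n) = (\<Sum>n<k. a n * \<phi> (x n))"
  unfolding dual.bop_psum[OF assms, of "\<lambda>n. a n \<odot> x n", OF ax_closed[of a]] finsum_scalars
  by (simp add: bop_smult[OF assms x_closed])

text \<open>The partial sums belong to the truncations of a. Tested with functionals, Hoelder's
  inequality bounds the difference of two partial sums by the weak norm times the l_q norm of the
  difference of the truncations. These converge in l_q, so the partial sums are Cauchy, and F is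
  complete.\<close>

lemma synthesis_converges:
  assumes a: "a \<in> carrier (lp_space (conj_index p))"
  shows "\<exists>y. limitin (norm_topology F) (\<lambda>k. \<Oplus>n\<in>{..<k}. a n \<odot> x n) y sequentially"
proof -
  let ?q = "conj_index p" and ?W = "weak_lp_norm p F x"
  let ?s = "\<lambda>k. \<Oplus>n\<in>{..<k}. a n \<odot> x n"
  have q: "1 < ?q" by (rule conj_index_gt_1[OF exponent])
  have sF: "?s k \<in> carrier F" for k by (rule psum_closed) (rule ax_closed)
  have tr: "truncate_seq k a \<in> carrier (lp_space ?q)" for k using q by (intro truncate_seq_lp) simp
  have tail: "(\<lambda>k. vnorm (lp_space ?q) (truncate_seq k a \<ominus>\<^bsub>lp_space ?q\<^esub> a)) \<longlonglongrightarrow> 0"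
  proof -
    have "1 \<le> ?q" using q by simp
    from lp_expansion[OF this a] show ?thesis
      unfolding truncate_seq_eq_finsum[OF \<open>1 \<le> ?q\<close>] using lq.limitin_norm_iff[of "\<lambda>k. truncate_seq k a" a] tr by blast
  qed
  have le: "vnorm F (?s m \<ominus> ?s k)
      \<le> vnorm (lp_space ?q) (truncate_seq m a \<ominus>\<^bsub>lp_space ?q\<^esub> truncate_seq k a) * ?W" for m k
  proof (rule vnorm_le_if_functionals_le)
    fix \<phi> assume \<phi>: "\<phi> \<in> dual_ball F"
    then have \<phi>B: "\<phi> \<in> bounded_operators F complex_scalars" by (simp add: dual_ball_iff)
    let ?d = "truncate_seq m a \<ominus>\<^bsub>lp_space ?q\<^esub> truncate_seq k a"
    have d: "?d \<in> carrier (lp_space ?q)" by (intro lq.diff_closed tr)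
    have d_eq: "?d n = truncate_seq m a n - truncate_seq k a n" for n
      using lq.minus_eq_smult[OF tr[of k]] by (simp add: lq.M.minus_eq)
    have sums: "(\<lambda>n. truncate_seq k a n * \<phi> (x n)) sums \<phi> (?s k)" for k
    proof -
      have "(\<lambda>n. truncate_seq k a n * \<phi> (x n)) sums (\<Sum>n<k. truncate_seq k a n * \<phi> (x n))"
        by (intro sums_finite) (auto simp: truncate_seq_def)
      then show ?thesis by (simp add: functional_psum[OF \<phi>B] truncate_seq_def)
    qed
    have "(\<lambda>n. ?d n * \<phi> (x n)) sums (\<phi> (?s m) - \<phi> (?s k))"
      unfolding d_eq left_diff_distrib by (intro sums_diff sums)
    then have "cmod (\<phi> (?s m) - \<phi> (?s k)) \<le> vnorm (lp_space ?q) ?d * vnorm (lp_space p) (\<lambda>n. \<phi> (x n))"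
      using hoelder_norm_le[OF exponent d x_functional[OF \<phi>B]] by (simp add: sums_iff)
    also have "\<dots> \<le> vnorm (lp_space ?q) ?d * ?W"
      by (intro mult_left_mono vnorm_le_weak_lp_norm weakly_summable \<phi> vnorm_lp_nonneg)
    finally show "cmod (\<phi> (?s m \<ominus> ?s k)) \<le> vnorm (lp_space ?q) ?d * ?W"
      using dual.bop_diff[OF \<phi>B sF sF] by simp
  qed (use sF in auto)
  have "metric.MCauchy ?s"
    unfolding metric.MCauchy_def
  proof (intro conjI allI impI)
    fix e :: real assume e: "0 < e"
    define K where "K = ?W + 1"
    have K: "0 < K" "?W \<le> K" using weak_lp_norm_nonneg[OF weakly_summable] by (auto simp: K_def)
    obtain N where N: "\<And>k. k \<ge> N \<Longrightarrow>
        vnorm (lp_space ?q) (truncate_seq k a \<ominus>\<^bsub>lp_space ?q\<^esub> a) < e / (2 * K)"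
      using LIMSEQ_D[OF tail, of "e / (2 * K)"] e K by (auto simp: abs_less_iff)
    have "ndist F (?s m) (?s k) < e" if "N \<le> m" "N \<le> k" for m k
    proof -
      let ?d = "truncate_seq m a \<ominus>\<^bsub>lp_space ?q\<^esub> truncate_seq k a"
      have "vnorm (lp_space ?q) ?d \<le> vnorm (lp_space ?q) (truncate_seq m a \<ominus>\<^bsub>lp_space ?q\<^esub> a)
          + vnorm (lp_space ?q) (truncate_seq k a \<ominus>\<^bsub>lp_space ?q\<^esub> a)"
        using lq.vnorm_triangle_diff[OF tr a tr, of m k] lq.vnorm_diff_commute[OF a tr, of k] by simp
      also have "\<dots> < e / K" using N[OF that(1)] N[OF that(2)] by simp
      finally have d: "vnorm (lp_space ?q) ?d < e / K" .
      have "vnorm F (?s m \<ominus> ?s k) \<le> vnorm (lp_space ?q) ?d * K"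
        using order_trans[OF le mult_left_mono[OF K(2) vnorm_lp_nonneg]] .
      also have "\<dots> < e / K * K" using d K by (intro mult_strict_right_mono) auto
      finally show ?thesis using K sF by (simp add: ndist_def)
    qed
    then show "\<exists>N. \<forall>m k. N \<le> m \<longrightarrow> N \<le> k \<longrightarrow> ndist F (?s m) (?s k) < e" by blast
  qed (use sF in auto)
  then show ?thesis using complete unfolding metric.mcomplete_def by blast
qed

text \<open>The operator \<open>\<Phi>\<close>, not yet restricted to l_q. On l_q the limit exists
  and is unique, so \<open>SOME\<close> leaves no choice there.\<close>

definition synthesis :: "(nat \<Rightarrow> complex) \<Rightarrow> 'f" where
  "synthesis a = (SOME y. limitin (norm_topology F) (\<lambda>k. \<Oplus>n\<in>{..<k}. a n \<odot> x n) y sequentially)"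

lemma synthesis_limit:
  "a \<in> carrier (lp_space (conj_index p))
    \<Longrightarrow> limitin (norm_topology F) (\<lambda>k. \<Oplus>n\<in>{..<k}. a n \<odot> x n) (synthesis a) sequentially"
  unfolding synthesis_def by (rule someI_ex) (rule synthesis_converges)

lemma synthesis_closed: "a \<in> carrier (lp_space (conj_index p)) \<Longrightarrow> synthesis a \<in> carrier F"
  using synthesis_limit limitin_topspace by fastforce

lemma synthesis_functional:
  assumes \<phi>: "\<phi> \<in> bounded_operators F complex_scalars" and a: "a \<in> carrier (lp_space (conj_index p))"
  shows "(\<lambda>n. a n * \<phi> (x n)) sums \<phi> (synthesis a)"
proof -
  have "limitin (norm_topology complex_scalars) (\<lambda>k. \<phi> (\<Oplus>n\<in>{..<k}. a n \<odot> x n)) (\<phi> (synthesis a)) sequentially"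
    by (rule dual.bop_limit[OF \<phi> _ synthesis_limit[OF a]]) (rule psum_closed, rule ax_closed)
  then show ?thesis unfolding functional_psum[OF \<phi>] limitin_scalars sums_def .
qed

lemma synthesis_functional_le:
  assumes \<phi>: "\<phi> \<in> bounded_operators F complex_scalars" and a: "a \<in> carrier (lp_space (conj_index p))"
  shows "cmod (\<phi> (synthesis a)) \<le> vnorm (lp_space (conj_index p)) a * vnorm (lp_space p) (\<lambda>n. \<phi> (x n))"
  using hoelder_norm_le[OF exponent a x_functional[OF \<phi>]] synthesis_functional[OF \<phi> a]
  by (simp add: sums_iff)

lemma synthesis_add:
  assumes a: "a \<in> carrier (lp_space (conj_index p))" and b: "b \<in> carrier (lp_space (conj_index p))"
  shows "synthesis (\<lambda>n. a n + b n) = synthesis a \<oplus> synthesis b"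
proof (rule eq_if_functionals_eq)
  have ab: "(\<lambda>n. a n + b n) \<in> carrier (lp_space (conj_index p))"
    using lq.M.a_closed[OF a b] by (simp only: lp_space_simps(3))
  then show "synthesis (\<lambda>n. a n + b n) \<in> carrier F" by (rule synthesis_closed)
  show "synthesis a \<oplus> synthesis b \<in> carrier F" using a b by (intro M.a_closed synthesis_closed)
  fix \<phi> assume \<phi>: "\<phi> \<in> bounded_operators F complex_scalars"
  have "(\<lambda>n. (a n + b n) * \<phi> (x n)) sums (\<phi> (synthesis a) + \<phi> (synthesis b))"
    unfolding distrib_right by (intro sums_add synthesis_functional \<phi> a b)
  then show "\<phi> (synthesis (\<lambda>n. a n + b n)) = \<phi> (synthesis a \<oplus> synthesis b)"
    using sums_unique2[OF synthesis_functional[OF \<phi> ab]] bop_add[OF \<phi> synthesis_closed[OF a] synthesis_closed[OF b]]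
    by simp
qed

lemma synthesis_smult:
  assumes a: "a \<in> carrier (lp_space (conj_index p))"
  shows "synthesis (\<lambda>n. c * a n) = c \<odot> synthesis a"
proof (rule eq_if_functionals_eq)
  have ca: "(\<lambda>n. c * a n) \<in> carrier (lp_space (conj_index p))" by (rule lp_smult_closed[OF a])
  then show "synthesis (\<lambda>n. c * a n) \<in> carrier F" by (rule synthesis_closed)
  show "c \<odot> synthesis a \<in> carrier F" using a by (intro smult_cl synthesis_closed)
  fix \<phi> assume \<phi>: "\<phi> \<in> bounded_operators F complex_scalars"
  have "(\<lambda>n. (c * a n) * \<phi> (x n)) sums (c * \<phi> (synthesis a))"
    unfolding mult.assoc by (intro sums_mult synthesis_functional \<phi> a)
  then show "\<phi> (synthesis (\<lambda>n. c * a n)) = \<phi> (c \<odot> synthesis a)"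
    using sums_unique2[OF synthesis_functional[OF \<phi> ca]] bop_smult[OF \<phi> synthesis_closed[OF a]] by simp
qed

lemma synthesis_norm_le:
  assumes a: "a \<in> carrier (lp_space (conj_index p))"
  shows "vnorm F (synthesis a) \<le> weak_lp_norm p F x * vnorm (lp_space (conj_index p)) a"
proof (rule vnorm_le_if_functionals_le)
  fix \<phi> assume \<phi>: "\<phi> \<in> dual_ball F"
  then have \<phi>B: "\<phi> \<in> bounded_operators F complex_scalars" by (simp add: dual_ball_iff)
  have "vnorm (lp_space (conj_index p)) a * vnorm (lp_space p) (\<lambda>n. \<phi> (x n))
      \<le> vnorm (lp_space (conj_index p)) a * weak_lp_norm p F x"
    by (intro mult_left_mono vnorm_le_weak_lp_norm weakly_summable \<phi> vnorm_lp_nonneg)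
  then show "cmod (\<phi> (synthesis a)) \<le> weak_lp_norm p F x * vnorm (lp_space (conj_index p)) a"
    using synthesis_functional_le[OF \<phi>B a] by (simp add: mult.commute)
qed (rule synthesis_closed[OF a])

lemma synthesis_bounded:
  "restrict synthesis (carrier (lp_space (conj_index p))) \<in> bounded_operators (lp_space (conj_index p)) F"
  by (rule bounded_operatorsI[OF lq.complex_normed_space_axioms _ _ _ synthesis_norm_le])
    (simp_all add: synthesis_closed synthesis_add synthesis_smult
      flip: lp_space_simps(1) del: lp_space_simps(1))

lemma p_conv_imp_synthesis:
  assumes "y \<in> p_conv p F x"
  obtains a where "a \<in> carrier (lp_space (conj_index p))" "vnorm (lp_space (conj_index p)) a \<le> 1"
    "synthesis a = y"
proof -
  obtain a where a: "a \<in> carrier (lp_space (conj_index p))" "vnorm (lp_space (conj_index p)) a \<le> 1"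
    and lim: "limitin (norm_topology F) (\<lambda>k. \<Oplus>n\<in>{..<k}. a n \<odot> x n) y sequentially"
    using assms unfolding p_conv_def by blast
  have "synthesis a = y"
    using metric.limitin_metric_unique[OF synthesis_limit[OF a(1)] lim] by simp
  then show ?thesis using that a by blast
qed

text \<open>A converse of \<open>synthesis_functional_le\<close>; together they describe the image
  of the ball of radius C by scalar inequalities. The point y enters \<open>helly\<close> as the
  evaluation \<phi> \<mapsto> \<phi> y.\<close>

lemma synthesis_surj:
  assumes y: "y \<in> carrier F" and C: "0 \<le> C"
    and bound: "\<And>\<phi>. \<phi> \<in> bounded_operators F complex_scalars
      \<Longrightarrow> cmod (\<phi> y) \<le> C * vnorm (lp_space p) (\<lambda>n. \<phi> (x n))"
  obtains a where "a \<in> carrier (lp_space (conj_index p))" "vnorm (lp_space (conj_index p)) a \<le> C"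
    "synthesis a = y"
proof -
  obtain a where a: "a \<in> carrier (lp_space (conj_index p))" "vnorm (lp_space (conj_index p)) a \<le> C"
    "\<And>\<phi>. \<phi> \<in> bounded_operators F complex_scalars \<Longrightarrow> (\<lambda>n. a n * \<phi> (x n)) sums \<phi> y"
    by (rule helly[of p x C "\<lambda>\<phi>. \<phi> y", OF exponent x_closed x_functional C])
      (use y bound in \<open>auto simp del: lp_space_simps\<close>)
  have "synthesis a = y"
  proof (rule eq_if_functionals_eq)
    show "\<phi> (synthesis a) = \<phi> y" if \<phi>: "\<phi> \<in> bounded_operators F complex_scalars" for \<phi>
      by (rule sums_unique2[OF synthesis_functional[OF \<phi> a(1)] a(3)[OF \<phi>]])
  qed (use synthesis_closed[OF a(1)] y in auto)
  then show ?thesis using that a by blast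
qed

end

section \<open>Holomorphy of the factor\<close>

text \<open>The Taylor coefficients satisfy |c_n| \<le> B / R^n, and the terms from degree two on,
  taken at 1, are dominated by a geometric series with sum (B / R^2) / (1 - 1 / R). This is at most
  2 B / R^2 when R \<ge> 2. The point 1 is chosen because u will be \<mu> \<mapsto> \<phi> (f (a +
  \<mu> h)), whose remainder at 1 is that of f for the increment h.\<close>

lemma
  fixes u :: "complex \<Rightarrow> complex"
  assumes hol: "u holomorphic_on ball 0 r" and R: "0 < R" "R < r"
    and bound: "\<And>z. z \<in> ball 0 r \<Longrightarrow> cmod (u z) \<le> B"
  shows first_derivative_bound: "cmod (deriv u 0) \<le> B / R"
    and taylor_remainder_bound: "2 \<le> R \<Longrightarrow> cmod (u 1 - u 0 - deriv u 0) \<le> 2 * B / R\<^sup>2"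
proof -
  have coeff: "cmod ((deriv ^^ n) u 0) \<le> fact n * B / R ^ n" for n
  proof (rule Cauchy_inequality)
    show "u holomorphic_on ball 0 R" using R by (intro holomorphic_on_subset[OF hol]) auto
    show "continuous_on (cball 0 R) u"
      using R by (intro holomorphic_on_imp_continuous_on holomorphic_on_subset[OF hol]) auto
  qed (use R bound in auto)
  show "cmod (deriv u 0) \<le> B / R" using coeff[of 1] by simp
  assume R2: "2 \<le> R"
  define c where "c n = (deriv ^^ n) u 0 / fact n" for n
  have c: "cmod (c n) \<le> B / R ^ n" for n
  proof -
    have "cmod ((deriv ^^ n) u 0) / fact n \<le> (fact n * B / R ^ n) / fact n"
      by (intro divide_right_mono coeff) simp
    then show ?thesis by (simp add: c_def norm_divide)
  qed
  have "(\<lambda>n. c n * (1 - 0) ^ n) sums u 1"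
    unfolding c_def using R R2 by (intro holomorphic_power_series[OF hol]) auto
  \<comment> \<open>The two omitted terms are u 0 and the derivative of u at 0.\<close>
  then have "(\<lambda>n. c (n + 2)) sums (u 1 - (\<Sum>n<2. c n))"
    by (subst sums_iff_shift[of c]) simp
  then have s: "(\<lambda>n. c (n + 2)) sums (u 1 - u 0 - deriv u 0)"
    by (simp add: c_def numeral_2_eq_2 diff_diff_eq)
  have "(\<lambda>n. (B / R\<^sup>2) * (1 / R) ^ n) sums ((B / R\<^sup>2) * (1 / (1 - 1 / R)))"
    using R2 by (intro sums_mult geometric_sums) auto
  moreover have "cmod (c (n + 2)) \<le> (B / R\<^sup>2) * (1 / R) ^ n" for n
    using c[of "n + 2"] by (simp add: power_add power_divide mult.commute power2_eq_square)
  ultimately have "cmod (u 1 - u 0 - deriv u 0) \<le> (B / R\<^sup>2) * (1 / (1 - 1 / R))"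
    using s norm_sums_le by blast
  also have "\<dots> \<le> (B / R\<^sup>2) * 2"
  proof (rule mult_left_mono)
    show "1 / (1 - 1 / R) \<le> 2" using R2 by (simp add: field_simps)
    show "0 \<le> B / R\<^sup>2" using order_trans[OF norm_ge_zero bound[of 0]] R by simp
  qed
  finally show "cmod (u 1 - u 0 - deriv u 0) \<le> 2 * B / R\<^sup>2" by (simp add: mult.commute)
qed

lemma line_derivative:
  assumes "complex_normed_space E" "complex_normed_space F"
    and \<phi>: "\<phi> \<in> bounded_operators F complex_scalars" and A: "A \<in> bounded_operators E F"
    and f: "f \<in> U \<rightarrow> carrier F"
    and a: "a \<in> carrier E" and h: "h \<in> carrier E" and d: "0 < d"
    and line: "\<And>\<mu>. cmod (\<mu> - \<zeta>) < d \<Longrightarrow> a \<oplus>\<^bsub>E\<^esub> \<mu> \<odot>\<^bsub>E\<^esub> h \<in> U"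
    and frechet: "\<And>\<epsilon>. 0 < \<epsilon> \<Longrightarrow> \<exists>\<delta>>0. \<forall>x\<in>U. vnorm E (x \<ominus>\<^bsub>E\<^esub> (a \<oplus>\<^bsub>E\<^esub> \<zeta> \<odot>\<^bsub>E\<^esub> h)) < \<delta> \<longrightarrow>
        vnorm F ((f x \<ominus>\<^bsub>F\<^esub> f (a \<oplus>\<^bsub>E\<^esub> \<zeta> \<odot>\<^bsub>E\<^esub> h)) \<ominus>\<^bsub>F\<^esub> A (x \<ominus>\<^bsub>E\<^esub> (a \<oplus>\<^bsub>E\<^esub> \<zeta> \<odot>\<^bsub>E\<^esub> h)))
          \<le> \<epsilon> * vnorm E (x \<ominus>\<^bsub>E\<^esub> (a \<oplus>\<^bsub>E\<^esub> \<zeta> \<odot>\<^bsub>E\<^esub> h))"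
  shows "((\<lambda>\<mu>. \<phi> (f (a \<oplus>\<^bsub>E\<^esub> \<mu> \<odot>\<^bsub>E\<^esub> h))) has_field_derivative \<phi> (A h)) (at \<zeta>)"
proof -
  interpret normed_spaces E F by (intro normed_spaces.intro assms)
  interpret F: normed_space_dual F by unfold_locales
  let ?l = "\<lambda>\<mu>. a \<oplus>\<^bsub>E\<^esub> \<mu> \<odot>\<^bsub>E\<^esub> h"
  \<comment> \<open>A positive number that dominates ||\<phi>|| ||h||, the factor by which the
    Frechet error is multiplied along the line; the Frechet condition is therefore used with e /
    N.\<close>
  define N where "N = (op_norm F complex_scalars \<phi> + 1) * (vnorm E h + 1)"
  have N: "0 < N" using h by (simp add: N_def F.dual.bop_norm_nonneg[OF \<phi>] add_nonneg_pos)
  have "\<exists>d'>0. \<forall>\<mu>. norm (\<mu> - \<zeta>) < d' \<longrightarrow>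
      norm (\<phi> (f (?l \<mu>)) - \<phi> (f (?l \<zeta>)) - \<phi> (A h) * (\<mu> - \<zeta>)) \<le> e * norm (\<mu> - \<zeta>)" if e: "0 < e" for e
  proof -
    obtain \<delta> where \<delta>: "0 < \<delta>" and fr: "\<And>x. x \<in> U \<Longrightarrow> vnorm E (x \<ominus>\<^bsub>E\<^esub> ?l \<zeta>) < \<delta> \<Longrightarrow>
        vnorm F ((f x \<ominus>\<^bsub>F\<^esub> f (?l \<zeta>)) \<ominus>\<^bsub>F\<^esub> A (x \<ominus>\<^bsub>E\<^esub> ?l \<zeta>)) \<le> e / N * vnorm E (x \<ominus>\<^bsub>E\<^esub> ?l \<zeta>)"
      using frechet[of "e / N"] e N by auto
    define d' where "d' = min d (\<delta> / (vnorm E h + 1))"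
    have d': "0 < d'" using d \<delta> h by (simp add: d'_def add_nonneg_pos)
    have "norm (\<phi> (f (?l \<mu>)) - \<phi> (f (?l \<zeta>)) - \<phi> (A h) * (\<mu> - \<zeta>)) \<le> e * norm (\<mu> - \<zeta>)"
      if \<mu>: "norm (\<mu> - \<zeta>) < d'" for \<mu>
    proof -
      have U: "?l \<mu> \<in> U" "?l \<zeta> \<in> U" using line[of \<mu>] line[of \<zeta>] \<mu> d by (auto simp: d'_def)
      have fF: "f (?l \<mu>) \<in> carrier F" "f (?l \<zeta>) \<in> carrier F" using f U by auto
      have diff: "?l \<mu> \<ominus>\<^bsub>E\<^esub> ?l \<zeta> = (\<mu> - \<zeta>) \<odot>\<^bsub>E\<^esub> h"
        using a h by (simp add: X.add_diff_add X.diff_smult X.diff_eq_zero_iff[THEN iffD2])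
      have dist: "vnorm E (?l \<mu> \<ominus>\<^bsub>E\<^esub> ?l \<zeta>) = cmod (\<mu> - \<zeta>) * vnorm E h"
        unfolding diff using h by (simp add: X.vnorm_smult)
      have "cmod (\<mu> - \<zeta>) * vnorm E h \<le> cmod (\<mu> - \<zeta>) * (vnorm E h + 1)"
        by (intro mult_left_mono) auto
      also have "\<dots> < \<delta> / (vnorm E h + 1) * (vnorm E h + 1)"
        using \<mu> h by (intro mult_strict_right_mono) (auto simp: d'_def add_nonneg_pos)
      also have "\<dots> = \<delta>" using X.vnorm_nonneg[OF h] by simp
      finally have small: "vnorm E (?l \<mu> \<ominus>\<^bsub>E\<^esub> ?l \<zeta>) < \<delta>" unfolding dist .
      let ?w = "(f (?l \<mu>) \<ominus>\<^bsub>F\<^esub> f (?l \<zeta>)) \<ominus>\<^bsub>F\<^esub> A ((\<mu> - \<zeta>) \<odot>\<^bsub>E\<^esub> h)"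
      have Ah: "A ((\<mu> - \<zeta>) \<odot>\<^bsub>E\<^esub> h) \<in> carrier F" using h by (intro bop_closed[OF A]) simp
      have wF: "?w \<in> carrier F" using fF Ah by simp
      have "\<phi> ?w = \<phi> (f (?l \<mu>)) - \<phi> (f (?l \<zeta>)) - \<phi> (A ((\<mu> - \<zeta>) \<odot>\<^bsub>E\<^esub> h))"
        using F.dual.bop_diff[OF \<phi> Y.diff_closed[OF fF] Ah] F.dual.bop_diff[OF \<phi> fF] by simp
      also have "\<phi> (A ((\<mu> - \<zeta>) \<odot>\<^bsub>E\<^esub> h)) = (\<mu> - \<zeta>) * \<phi> (A h)"
        using h by (simp add: bop_smult[OF A] bop_smult[OF \<phi>] bop_closed[OF A])
      finally have "norm (\<phi> (f (?l \<mu>)) - \<phi> (f (?l \<zeta>)) - \<phi> (A h) * (\<mu> - \<zeta>)) = cmod (\<phi> ?w)"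
        by (simp add: mult.commute)
      also have "\<dots> \<le> op_norm F complex_scalars \<phi> * vnorm F ?w" by (rule F.functional_bound[OF \<phi> wF])
      also have "\<dots> \<le> op_norm F complex_scalars \<phi> * (e / N * (cmod (\<mu> - \<zeta>) * vnorm E h))"
        using fr[OF U(1) small] unfolding dist unfolding diff
        by (intro mult_left_mono F.dual.bop_norm_nonneg[OF \<phi>])
      also have "\<dots> \<le> e / N * (cmod (\<mu> - \<zeta>) * N)"
      proof -
        have "op_norm F complex_scalars \<phi> * vnorm E h \<le> N"
          unfolding N_def using h F.dual.bop_norm_nonneg[OF \<phi>] by (intro mult_mono) auto
        then have "(e / N * cmod (\<mu> - \<zeta>)) * (op_norm F complex_scalars \<phi> * vnorm E h)
            \<le> (e / N * cmod (\<mu> - \<zeta>)) * N" using e N by (intro mult_left_mono) auto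
        then show ?thesis by (simp only: ac_simps)
      qed
      also have "\<dots> = e * norm (\<mu> - \<zeta>)" using N by simp
      finally show ?thesis .
    qed
    then show ?thesis using d' by blast
  qed
  then show ?thesis
    unfolding has_field_derivative_def has_derivative_at_alt by (auto intro: bounded_linear_mult_right)
qed

text \<open>Both bounds are linear in B with factors that do not involve \<phi>. With B a multiple
  of the l_p norm of (\<phi> (x n)) they take the form of the hypothesis of
  \<open>synthesis_surj\<close>.\<close>

lemma holomorphic_estimates:
  assumes E: "complex_normed_space E" and F: "complex_normed_space F"
    and hol: "holomorphic_map E U F f" and a: "a \<in> carrier E" and r: "0 < r"
    and ball: "\<And>t. t \<in> carrier E \<Longrightarrow> vnorm E (t \<ominus>\<^bsub>E\<^esub> a) < r \<Longrightarrow> t \<in> U"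
    and A: "A \<in> bounded_operators E F"
    and frechet: "\<And>\<epsilon>. 0 < \<epsilon> \<Longrightarrow> \<exists>\<delta>>0. \<forall>x\<in>U. vnorm E (x \<ominus>\<^bsub>E\<^esub> a) < \<delta> \<longrightarrow>
        vnorm F ((f x \<ominus>\<^bsub>F\<^esub> f a) \<ominus>\<^bsub>F\<^esub> A (x \<ominus>\<^bsub>E\<^esub> a)) \<le> \<epsilon> * vnorm E (x \<ominus>\<^bsub>E\<^esub> a)"
    and \<phi>: "\<phi> \<in> bounded_operators F complex_scalars"
    and B: "\<And>t. t \<in> carrier E \<Longrightarrow> vnorm E (t \<ominus>\<^bsub>E\<^esub> a) < r \<Longrightarrow> cmod (\<phi> (f t)) \<le> B"
    and h: "h \<in> carrier E"
  shows derivative_estimate: "cmod (\<phi> (A h)) \<le> 2 / r * vnorm E h * B"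
    and remainder_estimate: "vnorm E h \<le> r / 4 \<Longrightarrow>
      cmod (\<phi> ((f (a \<oplus>\<^bsub>E\<^esub> h) \<ominus>\<^bsub>F\<^esub> f a) \<ominus>\<^bsub>F\<^esub> A h)) \<le> 8 / r\<^sup>2 * (vnorm E h)\<^sup>2 * B"
proof -
  interpret normed_spaces E F by (intro normed_spaces.intro E F)
  interpret F: normed_space_dual F by unfold_locales
  have fU: "f \<in> U \<rightarrow> carrier F" using hol by (simp add: holomorphic_map_def)
  have aa: "a \<ominus>\<^bsub>E\<^esub> a = \<zero>\<^bsub>E\<^esub>" using a by (simp add: X.diff_eq_zero_iff)
  have aU: "a \<in> U" using ball[OF a] r by (simp add: aa)
  have fa: "f a \<in> carrier F" using fU aU by auto
  have Ah: "A h \<in> carrier F" by (rule bop_closed[OF A h])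
  have "cmod (\<phi> (A h)) \<le> 2 / r * vnorm E h * B \<and> (vnorm E h \<le> r / 4 \<longrightarrow>
      cmod (\<phi> ((f (a \<oplus>\<^bsub>E\<^esub> h) \<ominus>\<^bsub>F\<^esub> f a) \<ominus>\<^bsub>F\<^esub> A h)) \<le> 8 / r\<^sup>2 * (vnorm E h)\<^sup>2 * B)"
  proof (cases "h = \<zero>\<^bsub>E\<^esub>")
    case True
    have "(f (a \<oplus>\<^bsub>E\<^esub> h) \<ominus>\<^bsub>F\<^esub> f a) \<ominus>\<^bsub>F\<^esub> A h = \<zero>\<^bsub>F\<^esub>"
      using True a fa by (simp add: bop_zero[OF A] Y.diff_zero Y.diff_eq_zero_iff)
    then show ?thesis using True F.dual.bop_zero[OF \<phi>] by (simp add: bop_zero[OF A])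
  next
    case False
    define \<eta> where "\<eta> = vnorm E h"
    have \<eta>: "0 < \<eta>" using False h by (simp add: \<eta>_def less_le X.vnorm_eq_0_iff eq_commute[of 0])
    define u where "u \<mu> = \<phi> (f (a \<oplus>\<^bsub>E\<^esub> \<mu> \<odot>\<^bsub>E\<^esub> h))" for \<mu>
    have near: "a \<oplus>\<^bsub>E\<^esub> \<mu> \<odot>\<^bsub>E\<^esub> h \<in> carrier E" "vnorm E ((a \<oplus>\<^bsub>E\<^esub> \<mu> \<odot>\<^bsub>E\<^esub> h) \<ominus>\<^bsub>E\<^esub> a) < r"
      if "cmod \<mu> < r / \<eta>" for \<mu>
      using that a h \<eta> by (auto simp: X.add_diff_cancel X.vnorm_smult \<eta>_def[symmetric] field_simps)
    \<comment> \<open>At 0 the derivative must be computed with the given A, to identify it as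
      \<phi> (A h). At the other points of the disc any Frechet derivative serves, since only
      holomorphy of u is wanted.\<close>
    have deriv0: "(u has_field_derivative \<phi> (A h)) (at 0)"
      unfolding u_def
    proof (rule line_derivative[OF E F \<phi> A fU a h, of "r / \<eta>"])
      show "0 < r / \<eta>" using r \<eta> by simp
      show "a \<oplus>\<^bsub>E\<^esub> \<mu> \<odot>\<^bsub>E\<^esub> h \<in> U" if "cmod (\<mu> - 0) < r / \<eta>" for \<mu>
        using that by (intro ball near) auto
    qed (use frechet a h in simp)
    have hol_u: "u holomorphic_on ball 0 (r / \<eta>)"
      unfolding holomorphic_on_open[OF open_ball]
    proof
      fix \<zeta> :: complex assume "\<zeta> \<in> ball 0 (r / \<eta>)"
      then have \<zeta>: "cmod \<zeta> < r / \<eta>" by simp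
      let ?t = "a \<oplus>\<^bsub>E\<^esub> \<zeta> \<odot>\<^bsub>E\<^esub> h"
      have "?t \<in> U" using \<zeta> by (intro ball near)
      then obtain A' where A': "A' \<in> bounded_operators E F" and fr: "\<forall>\<epsilon>>0. \<exists>\<delta>>0. \<forall>x\<in>U.
          vnorm E (x \<ominus>\<^bsub>E\<^esub> ?t) < \<delta> \<longrightarrow> vnorm F ((f x \<ominus>\<^bsub>F\<^esub> f ?t) \<ominus>\<^bsub>F\<^esub> A' (x \<ominus>\<^bsub>E\<^esub> ?t))
            \<le> \<epsilon> * vnorm E (x \<ominus>\<^bsub>E\<^esub> ?t)"
        using hol unfolding holomorphic_map_def by blast
      have "(u has_field_derivative \<phi> (A' h)) (at \<zeta>)"
        unfolding u_def
      proof (rule line_derivative[OF E F \<phi> A' fU a h, of "r / \<eta> - cmod \<zeta>"])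
        show "0 < r / \<eta> - cmod \<zeta>" using \<zeta> by simp
        show "a \<oplus>\<^bsub>E\<^esub> \<mu> \<odot>\<^bsub>E\<^esub> h \<in> U" if "cmod (\<mu> - \<zeta>) < r / \<eta> - cmod \<zeta>" for \<mu>
          using that norm_triangle_ineq2[of \<mu> \<zeta>] by (intro ball near) auto
      qed (use fr in blast)
      then show "\<exists>f'. (u has_field_derivative f') (at \<zeta>)" by blast
    qed
    \<comment> \<open>Half the radius of the disc on which u is defined. It turns B / R into 2
      \<eta> B / r and 2 B / R^2 into 8 \<eta>^2 B / r^2, and \<eta> \<le> r / 4 into the condition
      R \<ge> 2.\<close>
    define R where "R = r / (2 * \<eta>)"
    have R: "0 < R" "R < r / \<eta>" using r \<eta> by (auto simp: R_def field_simps)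
    have bound: "cmod (u z) \<le> B" if "z \<in> ball 0 (r / \<eta>)" for z
      unfolding u_def using that by (intro B near) auto
    have d0: "deriv u 0 = \<phi> (A h)" by (rule DERIV_imp_deriv[OF deriv0])
    have 1: "cmod (\<phi> (A h)) \<le> 2 / r * \<eta> * B"
      using first_derivative_bound[OF hol_u R bound] r \<eta> by (simp add: d0 R_def field_simps)
    have 2: "cmod (\<phi> ((f (a \<oplus>\<^bsub>E\<^esub> h) \<ominus>\<^bsub>F\<^esub> f a) \<ominus>\<^bsub>F\<^esub> A h)) \<le> 8 / r\<^sup>2 * \<eta>\<^sup>2 * B" if small: "\<eta> \<le> r / 4"
    proof -
      have R2: "2 \<le> R" using small r \<eta> by (simp add: R_def field_simps)
      have "a \<oplus>\<^bsub>E\<^esub> h \<in> U"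
      proof (rule ball)
        show "vnorm E ((a \<oplus>\<^bsub>E\<^esub> h) \<ominus>\<^bsub>E\<^esub> a) < r"
          using a h small r by (simp add: X.add_diff_cancel \<eta>_def[symmetric])
      qed (use a h in simp)
      then have fah: "f (a \<oplus>\<^bsub>E\<^esub> h) \<in> carrier F" using fU by auto
      have "\<phi> ((f (a \<oplus>\<^bsub>E\<^esub> h) \<ominus>\<^bsub>F\<^esub> f a) \<ominus>\<^bsub>F\<^esub> A h) = u 1 - u 0 - deriv u 0"
        using F.dual.bop_diff[OF \<phi> Y.diff_closed[OF fah fa] Ah] F.dual.bop_diff[OF \<phi> fah fa] a h
        by (simp add: u_def d0)
      moreover have "2 * B / R\<^sup>2 = 8 / r\<^sup>2 * \<eta>\<^sup>2 * B"
        using r \<eta> by (simp add: R_def power2_eq_square)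
      ultimately show ?thesis
        using taylor_remainder_bound[OF hol_u R bound R2] by simp
    qed
    show ?thesis using 1 2 by (simp add: \<eta>_def)
  qed
  then show "cmod (\<phi> (A h)) \<le> 2 / r * vnorm E h * B"
    and "vnorm E h \<le> r / 4 \<Longrightarrow>
      cmod (\<phi> ((f (a \<oplus>\<^bsub>E\<^esub> h) \<ominus>\<^bsub>F\<^esub> f a) \<ominus>\<^bsub>F\<^esub> A h)) \<le> 8 / r\<^sup>2 * (vnorm E h)\<^sup>2 * B" by auto
qed

text \<open>Compactness controls v f and not f, so a local bound of f requires v to stay away from
  0; by continuity v exceeds half its value at a near a.\<close>

lemma weight_local_bound:
  assumes E: "complex_normed_space E" and U: "openin (norm_topology E) U" and v: "weight_on E U v"
    and a: "a \<in> U"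
  obtains r m where "0 < r" "0 < m"
    "\<And>t. t \<in> carrier E \<Longrightarrow> vnorm E (t \<ominus>\<^bsub>E\<^esub> a) < r \<Longrightarrow> t \<in> U \<and> m \<le> v t"
proof -
  interpret complex_normed_space E by (rule E)
  have UE: "U \<subseteq> carrier E" using openin_subset[OF U] by simp
  define m where "m = v a / 2"
  have m: "0 < m" using v a by (simp add: m_def weight_on_def)
  have "openin (subtopology (norm_topology E) U)
      {t \<in> topspace (subtopology (norm_topology E) U). v t \<in> {m<..}}"
    using v unfolding weight_on_def by (intro openin_continuous_map_preimage) auto
  moreover have "{t \<in> topspace (subtopology (norm_topology E) U). v t \<in> {m<..}} = {t \<in> U. m < v t}"
    using UE by auto
  ultimately have "openin (norm_topology E) {t \<in> U. m < v t}"
    using openin_trans_full[OF _ U] by metis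
  moreover have "a \<in> {t \<in> U. m < v t}" using a m by (simp add: m_def)
  ultimately obtain r where r: "0 < r" "metric.mball a r \<subseteq> {t \<in> U. m < v t}"
    unfolding metric.openin_mtopology by blast
  have "t \<in> U \<and> m \<le> v t" if "t \<in> carrier E" "vnorm E (t \<ominus>\<^bsub>E\<^esub> a) < r" for t
  proof -
    have "t \<in> metric.mball a r"
      using that a UE vnorm_diff_commute[of t a] by (auto simp: ndist_def)
    then show ?thesis using r(2) by auto
  qed
  then show ?thesis using that r(1) m by blast
qed

section \<open>The quotient by the kernel of the synthesis operator\<close>

locale synthesis_quotient = weak_lp_sequence F p x + Y: lp_quotient p Y \<pi>
  for F :: "'f normed_module" (structure) and p :: real and x :: "nat \<Rightarrow> 'f"
    and Y :: "'y normed_module" and \<pi> :: "(nat \<Rightarrow> complex) \<Rightarrow> 'y" +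
  assumes map_eq_iff: "a \<in> carrier (lp_space (conj_index p)) \<Longrightarrow> b \<in> carrier (lp_space (conj_index p))
    \<Longrightarrow> \<pi> a = \<pi> b \<longleftrightarrow> synthesis a = synthesis b"
begin

abbreviation "lq \<equiv> lp_space (conj_index p)"

sublocale Y_F: normed_spaces Y F
  by (intro normed_spaces.intro) unfold_locales

text \<open>By \<open>map_eq_iff\<close> the choice of the preimage does not matter. The same
  equivalence makes the operator injective; its range is that of \<open>synthesis\<close> on
  l_q.\<close>

definition induced :: "'y \<Rightarrow> 'f" where
  "induced = (\<lambda>y\<in>carrier Y. synthesis (SOME a. a \<in> carrier lq \<and> \<pi> a = y))"

lemma induced_map:
  assumes a: "a \<in> carrier lq"
  shows "induced (\<pi> a) = synthesis a"
proof -
  have "(SOME b. b \<in> carrier lq \<and> \<pi> b = \<pi> a) \<in> carrier lq \<and> \<pi> (SOME b. b \<in> carrier lq \<and> \<pi> b = \<pi> a) = \<pi> a"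
    by (rule someI_ex[of "\<lambda>b. b \<in> carrier lq \<and> \<pi> b = \<pi> a"]) (use a in blast)
  then have "synthesis (SOME b. b \<in> carrier lq \<and> \<pi> b = \<pi> a) = synthesis a" using map_eq_iff a by blast
  then show ?thesis using Y.map_closed[OF a] by (simp add: induced_def del: lp_space_simps)
qed

lemma preimage:
  assumes "y \<in> carrier Y"
  obtains a where "a \<in> carrier lq" "y = \<pi> a"
  using assms unfolding Y.carrier_eq by blast

lemma induced_norm_le:
  assumes y: "y \<in> carrier Y"
  shows "vnorm F (induced y) \<le> weak_lp_norm p F x * vnorm Y y"
proof -
  have "vnorm F (induced y) \<le> weak_lp_norm p F x * (vnorm Y y + e)" if e: "0 < e" for e
  proof -
    obtain a where a: "a \<in> carrier lq" "\<pi> a = y" "vnorm lq a < vnorm Y y + e" using Y.lift[OF y e] by blast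
    have "vnorm F (induced y) \<le> weak_lp_norm p F x * vnorm lq a"
      using synthesis_norm_le[OF a(1)] induced_map[OF a(1)] a(2) by simp
    also have "\<dots> \<le> weak_lp_norm p F x * (vnorm Y y + e)"
      using a by (intro mult_left_mono weak_lp_norm_nonneg weakly_summable) simp
    finally show ?thesis .
  qed
  moreover have "((\<lambda>e. weak_lp_norm p F x * (vnorm Y y + e))
      \<longlongrightarrow> weak_lp_norm p F x * (vnorm Y y + 0)) (at_right 0)"
    by (intro tendsto_intros)
  ultimately show ?thesis
    using tendsto_lowerbound[of "\<lambda>e. weak_lp_norm p F x * (vnorm Y y + e)"]
    by (simp add: eventually_mono[OF eventually_at_right_less])
qed

lemma induced_bounded: "induced \<in> bounded_operators Y F"
proof -
  have "restrict induced (carrier Y) \<in> bounded_operators Y F"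
  proof (rule bounded_operatorsI[OF Y.complex_normed_space_quotient _ _ _ induced_norm_le])
    show "induced y \<in> carrier F" if y: "y \<in> carrier Y" for y
      by (rule preimage[OF y]) (simp add: induced_map synthesis_closed del: lp_space_simps)
    show "induced (y \<oplus>\<^bsub>Y\<^esub> z) = induced y \<oplus>\<^bsub>F\<^esub> induced z" if y: "y \<in> carrier Y" and z: "z \<in> carrier Y" for y z
    proof -
      obtain a b where ab: "a \<in> carrier lq" "y = \<pi> a" "b \<in> carrier lq" "z = \<pi> b"
        using preimage[OF y] preimage[OF z] by metis
      have "y \<oplus>\<^bsub>Y\<^esub> z = \<pi> (a \<oplus>\<^bsub>lq\<^esub> b)" using ab Y.map_add by blast
      then show ?thesis
        using ab induced_map[OF lq.M.a_closed[OF ab(1,3)]] synthesis_add[OF ab(1,3)]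
        by (simp add: induced_map del: lp_space_simps(1))
    qed
    show "induced (c \<odot>\<^bsub>Y\<^esub> y) = c \<odot>\<^bsub>F\<^esub> induced y" if y: "y \<in> carrier Y" for c y
    proof -
      obtain a where a: "a \<in> carrier lq" "y = \<pi> a" using preimage[OF y] by metis
      have "c \<odot>\<^bsub>Y\<^esub> y = \<pi> (c \<odot>\<^bsub>lq\<^esub> a)" using a Y.map_smult by blast
      then show ?thesis
        using a induced_map[OF lq.smult_cl[OF a(1)]] synthesis_smult[OF a(1)]
        by (simp add: induced_map del: lp_space_simps(1))
    qed
  qed
  then show ?thesis by (simp add: induced_def)
qed

lemma induced_inj: "y \<in> carrier Y \<Longrightarrow> z \<in> carrier Y \<Longrightarrow> induced y = induced z \<Longrightarrow> y = z"
  by (elim preimage) (use map_eq_iff induced_map in simp)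

text \<open>The inverse of \<open>induced\<close> applied to f t, expressed by an arbitrary preimage
  of f t under \<open>synthesis\<close>; \<open>lift_map_eq\<close> shows independence of the
  choice.\<close>

definition lift_map :: "('e \<Rightarrow> 'f) \<Rightarrow> 'e \<Rightarrow> 'y" where
  "lift_map f t = \<pi> (SOME a. a \<in> carrier lq \<and> synthesis a = f t)"

lemma lift_map_eq:
  assumes "a \<in> carrier lq" "synthesis a = f t"
  shows "lift_map f t = \<pi> a"
proof -
  have "(SOME a. a \<in> carrier lq \<and> synthesis a = f t) \<in> carrier lq
      \<and> synthesis (SOME a. a \<in> carrier lq \<and> synthesis a = f t) = f t"
    by (rule someI_ex[of "\<lambda>a. a \<in> carrier lq \<and> synthesis a = f t"]) (use assms in blast)
  then show ?thesis
    using assms map_eq_iff[of "SOME a. a \<in> carrier lq \<and> synthesis a = f t" a]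
    unfolding lift_map_def by (simp del: lp_space_simps)
qed

section \<open>The lift of a holomorphic map\<close>

context
  fixes E :: "'e normed_module" and U :: "'e set" and v :: "'e \<Rightarrow> real" and f :: "'e \<Rightarrow> 'f"
  assumes E: "complex_normed_space E" and U: "openin (norm_topology E) U" and v: "weight_on E U v"
    and hol: "holomorphic_map E U F f" and range: "weighted_range U v F f \<subseteq> p_conv p F x"
begin

lemma v_pos: "t \<in> U \<Longrightarrow> 0 < v t"
  using v by (simp add: weight_on_def)

lemma coefficients:
  assumes t: "t \<in> U"
  obtains a where "a \<in> carrier lq" "vnorm lq a \<le> 1"
    "synthesis (\<lambda>n. complex_of_real (1 / v t) * a n) = f t"
proof -
  have ft: "f t \<in> carrier F" using hol t by (auto simp: holomorphic_map_def)
  have "complex_of_real (v t) \<odot>\<^bsub>F\<^esub> f t \<in> p_conv p F x" using range t by (auto simp: weighted_range_def)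
  then obtain a where a: "a \<in> carrier lq" "vnorm lq a \<le> 1" "synthesis a = complex_of_real (v t) \<odot>\<^bsub>F\<^esub> f t"
    by (rule p_conv_imp_synthesis)
  have "synthesis (\<lambda>n. complex_of_real (1 / v t) * a n) = f t"
    unfolding synthesis_smult[OF a(1)] a(3) using v_pos[OF t] ft by (simp add: smult_smult)
  then show ?thesis using that a by blast
qed

lemma lift_map_coefficients:
  assumes t: "t \<in> U"
  obtains a where "a \<in> carrier lq" "vnorm lq a \<le> 1"
    "lift_map f t \<in> carrier Y" "complex_of_real (v t) \<odot>\<^bsub>Y\<^esub> lift_map f t = \<pi> a" "induced (lift_map f t) = f t"
proof -
  obtain a where a: "a \<in> carrier lq" "vnorm lq a \<le> 1"
    "synthesis (\<lambda>n. complex_of_real (1 / v t) * a n) = f t" using coefficients[OF t] .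
  let ?b = "\<lambda>n. complex_of_real (1 / v t) * a n"
  have b: "?b \<in> carrier lq" by (rule lp_smult_closed[OF a(1)])
  have eq: "lift_map f t = \<pi> ?b" by (rule lift_map_eq[of ?b f t, OF b a(3)])
  have "complex_of_real (v t) \<odot>\<^bsub>Y\<^esub> \<pi> ?b = \<pi> (\<lambda>n. complex_of_real (v t) * ?b n)"
    unfolding Y.map_smult[OF b] by simp
  also have "(\<lambda>n. complex_of_real (v t) * ?b n) = a" using v_pos[OF t] by auto
  finally show ?thesis
    using that[OF a(1,2)] eq Y.map_closed[OF b] induced_map[OF b] a(3) by simp
qed

text \<open>The coefficient sequence of f t has norm at most 1 / v t. What matters is that the bound
  involves the values of \<phi> at the sequence instead of the norm of \<phi>, with a constant
  uniform in all t at which v is at least m.\<close>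

lemma f_functional_le:
  assumes t: "t \<in> U" and m: "0 < m" "m \<le> v t" and \<phi>: "\<phi> \<in> bounded_operators F complex_scalars"
  shows "cmod (\<phi> (f t)) \<le> 1 / m * vnorm (lp_space p) (\<lambda>n. \<phi> (x n))"
proof -
  obtain a where a: "a \<in> carrier lq" "vnorm lq a \<le> 1"
    "synthesis (\<lambda>n. complex_of_real (1 / v t) * a n) = f t" using coefficients[OF t] .
  let ?b = "\<lambda>n. complex_of_real (1 / v t) * a n"
  have b: "?b \<in> carrier lq" by (rule lp_smult_closed[OF a(1)])
  have "vnorm lq ?b = 1 / v t * vnorm lq a"
    by (subst vnorm_lp_smult[OF _ a(1)])
      (use conj_index_gt_1[OF exponent] v_pos[OF t] in \<open>simp_all add: norm_divide\<close>)
  also have "\<dots> \<le> 1 / m * 1" using a m by (intro mult_mono frac_le) (auto simp: vnorm_lp_nonneg)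
  finally have "vnorm lq ?b \<le> 1 / m" by simp
  then have "vnorm lq ?b * vnorm (lp_space p) (\<lambda>n. \<phi> (x n)) \<le> 1 / m * vnorm (lp_space p) (\<lambda>n. \<phi> (x n))"
    by (intro mult_right_mono vnorm_lp_nonneg)
  then show ?thesis using synthesis_functional_le[OF \<phi> b] a(3) by simp
qed

text \<open>The candidate for the derivative at a is D, the lift of A. The remainder of the lift is
  the lift of the remainder of f, because \<open>induced\<close> is linear and injective, and the
  lifted remainder has norm of order ||h||^2, which is more than Frechet differentiability
  requires.\<close>

theorem lift_map_holomorphic: "holomorphic_map E U Y (lift_map f)"
  unfolding holomorphic_map_def
proof (intro conjI ballI)
  show "lift_map f \<in> U \<rightarrow> carrier Y"
  proof
    fix t assume "t \<in> U"
    then show "lift_map f t \<in> carrier Y" by (rule lift_map_coefficients)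
  qed
  interpret E: complex_normed_space E by (rule E)
  interpret EF: normed_spaces E F by (intro normed_spaces.intro E) unfold_locales
  interpret EY: normed_spaces E Y by (intro normed_spaces.intro E) unfold_locales
  fix a assume aU: "a \<in> U"
  then have a: "a \<in> carrier E" using openin_subset[OF U] by auto
  obtain r m where r: "0 < r" and m: "0 < m"
    and ball: "\<And>t. t \<in> carrier E \<Longrightarrow> vnorm E (t \<ominus>\<^bsub>E\<^esub> a) < r \<Longrightarrow> t \<in> U \<and> m \<le> v t"
    by (rule weight_local_bound[OF E U v aU]) blast
  obtain A where A: "A \<in> bounded_operators E F" and fr: "\<And>\<epsilon>. 0 < \<epsilon> \<Longrightarrow> \<exists>\<delta>>0. \<forall>x\<in>U.
      vnorm E (x \<ominus>\<^bsub>E\<^esub> a) < \<delta> \<longrightarrow> vnorm F ((f x \<ominus>\<^bsub>F\<^esub> f a) \<ominus>\<^bsub>F\<^esub> A (x \<ominus>\<^bsub>E\<^esub> a)) \<le> \<epsilon> * vnorm E (x \<ominus>\<^bsub>E\<^esub> a)"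
    using hol aU unfolding holomorphic_map_def by blast
  define S where "S \<phi> = vnorm (lp_space p) (\<lambda>n. \<phi> (x n))" for \<phi>
  have f_le: "cmod (\<phi> (f t)) \<le> 1 / m * S \<phi>"
    if "\<phi> \<in> bounded_operators F complex_scalars" "t \<in> carrier E" "vnorm E (t \<ominus>\<^bsub>E\<^esub> a) < r" for \<phi> t
    unfolding S_def using ball[OF that(2,3)] m by (intro f_functional_le that(1)) auto
  \<comment> \<open>The constants 2 / r and 8 / r^2 of the derivative and remainder estimates,
    divided by the lower bound m of v.\<close>
  define K1 where "K1 = 2 / (r * m)"
  define K2 where "K2 = 8 / (r\<^sup>2 * m)"
  have K: "0 < K1" "0 < K2" using r m by (auto simp: K1_def K2_def)
  have deriv: "\<exists>b\<in>carrier lq. vnorm lq b \<le> K1 * vnorm E h \<and> synthesis b = A h" if h: "h \<in> carrier E" for h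
  proof -
    have le: "cmod (\<phi> (A h)) \<le> K1 * vnorm E h * vnorm (lp_space p) (\<lambda>n. \<phi> (x n))"
      if \<phi>: "\<phi> \<in> bounded_operators F complex_scalars" for \<phi>
      using derivative_estimate[OF E complex_normed_space_axioms hol a r conjunct1[OF ball] A fr \<phi> f_le[OF \<phi>] h]
      by (simp add: S_def K1_def)
    have "0 \<le> K1 * vnorm E h" using K h by simp
    then show ?thesis using synthesis_surj[OF bop_closed[OF A h] _ le] by blast
  qed
  have remainder: "\<exists>b\<in>carrier lq. vnorm lq b \<le> K2 * (vnorm E h)\<^sup>2
      \<and> synthesis b = (f (a \<oplus>\<^bsub>E\<^esub> h) \<ominus>\<^bsub>F\<^esub> f a) \<ominus>\<^bsub>F\<^esub> A h"
    if h: "h \<in> carrier E" and small: "vnorm E h \<le> r / 4" for h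
  proof -
    have "a \<oplus>\<^bsub>E\<^esub> h \<in> U"
      using ball[of "a \<oplus>\<^bsub>E\<^esub> h"] a h small r by (simp add: E.add_diff_cancel)
    then have wF: "(f (a \<oplus>\<^bsub>E\<^esub> h) \<ominus>\<^bsub>F\<^esub> f a) \<ominus>\<^bsub>F\<^esub> A h \<in> carrier F"
      using hol aU bop_closed[OF A h] unfolding holomorphic_map_def by auto
    have le: "cmod (\<phi> ((f (a \<oplus>\<^bsub>E\<^esub> h) \<ominus>\<^bsub>F\<^esub> f a) \<ominus>\<^bsub>F\<^esub> A h))
        \<le> K2 * (vnorm E h)\<^sup>2 * vnorm (lp_space p) (\<lambda>n. \<phi> (x n))"
      if \<phi>: "\<phi> \<in> bounded_operators F complex_scalars" for \<phi>
      using remainder_estimate[OF E complex_normed_space_axioms hol a r conjunct1[OF ball] A fr \<phi> f_le[OF \<phi>] h small]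
      by (simp add: S_def K2_def)
    have "0 \<le> K2 * (vnorm E h)\<^sup>2" using K by simp
    then show ?thesis using synthesis_surj[OF wF _ le] by blast
  qed
  define D where "D = (\<lambda>h. \<pi> (SOME b. b \<in> carrier lq \<and> synthesis b = A h))"
  have D: "D h \<in> carrier Y" "induced (D h) = A h" "vnorm Y (D h) \<le> K1 * vnorm E h"
    if h: "h \<in> carrier E" for h
  proof -
    obtain b where b: "b \<in> carrier lq" "vnorm lq b \<le> K1 * vnorm E h" "synthesis b = A h"
      using deriv[OF h] by blast
    have "(SOME b. b \<in> carrier lq \<and> synthesis b = A h) \<in> carrier lq
        \<and> synthesis (SOME b. b \<in> carrier lq \<and> synthesis b = A h) = A h"
      by (rule someI_ex[of "\<lambda>b. b \<in> carrier lq \<and> synthesis b = A h"]) (use b in blast)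
    then have "D h = \<pi> b"
      using b map_eq_iff[of "SOME b. b \<in> carrier lq \<and> synthesis b = A h" b] unfolding D_def by simp
    then show "D h \<in> carrier Y" "induced (D h) = A h" "vnorm Y (D h) \<le> K1 * vnorm E h"
      using b Y.map_closed[OF b(1)] induced_map[OF b(1)] Y.norm_map_le[OF b(1)] by auto
  qed
  have "restrict D (carrier E) \<in> bounded_operators E Y"
  proof (rule bounded_operatorsI[OF E _ _ _ D(3)])
    \<comment> \<open>D is defined by choice of preimages; it inherits linearity from A, since
      equality in Y can be checked after applying \<open>induced\<close>.\<close>
    show "D (h \<oplus>\<^bsub>E\<^esub> k) = D h \<oplus>\<^bsub>Y\<^esub> D k" if "h \<in> carrier E" "k \<in> carrier E" for h k
      using that by (intro induced_inj)
        (auto simp: D bop_add[OF A] bop_add[OF induced_bounded] intro: Y.Y.M.a_closed)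
    show "D (c \<odot>\<^bsub>E\<^esub> h) = c \<odot>\<^bsub>Y\<^esub> D h" if "h \<in> carrier E" for c h
      using that by (intro induced_inj) (auto simp: D bop_smult[OF A] bop_smult[OF induced_bounded])
  qed (use D in auto)
  moreover have "\<exists>\<delta>>0. \<forall>t\<in>U. vnorm E (t \<ominus>\<^bsub>E\<^esub> a) < \<delta> \<longrightarrow>
      vnorm Y ((lift_map f t \<ominus>\<^bsub>Y\<^esub> lift_map f a) \<ominus>\<^bsub>Y\<^esub> restrict D (carrier E) (t \<ominus>\<^bsub>E\<^esub> a))
        \<le> \<epsilon> * vnorm E (t \<ominus>\<^bsub>E\<^esub> a)" if \<epsilon>: "0 < \<epsilon>" for \<epsilon>
  proof (intro exI conjI ballI impI)
    \<comment> \<open>The first bound permits the remainder estimate; the second makes K2 ||h|| at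
      most \<epsilon>.\<close>
    show "0 < min (r / 4) (\<epsilon> / K2)" using r \<epsilon> K by simp
    fix t assume tU: "t \<in> U" and close: "vnorm E (t \<ominus>\<^bsub>E\<^esub> a) < min (r / 4) (\<epsilon> / K2)"
    have t: "t \<in> carrier E" using tU openin_subset[OF U] by auto
    define h where "h = t \<ominus>\<^bsub>E\<^esub> a"
    have h: "h \<in> carrier E" "vnorm E h \<le> r / 4" "vnorm E h \<le> \<epsilon> / K2" and ah: "a \<oplus>\<^bsub>E\<^esub> h = t"
      using t a close E.diff_add_cancel[OF t a] by (auto simp: h_def E.M.a_comm)
    obtain b where b: "b \<in> carrier lq" "vnorm lq b \<le> K2 * (vnorm E h)\<^sup>2"
      "synthesis b = (f t \<ominus>\<^bsub>F\<^esub> f a) \<ominus>\<^bsub>F\<^esub> A h" using remainder[OF h(1,2)] unfolding ah by blast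
    have g: "lift_map f s \<in> carrier Y" "induced (lift_map f s) = f s" if "s \<in> U" for s
      using lift_map_coefficients[OF that] by blast+
    have "(lift_map f t \<ominus>\<^bsub>Y\<^esub> lift_map f a) \<ominus>\<^bsub>Y\<^esub> D h = \<pi> b"
    proof (rule induced_inj)
      show "induced ((lift_map f t \<ominus>\<^bsub>Y\<^esub> lift_map f a) \<ominus>\<^bsub>Y\<^esub> D h) = induced (\<pi> b)"
        using g[OF tU] g[OF aU] D[OF h(1)] b
        by (simp add: Y_F.bop_diff[OF induced_bounded] induced_map del: lp_space_simps)
    qed (use g[OF tU] g[OF aU] D[OF h(1)] Y.map_closed[OF b(1)] in auto)
    then have "vnorm Y ((lift_map f t \<ominus>\<^bsub>Y\<^esub> lift_map f a) \<ominus>\<^bsub>Y\<^esub> D h) \<le> vnorm lq b"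
      using Y.norm_map_le[OF b(1)] by simp
    also have "\<dots> \<le> (K2 * vnorm E h) * vnorm E h" using b by (simp add: power2_eq_square mult.assoc)
    also have "\<dots> \<le> \<epsilon> * vnorm E h"
      using h K E.vnorm_nonneg[OF h(1)] by (intro mult_right_mono) (auto simp: field_simps)
    finally show "vnorm Y ((lift_map f t \<ominus>\<^bsub>Y\<^esub> lift_map f a) \<ominus>\<^bsub>Y\<^esub> restrict D (carrier E) (t \<ominus>\<^bsub>E\<^esub> a))
        \<le> \<epsilon> * vnorm E (t \<ominus>\<^bsub>E\<^esub> a)" using h by (simp add: h_def)
  qed
  ultimately show "\<exists>A\<in>bounded_operators E Y. \<forall>\<epsilon>>0. \<exists>\<delta>>0. \<forall>x\<in>U. vnorm E (x \<ominus>\<^bsub>E\<^esub> a) < \<delta> \<longrightarrow>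
      vnorm Y ((lift_map f x \<ominus>\<^bsub>Y\<^esub> lift_map f a) \<ominus>\<^bsub>Y\<^esub> A (x \<ominus>\<^bsub>E\<^esub> a)) \<le> \<epsilon> * vnorm E (x \<ominus>\<^bsub>E\<^esub> a)"
    by blast
qed

text \<open>At each t of U the weighted value is \<pi> a with ||a|| \<le> 1. This one fact gives
  boundedness, the inclusion in the p-convex hull of the images of the unit vectors, and the norm
  bound.\<close>

theorem lift_map_HvK_wp: "lift_map f \<in> HvK_wp p E U v Y"
  and HvK_wp_norm_lift_map: "HvK_wp_norm p U v Y (lift_map f) \<le> 1"
proof -
  have "weighted_range U v Y (lift_map f) \<subseteq> p_conv p Y (\<lambda>n. \<pi> (unit_seq n))"
  proof
    fix y assume "y \<in> weighted_range U v Y (lift_map f)"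
    then obtain t where t: "t \<in> U" "y = complex_of_real (v t) \<odot>\<^bsub>Y\<^esub> lift_map f t"
      by (auto simp: weighted_range_def)
    obtain a where "a \<in> carrier lq" "vnorm lq a \<le> 1" "complex_of_real (v t) \<odot>\<^bsub>Y\<^esub> lift_map f t = \<pi> a"
      using lift_map_coefficients[OF t(1)] by metis
    then show "y \<in> p_conv p Y (\<lambda>n. \<pi> (unit_seq n))" using Y.quotient_in_p_conv[of a] t(2) by simp
  qed
  note sub = this
  have carr: "weighted_range U v Y (lift_map f) \<subseteq> carrier Y"
  proof
    fix y assume "y \<in> weighted_range U v Y (lift_map f)"
    then obtain t where t: "t \<in> U" "y = complex_of_real (v t) \<odot>\<^bsub>Y\<^esub> lift_map f t"
      by (auto simp: weighted_range_def)
    then show "y \<in> carrier Y" using lift_map_coefficients[OF t(1)] by (metis Y.Y.smult_cl)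
  qed
  have "bdd_above ((\<lambda>t. v t * vnorm Y (lift_map f t)) ` U)"
  proof (rule bdd_aboveI2)
    fix t assume t: "t \<in> U"
    obtain a where a: "a \<in> carrier lq" "vnorm lq a \<le> 1"
      "lift_map f t \<in> carrier Y" "complex_of_real (v t) \<odot>\<^bsub>Y\<^esub> lift_map f t = \<pi> a"
      using lift_map_coefficients[OF t] by metis
    have "v t * vnorm Y (lift_map f t) = vnorm Y (\<pi> a)"
      using Y.Y.vnorm_smult[OF a(3), of "complex_of_real (v t)"] a(4) v_pos[OF t] by simp
    then show "v t * vnorm Y (lift_map f t) \<le> 1" using Y.norm_map_le[OF a(1)] a(2) by simp
  qed
  then show "lift_map f \<in> HvK_wp p E U v Y"
    using lift_map_holomorphic sub carr Y.unit_images_weak_lp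
    by (auto simp: HvK_wp_def Hv_inf_def rel_weakly_p_compact_def)
  show "HvK_wp_norm p U v Y (lift_map f) \<le> 1"
    unfolding HvK_wp_norm_def
    using Y.Y.m_Kwp_le[OF Y.unit_images_weak_lp sub] Y.weak_lp_norm_unit_images by simp
qed

end

end

section \<open>Factorization\<close>

lemma (in complex_normed_space) weighted_range_closed:
  "f \<in> U \<rightarrow> carrier X \<Longrightarrow> weighted_range U v X f \<subseteq> carrier X"
  by (auto simp: weighted_range_def)

text \<open>The bound is stated for each admissible sequence separately; the first norm inequality
  follows by taking the infimum over the sequences. T is the copying map from G to H, and
  \<open>Q \<circ> T\<close> agrees with \<open>induced\<close> on G.\<close>

lemma factorization_exists:
  fixes F :: "'f normed_module" and \<iota> :: "(nat \<Rightarrow> complex) \<Rightarrow> 'h"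
  assumes \<iota>: "inj \<iota>" and E: "complex_normed_space E" and F: "complex_banach_space F"
    and U: "openin (norm_topology E) U" and v: "weight_on E U v" and p: "1 < p"
    and hol: "holomorphic_map E U F f" and x: "x \<in> weak_lp p F"
    and range: "weighted_range U v F f \<subseteq> p_conv p F x"
  obtains G and H :: "'h normed_module" and T Q g where "is_factorization p E U v F f G H T Q g"
    "op_norm G F (Q \<circ> T) * HvK_wp_norm p U v G g \<le> weak_lp_norm p F x"
proof -
  interpret weak_lp_sequence F p x
    by (intro weak_lp_sequence.intro F weak_lp_sequence_axioms.intro p x)
  let ?lq = "lp_space (conj_index p)"
  define N where "N = {a \<in> carrier ?lq. synthesis a = \<zero>\<^bsub>F\<^esub>}"
  have "N = {a \<in> carrier ?lq. restrict synthesis (carrier ?lq) a = \<zero>\<^bsub>F\<^esub>}"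
    by (auto simp: N_def)
  then have N: "closed_subspace N ?lq" using lq_F.kernel_closed_subspace[OF synthesis_bounded] by simp
  then have sub: "submodule N complex_scalars ?lq" by (simp add: closed_subspace_def)
  let ?G = "quotient_space ?lq N" and ?\<pi> = "\<lambda>a. N +>\<^bsub>?lq\<^esub> a"
  have \<pi>: "quotient_map ?lq ?G ?\<pi>" by (rule lq.quotient_map_coset[OF N])
  interpret G: synthesis_quotient F p x ?G ?\<pi>
  proof (intro synthesis_quotient.intro lp_quotient.intro lp_quotient_axioms.intro \<pi> p
      synthesis_quotient_axioms.intro)
    show "weak_lp_sequence F p x" by unfold_locales
    fix a b assume a: "a \<in> carrier ?lq" and b: "b \<in> carrier ?lq"
    have "restrict synthesis (carrier ?lq) (a \<ominus>\<^bsub>?lq\<^esub> b)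
        = restrict synthesis (carrier ?lq) a \<ominus>\<^bsub>F\<^esub> restrict synthesis (carrier ?lq) b"
      by (rule lq_F.bop_diff[OF synthesis_bounded a b])
    then have "synthesis (a \<ominus>\<^bsub>?lq\<^esub> b) = synthesis a \<ominus>\<^bsub>F\<^esub> synthesis b"
      using a b lq.diff_closed[OF a b] by (simp only: restrict_apply')
    then have "a \<ominus>\<^bsub>?lq\<^esub> b \<in> N \<longleftrightarrow> synthesis a = synthesis b"
      using lq.diff_closed[OF a b] diff_eq_zero_iff[OF synthesis_closed[OF a] synthesis_closed[OF b]]
      unfolding N_def by (simp only: mem_Collect_eq simp_thms)
    then show "?\<pi> a = ?\<pi> b \<longleftrightarrow> synthesis a = synthesis b"
      using lq.coset_eq_iff[OF sub a b] by blast
  qed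
  \<comment> \<open>A coset is determined by any one of its elements, so an injection of sequences
    into \<open>'h\<close> suffices, although the elements of G are sets of sequences.\<close>
  define j where "j A = \<iota> (SOME a. a \<in> A)" for A
  have rep: "N +>\<^bsub>?lq\<^esub> (SOME a. a \<in> A) = A" if A: "A \<in> carrier ?G" for A
  proof -
    obtain b where b: "b \<in> carrier ?lq" "A = N +>\<^bsub>?lq\<^esub> b" using G.preimage[OF A] by metis
    have "b \<in> A"
      using lq.mem_coset_iff[OF lq.submoduleE(1)[OF sub] b(1)] lq.coset_eq_iff[OF sub b(1) b(1)] b by blast
    then have "(SOME a. a \<in> A) \<in> A" by (rule someI[of "\<lambda>a. a \<in> A"])
    then show ?thesis
      using b lq.mem_coset_iff[OF lq.submoduleE(1)[OF sub] b(1)] lq.coset_eq_iff[OF sub _ b(1)] by blast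
  qed
  have j: "inj_on j (carrier ?G)"
    by (rule inj_onI) (metis rep j_def injD[OF \<iota>])
  let ?H = "transport j ?G"
  interpret H: lp_quotient p ?H "j \<circ> ?\<pi>"
    by (intro lp_quotient.intro lp_quotient_axioms.intro quotient_map_transport j \<pi> p)
  note ts = transport_simps[OF j]
  define T where "T = restrict j (carrier ?G)"
  define Q where "Q = (\<lambda>h\<in>carrier ?H. G.induced (inv_into (carrier ?G) j h))"
  have Qj: "Q (j y) = G.induced y" if "y \<in> carrier ?G" for y
    using that j by (simp add: Q_def ts)
  have T: "T \<in> bounded_operators ?G ?H"
    unfolding T_def
    by (rule bounded_operatorsI[OF G.Y.complex_normed_space_quotient, where C = 1]) (simp_all add: ts)
  have Q: "Q \<in> bounded_operators ?H F"
  proof -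
    have "restrict Q (carrier ?H) \<in> bounded_operators ?H F"
    proof (rule bounded_operatorsI[OF H.complex_normed_space_quotient])
      fix h assume "h \<in> carrier ?H"
      then obtain y where y: "y \<in> carrier ?G" "h = j y" by (auto simp: ts)
      show "Q h \<in> carrier F" using y by (simp add: Qj bop_closed[OF G.induced_bounded])
      show "Q (c \<odot>\<^bsub>?H\<^esub> h) = c \<odot>\<^bsub>F\<^esub> Q h" for c
        using y G.Y.Y.smult_cl[OF y(1)] by (simp add: ts Qj bop_smult[OF G.induced_bounded])
      show "vnorm F (Q h) \<le> weak_lp_norm p F x * vnorm ?H h"
        using y G.induced_norm_le[OF y(1)] by (simp add: ts Qj)
      fix k assume "k \<in> carrier ?H"
      then obtain z where z: "z \<in> carrier ?G" "k = j z" by (auto simp: ts)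
      show "Q (h \<oplus>\<^bsub>?H\<^esub> k) = Q h \<oplus>\<^bsub>F\<^esub> Q k"
        using y z G.Y.Y.M.a_closed[OF y(1) z(1)] by (simp add: ts Qj bop_add[OF G.induced_bounded])
    qed
    then show ?thesis by (simp add: Q_def)
  qed
  have QT: "(Q \<circ> T) y = G.induced y" if "y \<in> carrier ?G" for y
    using that by (simp add: T_def Qj)
  have fact: "is_factorization p E U v F f ?G ?H T Q (G.lift_map f)"
    unfolding is_factorization_def
  proof (intro conjI)
    show "\<exists>N. closed_subspace N ?lq \<and> ?G = quotient_space ?lq N" using N by blast
    show "\<forall>t\<in>U. f t = (Q \<circ> T \<circ> G.lift_map f) t"
    proof
      fix t assume t: "t \<in> U"
      have "G.lift_map f t \<in> carrier ?G" "G.induced (G.lift_map f t) = f t"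
        using G.lift_map_coefficients[OF E U v hol range t] by blast+
      then show "f t = (Q \<circ> T \<circ> G.lift_map f) t" using QT by simp
    qed
  qed (use T Q H.complex_banach_space_quotient H.reflexive G.lift_map_HvK_wp[OF E U v hol range] in auto)
  have "op_norm ?G F (Q \<circ> T) \<le> weak_lp_norm p F x"
    using G.induced_norm_le by (intro G.Y_F.op_norm_le weak_lp_norm_nonneg x) (simp add: QT[unfolded comp_def])
  moreover have "0 \<le> HvK_wp_norm p U v ?G (G.lift_map f)"
    using G.lift_map_HvK_wp[OF E U v hol range] G.Y.Y.m_Kwp_nonneg
    by (simp add: HvK_wp_norm_def HvK_wp_def)
  ultimately have "op_norm ?G F (Q \<circ> T) * HvK_wp_norm p U v ?G (G.lift_map f) \<le> weak_lp_norm p F x * 1"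
    using G.HvK_wp_norm_lift_map[OF E U v hol range] weak_lp_norm_nonneg[OF x] by (intro mult_mono) auto
  with fact show ?thesis using that by simp
qed

text \<open>A sequence y that works for g is mapped by Q and T to one that works for f, with weak
  norm increased at most by the factor ||Q|| ||T||; then the infimum is taken over y. The
  nonnegativity shows that the set in the first infimum of the theorem is bounded below.\<close>

lemma factorization_bounds:
  assumes E: "complex_normed_space E" and F: "complex_banach_space F" and p: "1 < p"
    and f: "f \<in> Hv_inf E U v F" and fact: "is_factorization p E U v F f G H T Q g"
  shows factorization_imp_HvK_wp: "f \<in> HvK_wp p E U v F"
    and HvK_wp_norm_le_factorization:
      "HvK_wp_norm p U v F f \<le> op_norm H F Q * op_norm G H T * HvK_wp_norm p U v G g"
    and factorization_nonneg: "0 \<le> op_norm G F (Q \<circ> T) * HvK_wp_norm p U v G g"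
proof -
  let ?lq = "lp_space (conj_index p)"
  obtain N where N: "closed_subspace N ?lq" and G: "G = quotient_space ?lq N"
    and H: "complex_banach_space H"
    and T: "T \<in> bounded_operators G H" and Q: "Q \<in> bounded_operators H F"
    and g: "g \<in> HvK_wp p E U v G" and fQTg: "\<And>t. t \<in> U \<Longrightarrow> f t = Q (T (g t))"
    using fact unfolding is_factorization_def by auto
  interpret lq: complex_normed_space ?lq
    using conj_index_gt_1[OF p] by (intro complex_normed_space_lp) simp
  interpret \<pi>: quotient_map ?lq G "\<lambda>a. N +>\<^bsub>?lq\<^esub> a"
    unfolding G by (rule lq.quotient_map_coset[OF N])
  interpret H: complex_banach_space H by (rule H)
  interpret F: complex_banach_space F by (rule F)
  interpret F': normed_space_dual F by unfold_locales
  interpret GH: normed_spaces G H by unfold_locales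
  interpret HF: normed_spaces H F by unfold_locales
  interpret GF: normed_spaces G F by unfold_locales
  define C where "C = op_norm H F Q * op_norm G H T"
  have C: "0 \<le> C" using GH.bop_norm_nonneg[OF T] HF.bop_norm_nonneg[OF Q] by (simp add: C_def)
  note compose = bop_compose[OF \<pi>.complex_normed_space_quotient H.complex_normed_space_axioms
      F.complex_normed_space_axioms T Q]
  \<comment> \<open>The composite restricted to the carrier, which makes it an element of
    \<open>bounded_operators\<close>.\<close>
  let ?L = "\<lambda>y\<in>carrier G. Q (T y)"
  have L: "?L \<in> bounded_operators G F" by (rule compose(1))
  have L_le: "vnorm F (?L y) \<le> C * vnorm G y" if "y \<in> carrier G" for y
    using compose(2)[OF that] that by (simp add: C_def)
  have gG: "g \<in> U \<rightarrow> carrier G" and g_compact: "rel_weakly_p_compact p G (weighted_range U v G g)"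
    using g by (auto simp: HvK_wp_def Hv_inf_def holomorphic_map_def)
  have fF: "f \<in> U \<rightarrow> carrier F" using f by (auto simp: Hv_inf_def holomorphic_map_def)
  have push: "(\<lambda>n. ?L (y n)) \<in> weak_lp p F" "weak_lp_norm p F (\<lambda>n. ?L (y n)) \<le> C * weak_lp_norm p G y"
    "weighted_range U v F f \<subseteq> p_conv p F (\<lambda>n. ?L (y n))"
    if y: "y \<in> weak_lp p G" and sub: "weighted_range U v G g \<subseteq> p_conv p G y" for y
  proof -
    show "(\<lambda>n. ?L (y n)) \<in> weak_lp p F" "weak_lp_norm p F (\<lambda>n. ?L (y n)) \<le> C * weak_lp_norm p G y"
      using GF.bop_weak_lp[OF _ L y C L_le] p by auto
    show "weighted_range U v F f \<subseteq> p_conv p F (\<lambda>n. ?L (y n))"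
    proof
      fix w assume "w \<in> weighted_range U v F f"
      then obtain t where t: "t \<in> U" "w = complex_of_real (v t) \<odot>\<^bsub>F\<^esub> f t" by (auto simp: weighted_range_def)
      have gt: "g t \<in> carrier G" using gG t by auto
      have "w = ?L (complex_of_real (v t) \<odot>\<^bsub>G\<^esub> g t)"
        using bop_smult[OF L gt, of "complex_of_real (v t)"] t(2) fQTg[OF t(1)] gt by simp
      moreover have "complex_of_real (v t) \<odot>\<^bsub>G\<^esub> g t \<in> p_conv p G y"
        using sub t by (auto simp: weighted_range_def)
      ultimately show "w \<in> p_conv p F (\<lambda>n. ?L (y n))"
        using GF.bop_p_conv[OF L, of y, OF \<pi>.Y.weak_lp_closed[OF y]] by blast
    qed
  qed
  obtain y where "y \<in> weak_lp p G" "weighted_range U v G g \<subseteq> p_conv p G y"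
    using g_compact by (auto simp: rel_weakly_p_compact_def)
  then have f_compact: "rel_weakly_p_compact p F (weighted_range U v F f)"
    using push F.weighted_range_closed[OF fF] unfolding rel_weakly_p_compact_def by blast
  then show "f \<in> HvK_wp p E U v F" using f by (simp add: HvK_wp_def)
  have le: "HvK_wp_norm p U v F f \<le> C * weak_lp_norm p G y"
    if "y \<in> weak_lp p G" "weighted_range U v G g \<subseteq> p_conv p G y" for y
    unfolding HvK_wp_norm_def
    using F'.m_Kwp_le[OF push(1)[OF that] push(3)[OF that]] push(2)[OF that] by simp
  have "HvK_wp_norm p U v F f \<le> C * HvK_wp_norm p U v G g"
  \<comment> \<open>The factor C is taken out of the infimum by division, so C = 0 has to be treated
    apart; a single admissible sequence settles that case.\<close>
  proof (cases "C = 0")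
    case True
    obtain y where "y \<in> weak_lp p G" "weighted_range U v G g \<subseteq> p_conv p G y"
      using g_compact by (auto simp: rel_weakly_p_compact_def)
    from le[OF this] show ?thesis using True by simp
  next
    case False
    then have C: "0 < C" using C by simp
    have "HvK_wp_norm p U v F f / C \<le> HvK_wp_norm p U v G g"
      unfolding HvK_wp_norm_def[of p U v G]
      using le C by (intro \<pi>.Y.m_Kwp_greatest[OF g_compact]) (simp add: divide_le_eq mult.commute)
    then show ?thesis using C by (simp add: divide_le_eq mult.commute)
  qed
  then show "HvK_wp_norm p U v F f \<le> op_norm H F Q * op_norm G H T * HvK_wp_norm p U v G g"
    by (simp add: C_def)
  have "0 \<le> op_norm G F (Q \<circ> T)"
    by (rule GF.op_norm_nonneg[of _ C]) (use compose(2) bop_closed[OF T] bop_closed[OF Q] in \<open>auto simp: C_def\<close>)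
  moreover have "0 \<le> HvK_wp_norm p U v G g"
    unfolding HvK_wp_norm_def by (rule \<pi>.Y.m_Kwp_nonneg[OF g_compact])
  ultimately show "0 \<le> op_norm G F (Q \<circ> T) * HvK_wp_norm p U v G g" by simp
qed

theorem corollary2p14:
  fixes E :: "'e normed_module" and F :: "'f normed_module"
    and U :: "'e set" and v :: "'e \<Rightarrow> real" and p :: real and f :: "'e \<Rightarrow> 'f"
    and \<iota> :: "(nat \<Rightarrow> complex) \<Rightarrow> 'h"
  assumes universe: "inj \<iota>"
    and "complex_banach_space E" and "complex_banach_space F"
    and "openin (norm_topology E) U" and "weight_on E U v"
    and "1 < p"
    and "f \<in> Hv_inf E U v F"
  shows "(f \<in> HvK_wp p E U v F \<longleftrightarrow>
            (\<exists>G (H :: 'h normed_module) T Q g. is_factorization p E U v F f G H T Q g)) \<and>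
         (f \<in> HvK_wp p E U v F \<longrightarrow>
            Inf {op_norm G F (Q \<circ> T) * HvK_wp_norm p U v G g | G (H :: 'h normed_module) T Q g.
                   is_factorization p E U v F f G H T Q g}
              \<le> HvK_wp_norm p U v F f \<and>
            HvK_wp_norm p U v F f
              \<le> Inf {op_norm H F Q * op_norm G H T * HvK_wp_norm p U v G g |
                      G (H :: 'h normed_module) T Q g. is_factorization p E U v F f G H T Q g})"
proof -
  have E: "complex_normed_space E" using assms(2) by (rule complex_banach_space.axioms)
  interpret F: normed_space_dual F
    using assms(3) by (intro normed_space_dual.intro) (rule complex_banach_space.axioms)
  have hol: "holomorphic_map E U F f" using assms(7) by (simp add: Hv_inf_def)
  note exists = factorization_exists[OF universe E assms(3-6) hol]
  note bounds = factorization_imp_HvK_wp[OF E assms(3,6,7)]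
    HvK_wp_norm_le_factorization[OF E assms(3,6,7)] factorization_nonneg[OF E assms(3,6,7)]
  have fact: "\<exists>G (H :: 'h normed_module) T Q g. is_factorization p E U v F f G H T Q g"
    if f: "f \<in> HvK_wp p E U v F"
  proof -
    obtain x where "x \<in> weak_lp p F" "weighted_range U v F f \<subseteq> p_conv p F x"
      using f by (auto simp: HvK_wp_def rel_weakly_p_compact_def)
    then show ?thesis by (rule exists) blast
  qed
  show ?thesis
  proof (intro conjI impI iffI)
    show "\<exists>G (H :: 'h normed_module) T Q g. is_factorization p E U v F f G H T Q g"
      if "f \<in> HvK_wp p E U v F" by (rule fact[OF that])
    show "f \<in> HvK_wp p E U v F"
      if "\<exists>G (H :: 'h normed_module) T Q g. is_factorization p E U v F f G H T Q g"
      using that bounds(1) by blast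
  next
    assume f: "f \<in> HvK_wp p E U v F"
    let ?A = "{op_norm G F (Q \<circ> T) * HvK_wp_norm p U v G g | G (H :: 'h normed_module) T Q g.
        is_factorization p E U v F f G H T Q g}"
    \<comment> \<open>An element of a set of reals bounds its infimum from above only if the set is
      bounded below.\<close>
    have bdd: "bdd_below ?A" using bounds(3) by (intro bdd_belowI[of _ 0]) blast
    show "Inf ?A \<le> HvK_wp_norm p U v F f"
      unfolding HvK_wp_norm_def[of p U v F]
    \<comment> \<open>The norm of f is itself an infimum over sequences, so it is enough to compare
      with the weak norm of each admissible one.\<close>
    proof (rule F.m_Kwp_greatest)
      show "rel_weakly_p_compact p F (weighted_range U v F f)" using f by (simp add: HvK_wp_def)
      fix x assume "x \<in> weak_lp p F" "weighted_range U v F f \<subseteq> p_conv p F x"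
      then obtain G and H :: "'h normed_module" and T Q g where
        fac: "is_factorization p E U v F f G H T Q g"
        and le: "op_norm G F (Q \<circ> T) * HvK_wp_norm p U v G g \<le> weak_lp_norm p F x"
        by (rule exists)
      have "op_norm G F (Q \<circ> T) * HvK_wp_norm p U v G g \<in> ?A" using fac by blast
      then show "Inf ?A \<le> weak_lp_norm p F x" using cInf_lower[OF _ bdd] le by force
    qed
    show "HvK_wp_norm p U v F f
        \<le> Inf {op_norm H F Q * op_norm G H T * HvK_wp_norm p U v G g |
              G (H :: 'h normed_module) T Q g. is_factorization p E U v F f G H T Q g}"
      \<comment> \<open>\<open>fact\<close> makes the set of products nonempty, as is required for a
        lower bound of its elements to bound the infimum.\<close>
      using fact[OF f] bounds(2) by (intro cInf_greatest) blast+
  qed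
qed

end
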